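(* Let $\lambda:[0,\infty)\to\mathbb R\cup\{\infty\}$ be non-decreasing with $B_\lambda:=\sup\{r\in[0,\infty):\lambda(r)<\infty\}>0$, and let $\mathcal A^\lambda(-1,1)$ be the space of analytic functions defined in the context. 1. The space $\mathcal A^\lambda(-1,1)$ equipped with the norm $\|\cdot\|_{\mathcal A^\lambda(-1,1)}$ is a Banach space. 2. The coefficients $a_n(g)$ of $g\in\mathcal A^\lambda(-1,1)$ with respect to the Chebyshev polynomials satisfy $$|a_n(g)|\le 2\exp(-\lambda^*(|n|))\,\|g\|_{\mathcal A^\lambda(-1,1)},\qquad n\in\mathbb N.$$ 3. If $P_m$ denotes the $L^2$-orthogonal projection onto the space of polynomials of degree $\le m$, then there exist $m_0\in\mathbb N$ and a constant $c_\lambda>0$ such that $$\|(I-P_m)g\|_{L^\infty(-1,1)}\le c_\lambda\exp(-\lambda^*(m))\,\|g\|_{\mathcal A^\lambda(-1,1)}$$ for all $g\in\mathcal A^\lambda(-1,1)$ and $m\ge m_0$. 4. There exists $\delta_0>0$ such that $$\|g\|_{L^\infty(-1,1)}\le\gamma(\delta)\,\|g\|_{\mathcal A^\lambda(-1,1)}+\frac1\delta\|g\|_{L^1(-1,1)},\qquad \gamma(\delta)=c_\lambda\exp\Big(-\lambda^*\Big(\Big\lfloor\sqrt{\tfrac2\delta}\Big\rfloor-1\Big)\Big),$$ for all $g\in\mathcal A^\lambda(-1,1)$ and all $0<\delta\le\delta_0$, where $c_\lambda$ is the constant of part 3.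
   Context: For $r>0$ let $\mathcal E_r=\{x+\mathrm iy\in\mathbb C:x,y\in\mathbb R,\ \frac{x^2}{\cosh(r)^2}+\frac{y^2}{\sinh(r)^2}\le1\}$, the ellipse with foci $\pm1$ (with $\mathcal E_\infty=\mathbb C$). For a real-analytic function $g$ on $(-1,1)$, $\tilde g$ denotes its holomorphic extension. Let $\mathcal A(-1,1)$ be the set of analytic functions on $(-1,1)$ and define $$\mathcal A^\lambda(-1,1):=\{g\in\mathcal A(-1,1):\tilde g\text{ exists on }\mathcal E_{B_\lambda},\ \|g\|_{\mathcal A^\lambda(-1,1)}<\infty\},$$ $$\|g\|_{\mathcal A^\lambda(-1,1)}:=\sup_{0<t<B_\lambda}\Big[\exp(-\lambda(t))\sup_{z\in\partial\mathcal E_t}|\tilde g(z)|\Big].$$ $T_n$ is the $n$-th Chebyshev polynomial, $T_n(\cos s)=\cos(ns)$, and the coefficients $a_n(g)$ are those of the expansion $g=\frac{a_0(g)}2+\sum_{n\in\mathbb N}a_n(g)T_n$. $\lambda^*(s):=\sup_{r\ge0}[rs-\lambda(r)]$ is the Fenchel conjugate of $\lambda$ (extended by $\infty$ on $(-\infty,0)$). $\lfloor x\rfloor$ is the largest integer $\le x$.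
   Formalization: Part 2 is proved for n with λ*(n)>−λ(0), or all n if λ is right-continuous at 0; part 3 holds as written for the Chebyshev-weighted L² projection, and for the unweighted one with c√(m+1)·exp(−λ*(m+1)); g̃ need only exist on the interior of E_{B_λ}. *)

theory Defs
  imports "HOL-Complex_Analysis.Complex_Analysis" "HOL-Probability.Essential_Supremum"
begin

section \<open>Ellipses and the spaces of analytic functions\<close>

definition ellipse :: "ereal \<Rightarrow> complex set" where
  "ellipse r =
    (if r = \<infinity> then UNIV
     else {z. (Re z)\<^sup>2 / (cosh (real_of_ereal r))\<^sup>2 + (Im z)\<^sup>2 / (sinh (real_of_ereal r))\<^sup>2 \<le> 1})"

definition real_analytic :: "(real \<Rightarrow> complex) \<Rightarrow> bool" where
  "real_analytic g \<longleftrightarrow>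
    (\<forall>x0\<in>{-1<..<1}. \<exists>c \<epsilon>. \<epsilon> > 0 \<and>
      (\<forall>x\<in>{-1<..<1}. \<bar>x - x0\<bar> < \<epsilon> \<longrightarrow> (\<lambda>k. c k * of_real (x - x0) ^ k) sums g x))"

text \<open>The weight \<open>lam\<close> has values in the reals extended by \<open>\<infinity>\<close>; only its values on \<open>{0..}\<close> matter.\<close>

definition B_lam :: "(real \<Rightarrow> ereal) \<Rightarrow> ereal" where
  "B_lam lam = (SUP r\<in>{r. 0 \<le> r \<and> lam r < \<infinity>}. ereal r)"

definition lam_star :: "(real \<Rightarrow> ereal) \<Rightarrow> real \<Rightarrow> ereal" where
  "lam_star lam s = (if s < 0 then \<infinity> else (SUP r\<in>{0..}. ereal (r * s) - lam r))"

text \<open>\<open>exp (- x)\<close> for \<open>x\<close> a real number or \<open>\<infinity>\<close>. It is never used at \<open>- \<infinity>\<close>: both \<open>lam\<close> on \<open>{0..}\<close>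
  and \<open>lam_star lam\<close>, which is at least \<open>- lam 0\<close>, avoid that value when \<open>B_lam lam > 0\<close>.\<close>

definition exp_minus :: "ereal \<Rightarrow> real" where
  "exp_minus x = (if x = \<infinity> then 0 else exp (- real_of_ereal x))"

text \<open>The holomorphic extension is taken on the interior of the closed ellipse with parameter
  \<open>B_lam lam\<close> (the whole plane if \<open>B_lam lam = \<infinity>\<close>), which contains every ellipse of smaller parameter.
  With holomorphy up to the boundary the space would not be complete when \<open>B_lam lam < \<infinity>\<close>.\<close>

definition is_hol_ext :: "(real \<Rightarrow> ereal) \<Rightarrow> (real \<Rightarrow> complex) \<Rightarrow> (complex \<Rightarrow> complex) \<Rightarrow> bool" where
  "is_hol_ext lam g h \<longleftrightarrow>
    h holomorphic_on interior (ellipse (B_lam lam)) \<and> (\<forall>x\<in>{-1<..<1}. h (of_real x) = g x)"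

text \<open>By the identity theorem the values on the interior of the ellipse do not depend on the choice.\<close>

definition hol_ext :: "(real \<Rightarrow> ereal) \<Rightarrow> (real \<Rightarrow> complex) \<Rightarrow> complex \<Rightarrow> complex" where
  "hol_ext lam g = (SOME h. is_hol_ext lam g h)"

definition A_enorm :: "(real \<Rightarrow> ereal) \<Rightarrow> (real \<Rightarrow> complex) \<Rightarrow> ereal" where
  "A_enorm lam g =
    (SUP t\<in>{t. 0 < t \<and> ereal t < B_lam lam}.
       ereal (exp_minus (lam t)) *
       (SUP z\<in>frontier (ellipse (ereal t)). ereal (cmod (hol_ext lam g z))))"

text \<open>A function on \<open>(-1,1)\<close> is represented by its extension by zero to the real line, so that
  equality of elements is equality of functions on \<open>(-1,1)\<close>.\<close>

definition A_space :: "(real \<Rightarrow> ereal) \<Rightarrow> (real \<Rightarrow> complex) set" where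
  "A_space lam =
    {g. (\<forall>x. x \<notin> {-1<..<1} \<longrightarrow> g x = 0) \<and> real_analytic g \<and> (\<exists>h. is_hol_ext lam g h) \<and>
        A_enorm lam g < \<infinity>}"

definition A_norm :: "(real \<Rightarrow> ereal) \<Rightarrow> (real \<Rightarrow> complex) \<Rightarrow> real" where
  "A_norm lam g = real_of_ereal (A_enorm lam g)"

text \<open>\<open>V\<close>, with the pointwise operations and the norm \<open>N\<close>, is a complex Banach space.\<close>

definition banach_on :: "('a \<Rightarrow> complex) set \<Rightarrow> (('a \<Rightarrow> complex) \<Rightarrow> real) \<Rightarrow> bool" where
  "banach_on V N \<longleftrightarrow>
    (\<lambda>x. 0) \<in> V \<and>
    (\<forall>f\<in>V. \<forall>g\<in>V. (\<lambda>x. f x + g x) \<in> V) \<and>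
    (\<forall>c. \<forall>f\<in>V. (\<lambda>x. c * f x) \<in> V) \<and>
    (\<forall>f\<in>V. 0 \<le> N f) \<and>
    (\<forall>f\<in>V. N f = 0 \<longleftrightarrow> f = (\<lambda>x. 0)) \<and>
    (\<forall>c. \<forall>f\<in>V. N (\<lambda>x. c * f x) = cmod c * N f) \<and>
    (\<forall>f\<in>V. \<forall>g\<in>V. N (\<lambda>x. f x + g x) \<le> N f + N g) \<and>
    (\<forall>F :: nat \<Rightarrow> 'a \<Rightarrow> complex.
       (\<forall>n. F n \<in> V) \<and> (\<forall>e>0. \<exists>M. \<forall>m\<ge>M. \<forall>n\<ge>M. N (\<lambda>x. F m x - F n x) < e) \<longrightarrow>
       (\<exists>f\<in>V. (\<lambda>n. N (\<lambda>x. F n x - f x)) \<longlonglongrightarrow> 0))"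

section \<open>Chebyshev coefficients\<close>

fun cheb_T :: "nat \<Rightarrow> real poly" where
  "cheb_T 0 = 1"
| "cheb_T (Suc 0) = [:0, 1:]"
| "cheb_T (Suc (Suc n)) = [:0, 2:] * cheb_T (Suc n) - cheb_T n"

lemma poly_cheb_T_cos: "poly (cheb_T n) (cos s) = cos (real n * s)"
proof (induction n rule: cheb_T.induct)
  case (3 n)
  have "cos (real (Suc (Suc n)) * s) + cos (real n * s) = 2 * cos s * cos (real (Suc n) * s)"
  proof -
    have "real (Suc (Suc n)) * s = real (Suc n) * s + s" "real n * s = real (Suc n) * s - s"
      by (simp_all add: algebra_simps)
    then show ?thesis by (simp only: cos_add cos_diff) simp
  qed
  then show ?case using 3 by simp
qed simp_all

text \<open>The expansion \<open>g = a 0 / 2 + (\<Sum>n\<ge>1. a n * T_n)\<close> is understood in the sense of uniform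
  convergence on \<open>(-1,1)\<close>; such an \<open>a\<close> is unique.\<close>

definition cheb_expansion :: "(nat \<Rightarrow> complex) \<Rightarrow> (real \<Rightarrow> complex) \<Rightarrow> bool" where
  "cheb_expansion a g \<longleftrightarrow>
    uniform_limit {-1<..<1}
      (\<lambda>K x. a 0 / 2 + (\<Sum>n=1..K. a n * of_real (poly (cheb_T n) x))) g sequentially"

definition cheb_coeff :: "(real \<Rightarrow> complex) \<Rightarrow> nat \<Rightarrow> complex" where
  "cheb_coeff g = (THE a. cheb_expansion a g)"

section \<open>Norms and orthogonal projections on the interval\<close>

definition unit_lborel :: "real measure" where
  "unit_lborel = restrict_space lborel {-1<..<1}"

text \<open>The weight for which the \<open>T_n\<close> are orthogonal. For the unweighted projection an estimate by
  \<open>exp (- lam_star lam m)\<close> fails, e.g. if \<open>lam\<close> is \<open>0\<close> up to some \<open>b\<close> and \<open>\<infinity>\<close> beyond: there \<open>T_(m+1)\<close> has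
  norm \<open>cosh ((m + 1) * b)\<close>, but its distance to its unweighted projection grows like \<open>sqrt m\<close>.\<close>

definition cheb_measure :: "real measure" where
  "cheb_measure = density unit_lborel (\<lambda>x. ennreal (1 / sqrt (1 - x\<^sup>2)))"

definition Linf_norm :: "(real \<Rightarrow> complex) \<Rightarrow> ereal" where
  "Linf_norm f = esssup unit_lborel (\<lambda>x. ereal (cmod (f x)))"

definition L1_norm :: "(real \<Rightarrow> complex) \<Rightarrow> real" where
  "L1_norm f = (\<integral>x. cmod (f x) \<partial>unit_lborel)"

text \<open>Orthogonal projection in \<open>L\<^sup>2(M)\<close> onto the complex polynomials of degree at most \<open>m\<close>.\<close>

definition L2_proj_poly :: "real measure \<Rightarrow> nat \<Rightarrow> (real \<Rightarrow> complex) \<Rightarrow> complex poly" where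
  "L2_proj_poly M m g =
    (THE p. degree p \<le> m \<and>
       (\<forall>q. degree q \<le> m \<longrightarrow>
          (\<integral>x. (g x - poly p (of_real x)) * cnj (poly q (of_real x)) \<partial>M) = 0))"

definition L2_proj :: "real measure \<Rightarrow> nat \<Rightarrow> (real \<Rightarrow> complex) \<Rightarrow> real \<Rightarrow> complex" where
  "L2_proj M m g x = poly (L2_proj_poly M m g) (of_real x)"

end

theory Submission
  imports Defs
begin

text \<open>
  Composed with the Joukowski map \<open>w \<mapsto> (w + 1 / w) / 2\<close>, which sends the circles \<open>\<bar>w\<bar> = exp t\<close> to the
  boundaries of the ellipses, the holomorphic extension becomes a function on an annulus that is
  invariant under \<open>w \<mapsto> 1 / w\<close>. Cauchy's formula for the annulus gives the Chebyshev expansion, and moving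
  the circle in the integral for the coefficients to radius \<open>exp t\<close> bounds them by
  \<open>2 exp (lam t - n t)\<close> times the norm; the infimum over \<open>t\<close> is the conjugate weight. Completeness is
  the maximum principle together with Weierstrass' theorem on locally uniform limits.

  From some \<open>m0\<close> on the conjugate weight grows at least linearly, so the coefficient bounds decay
  geometrically. Their sum bounds the error of the projection in the Chebyshev weight, which is the
  truncated series. For the unweighted projection, the \<open>j\<close>-th Legendre coefficient does not see the first
  \<open>j\<close> terms of the Chebyshev series, and \<open>\<bar>P j\<bar> \<le> 1\<close> together with \<open>\<parallel>P j\<parallel>\<^sup>2 = 2 / (2 j + 1)\<close>
  costs only a factor \<open>sqrt (2 j + 1)\<close>. For the interpolation inequality the function is expanded in
  Chebyshev polynomials of the second kind, whose coefficients are at most \<open>2 / pi\<close> times the \<open>L1\<close> norm.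
\<close>

section \<open>Confocal ellipses and the Joukowski map\<close>

text \<open>The constant in the interpolation inequality shapes its proof. With \<open>m + 1\<close>
  the floor of \<open>sqrt (2 / \<delta>)\<close>, the \<open>L1\<close> norm may be multiplied by
  at most \<open>(m + 1)^2 / 2\<close>. Chebyshev coefficients are controlled by the integral of
  \<open>cmod (g x) / sqrt (1 - x^2)\<close>, not by the \<open>L1\<close> norm. Legendre
  coefficients would give exactly \<open>(m + 1)^2 / 2\<close>, but their truncation error carries
  \<open>sqrt (m + 1)\<close>, which a merely geometric decay does not absorb. Polynomials of the
  second kind, truncated at \<open>J\<close>, give \<open>(J + 1) (J + 2) / pi\<close>. The other
  obstacle is the radius 0: it takes part in the supremum defining \<open>lam_star\<close>, while
  the norm sees positive radii only. If \<open>lam\<close> jumps at 0, the bounds from positive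
  radii need not yield the factor \<open>exp (lam 0)\<close>. For large arguments the supremum
  exceeds its value at 0, so only small indices are affected. All decay is measured by one ratio
  \<open>q < 1\<close> that depends on \<open>lam\<close> alone, so one constant serves every
  \<open>g\<close> and every large \<open>m\<close>.\<close>

definition ellipse_form :: "real \<Rightarrow> complex \<Rightarrow> real" where
  "ellipse_form t z = (Re z)\<^sup>2 / (cosh t)\<^sup>2 + (Im z)\<^sup>2 / (sinh t)\<^sup>2"

lemma ellipse_ereal: "ellipse (ereal t) = {z. ellipse_form t z \<le> 1}"
  by (simp add: ellipse_def ellipse_form_def)

lemma ellipse_form_nonneg: "0 \<le> ellipse_form t z"
  by (simp add: ellipse_form_def)

lemma ellipse_form_scale: "ellipse_form t (of_real c * z) = c\<^sup>2 * ellipse_form t z"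
  by (simp add: ellipse_form_def power_mult_distrib algebra_simps)

lemma continuous_ellipse_form: "continuous_on S (ellipse_form t)"
  unfolding ellipse_form_def divide_inverse by (intro continuous_intros)

text \<open>By homogeneity of degree 2, a dilation by a factor \<open>c > 1\<close> pushes a point
  of value 1 out of the ellipse, so no open subset contains such a point.\<close>

lemma interior_ellipse: "interior (ellipse (ereal t)) = {z. ellipse_form t z < 1}"
proof (rule interior_unique)
  show "{z. ellipse_form t z < 1} \<subseteq> ellipse (ereal t)"
    by (auto simp: ellipse_ereal)
  show "open {z. ellipse_form t z < 1}"
    by (intro open_Collect_less continuous_ellipse_form continuous_intros)
  fix S assume S: "S \<subseteq> ellipse (ereal t)" "open S"
  show "S \<subseteq> {z. ellipse_form t z < 1}"
  proof
    fix z assume "z \<in> S"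
    then obtain e where e: "e > 0" "ball z e \<subseteq> S" using S(2) openE by blast
    \<comment> \<open>The dilation moves \<open>z\<close> by
      \<open>e * cmod z / (2 * (cmod z + 1)) < e\<close> and so stays in the ball; the added 1
      covers \<open>z = 0\<close>.\<close>
    define c where "c = 1 + e / (2 * (cmod z + 1))"
    have c: "c > 1" using e by (simp add: c_def add_nonneg_pos)
    have "dist z (of_real c * z) = e * (cmod z / (2 * (cmod z + 1)))"
    proof -
      have "z - of_real c * z = of_real (1 - c) * z" by (simp add: algebra_simps)
      then have "dist z (of_real c * z) = \<bar>1 - c\<bar> * cmod z"
        by (metis dist_norm norm_mult norm_of_real)
      moreover have "\<bar>1 - c\<bar> = e / (2 * (cmod z + 1))"
        using e by (simp add: c_def add_nonneg_pos)
      ultimately show ?thesis by simp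
    qed
    also have "\<dots> < e * 1"
      by (rule mult_strict_left_mono) (use e norm_ge_zero[of z] in \<open>simp_all add: divide_less_eq_1_pos add_nonneg_pos del: norm_ge_zero\<close>)
    finally have "of_real c * z \<in> ball z e" by simp
    then have "of_real c * z \<in> ellipse (ereal t)" using e S(1) by blast
    then have "c\<^sup>2 * ellipse_form t z \<le> 1"
      by (simp only: ellipse_ereal mem_Collect_eq ellipse_form_scale)
    moreover have "c\<^sup>2 > 1" using c by (simp add: power2_eq_square less_1_mult)
    ultimately have "ellipse_form t z < 1"
      by (smt (verit) ellipse_form_nonneg mult_cancel_right2 mult_right_mono)
    then show "z \<in> {z. ellipse_form t z < 1}" by simp
  qed
qed

lemma closed_ellipse: "closed (ellipse (ereal t))"
  unfolding ellipse_ereal by (intro closed_Collect_le continuous_ellipse_form continuous_intros)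

lemma frontier_ellipse: "frontier (ellipse (ereal t)) = {z. ellipse_form t z = 1}"
  using interior_ellipse[of t] closed_ellipse[of t]
  by (auto simp: frontier_def ellipse_ereal)

text \<open>Positivity of \<open>t\<close> matters: at \<open>t = 0\<close> the convention for
  division by 0 drops the imaginary part from the form, and the set is a strip.\<close>

lemma bounded_ellipse:
  assumes "0 < t"
  shows "bounded (ellipse (ereal t))"
proof (rule boundedI)
  fix z assume "z \<in> ellipse (ereal t)"
  then have z: "(Re z)\<^sup>2 / (cosh t)\<^sup>2 + (Im z)\<^sup>2 / (sinh t)\<^sup>2 \<le> 1"
    by (simp add: ellipse_ereal ellipse_form_def)
  have "(sinh t)\<^sup>2 > 0" "(cosh t)\<^sup>2 > 0" using assms by simp_all
  with z have "(Re z)\<^sup>2 \<le> (cosh t)\<^sup>2" "(Im z)\<^sup>2 \<le> (sinh t)\<^sup>2"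
    by (smt (verit) divide_le_eq_1_pos zero_le_divide_iff zero_le_power2)+
  then have "\<bar>Re z\<bar> \<le> cosh t" "\<bar>Im z\<bar> \<le> sinh t"
    using assms by (auto simp: abs_le_square_iff[symmetric])
  then show "cmod z \<le> cosh t + sinh t" using cmod_le[of z] by linarith
qed

lemma ellipse_form_strict_antimono:
  assumes "0 < s" "s < t" "ellipse_form s z \<le> 1"
  shows "ellipse_form t z < 1"
proof (cases "z = 0")
  case False
  have sh: "0 < sinh s" "sinh s < sinh t" "0 < cosh s" "cosh s < cosh t"
    using assms cosh_real_strict_mono[of s t] by auto
  have "ellipse_form t z < ellipse_form s z"
  proof -
    have sq: "(sinh s)\<^sup>2 < (sinh t)\<^sup>2" "(cosh s)\<^sup>2 < (cosh t)\<^sup>2" "0 < (sinh s)\<^sup>2" "0 < (cosh s)\<^sup>2"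
      using sh by (auto intro!: power_strict_mono)
    have "(Re z)\<^sup>2 / (cosh t)\<^sup>2 \<le> (Re z)\<^sup>2 / (cosh s)\<^sup>2"
      "(Im z)\<^sup>2 / (sinh t)\<^sup>2 \<le> (Im z)\<^sup>2 / (sinh s)\<^sup>2"
      using sq sh by (auto intro!: divide_left_mono mult_pos_pos power_mono)
    moreover have "Re z \<noteq> 0 \<or> Im z \<noteq> 0" using False by (simp add: complex_eq_iff)
    moreover have "(Re z)\<^sup>2 / (cosh t)\<^sup>2 < (Re z)\<^sup>2 / (cosh s)\<^sup>2" if "Re z \<noteq> 0"
      using sq that by (auto intro!: divide_strict_left_mono mult_pos_pos)
    moreover have "(Im z)\<^sup>2 / (sinh t)\<^sup>2 < (Im z)\<^sup>2 / (sinh s)\<^sup>2" if "Im z \<noteq> 0"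
      using sq that by (auto intro!: divide_strict_left_mono mult_pos_pos)
    ultimately show ?thesis unfolding ellipse_form_def by linarith
  qed
  then show ?thesis using assms by simp
qed (simp add: ellipse_form_def)

lemma ellipse_subset_interior:
  assumes "0 < t" "ereal t < B"
  shows "ellipse (ereal t) \<subseteq> interior (ellipse B)"
proof (cases B)
  case (real b)
  then have "t < b" using assms by simp
  then show ?thesis
    unfolding real interior_ellipse
    using assms ellipse_form_strict_antimono[of t b] by (auto simp: ellipse_ereal)
qed (use assms in \<open>auto simp: ellipse_def\<close>)

text \<open>Moves local questions on the domain to an ellipse of finite parameter below
  \<open>B\<close>, where the norm gives bounds. For finite \<open>B\<close> the form is continuous
  in the parameter; for infinite \<open>B\<close> the choice \<open>sinh t = 1 + cmod z\<close>
  makes both semi-axes exceed \<open>cmod z\<close>.\<close>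

lemma interior_ellipse_exhaust:
  assumes "0 < B" "z \<in> interior (ellipse B)"
  obtains t where "0 < t" "ereal t < B" "ellipse_form t z < 1"
proof (cases B)
  case (real b)
  then have b: "b > 0" "ellipse_form b z < 1" using assms by (auto simp: interior_ellipse)
  have "((\<lambda>t. ellipse_form t z) \<longlongrightarrow> ellipse_form b z) (at_left b)"
    unfolding ellipse_form_def using b by (auto intro!: tendsto_intros)
  then have "eventually (\<lambda>t. ellipse_form t z < 1) (at_left b)"
    using b by (simp add: order_tendsto_iff)
  moreover have "eventually (\<lambda>t. t \<in> {0<..<b}) (at_left b)"
    by (rule eventually_at_leftI[of 0]) (use b in auto)
  ultimately have "eventually (\<lambda>t. t \<in> {0<..<b} \<and> ellipse_form t z < 1) (at_left b)"
    by eventually_elim auto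
  then obtain t where "t \<in> {0<..<b}" "ellipse_form t z < 1"
    using eventually_happens trivial_limit_at_left_real by blast
  then show ?thesis using that[of t] real by auto
next
  case PInf
  define s where "s = 1 + cmod z"
  define t where "t = arsinh s"
  have s: "s > 0" by (simp add: s_def add_pos_nonneg)
  have sh: "sinh t = s" by (simp add: t_def)
  then have t: "t > 0" using s sinh_real_pos_iff by metis
  show ?thesis
  proof (rule that[of t])
    have ch: "cosh t \<ge> s" using sh sinh_le_cosh_real[of t] by linarith
    have "(Re z)\<^sup>2 / (cosh t)\<^sup>2 \<le> (Re z)\<^sup>2 / s\<^sup>2" "(Im z)\<^sup>2 / (sinh t)\<^sup>2 \<le> (Im z)\<^sup>2 / s\<^sup>2"
      using s sh ch by (auto intro!: divide_left_mono power_mono)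
    then have "ellipse_form t z \<le> (cmod z)\<^sup>2 / s\<^sup>2"
      unfolding ellipse_form_def cmod_power2 by (simp add: add_divide_distrib)
    also have "\<dots> < 1"
      using s power_strict_mono[of "cmod z" s 2] by (simp add: s_def)
    finally show "ellipse_form t z < 1" .
  qed (use t PInf in auto)
qed (use assms in auto)

text \<open>The form scales quadratically, so the interior is starlike about 0. Connectedness is
  what the identity theorem for extensions requires.\<close>

lemma connected_interior_ellipse:
  assumes "0 < B"
  shows "connected (interior (ellipse B))"
proof -
  have "starlike (interior (ellipse B))"
    unfolding starlike_def
  proof (intro bexI ballI)
    have 0: "0 \<in> interior (ellipse B)"
      using assms by (cases B) (auto simp: interior_ellipse ellipse_form_def ellipse_def[of \<infinity>])
    then show "0 \<in> interior (ellipse B)" .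
    fix z assume z: "z \<in> interior (ellipse B)"
    show "closed_segment 0 z \<subseteq> interior (ellipse B)"
    proof
      fix y assume "y \<in> closed_segment 0 z"
      then obtain u where u: "0 \<le> u" "u \<le> 1" "y = of_real u * z"
        by (auto simp: in_segment scaleR_conv_of_real)
      from u have "u\<^sup>2 \<le> 1" by (simp add: power_le_one)
      then have *: "u\<^sup>2 * ellipse_form b z \<le> ellipse_form b z" for b
        using mult_right_mono[OF _ ellipse_form_nonneg, of "u\<^sup>2" 1] by simp
      show "y \<in> interior (ellipse B)"
      proof (cases B)
        case (real b)
        then show ?thesis
          using z u *[of b] by (auto simp: interior_ellipse ellipse_form_scale)
      qed (use assms in \<open>auto simp: ellipse_def\<close>)
    qed
  qed
  then show ?thesis by (rule starlike_imp_connected)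
qed

lemma of_real_in_interior_ellipse:
  assumes "0 < B" "\<bar>x\<bar> \<le> 1"
  shows "of_real x \<in> interior (ellipse B)"
proof (cases B)
  case (real b)
  have "cosh b > 1" using real assms cosh_real_strict_mono[of 0 b] by simp
  moreover have "x\<^sup>2 \<le> 1" using assms by (simp add: abs_square_le_1)
  ultimately have "x\<^sup>2 < (cosh b)\<^sup>2" by (smt (verit) one_less_power pos2)
  then show ?thesis using real by (simp add: interior_ellipse ellipse_form_def)
qed (use assms in \<open>auto simp: ellipse_def\<close>)

section \<open>Polar form of the Joukowski map\<close>

definition joukowski :: "complex \<Rightarrow> complex" where
  "joukowski w = (w + 1 / w) / 2"

lemma joukowski_inverse: "joukowski (1 / w) = joukowski w"
  by (simp add: joukowski_def add.commute)

text \<open>For \<open>w = exp (\<tau> + i \<theta>)\<close> the image is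
  \<open>cosh \<tau> cos \<theta> + i sinh \<tau> sin \<theta>\<close>, and \<open>a\<close>,
  \<open>b\<close> are the squares of \<open>cos \<theta>\<close> and \<open>sin \<theta>\<close>.
  As they do not depend on \<open>t\<close>, membership in every ellipse is read off from one pair
  of weights.\<close>

lemma ellipse_form_joukowski:
  assumes "cmod w = exp \<tau>"
  obtains a b where "0 \<le> a" "0 \<le> b" "a + b = 1"
    "\<And>t. ellipse_form t (joukowski w) = (cosh \<tau> / cosh t)\<^sup>2 * a + (sinh \<tau> / sinh t)\<^sup>2 * b"
proof
  let ?r = "exp \<tau>"
  have r: "(Re w)\<^sup>2 + (Im w)\<^sup>2 = ?r\<^sup>2" using assms by (metis cmod_power2)
  show "(Re w / ?r)\<^sup>2 + (Im w / ?r)\<^sup>2 = 1"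
    using r by (simp add: power_divide add_divide_distrib[symmetric])
  have "1 / ?r = exp (-\<tau>)" by (simp add: exp_minus field_simps)
  then have c: "cosh \<tau> = (?r + 1 / ?r) / 2" "sinh \<tau> = (?r - 1 / ?r) / 2"
    by (simp_all add: cosh_def sinh_def)
  have re: "Re (joukowski w) = cosh \<tau> * (Re w / ?r)"
    unfolding c by (simp add: joukowski_def Re_divide r) (simp add: field_simps power2_eq_square)
  have im: "Im (joukowski w) = sinh \<tau> * (Im w / ?r)"
    unfolding c by (simp add: joukowski_def Im_divide r) (simp add: field_simps power2_eq_square)
  show "ellipse_form t (joukowski w) = (cosh \<tau> / cosh t)\<^sup>2 * (Re w / ?r)\<^sup>2 + (sinh \<tau> / sinh t)\<^sup>2 * (Im w / ?r)\<^sup>2" for t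
    unfolding ellipse_form_def re im by (simp add: power_mult_distrib power_divide mult.commute)
qed auto

lemma joukowski_in_frontier_ellipse:
  assumes "cmod w = exp t" "0 < t"
  shows "joukowski w \<in> frontier (ellipse (ereal t))"
proof -
  obtain a b where "a + b = 1"
    "\<And>s. ellipse_form s (joukowski w) = (cosh t / cosh s)\<^sup>2 * a + (sinh t / sinh s)\<^sup>2 * b"
    using ellipse_form_joukowski[OF assms(1)] by blast
  then show ?thesis using assms(2) by (simp add: frontier_ellipse)
qed

text \<open>Here \<open>\<bar>\<tau>\<bar> \<le> t\<close>, so both quotients multiplying the
  weights \<open>a\<close> and \<open>b\<close> are at most 1. Moving contours needs the whole
  closed annulus, not only its boundary.\<close>

lemma joukowski_in_ellipse:
  assumes "exp (-t) \<le> cmod w" "cmod w \<le> exp t" "0 < t"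
  shows "joukowski w \<in> ellipse (ereal t)"
proof -
  have w: "cmod w > 0" using assms(1) exp_gt_zero[of "-t"] by linarith
  define \<tau> where "\<tau> = ln (cmod w)"
  have ex: "cmod w = exp \<tau>" using w by (simp add: \<tau>_def)
  have \<tau>: "\<bar>\<tau>\<bar> \<le> t" using assms ex by auto
  obtain a b where ab: "0 \<le> a" "0 \<le> b" "a + b = 1"
    "\<And>t. ellipse_form t (joukowski w) = (cosh \<tau> / cosh t)\<^sup>2 * a + (sinh \<tau> / sinh t)\<^sup>2 * b"
    using ellipse_form_joukowski[OF ex] by blast
  have "cosh \<tau> \<le> cosh t"
    using \<tau> cosh_real_nonneg_le_iff[of "\<bar>\<tau>\<bar>" t] assms(3) by simp
  then have 1: "(cosh \<tau> / cosh t)\<^sup>2 \<le> 1"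
    by (simp add: abs_square_le_1)
  have "\<bar>sinh \<tau>\<bar> \<le> sinh t"
    using \<tau> by (metis sinh_real_abs sinh_real_le_iff)
  then have 2: "(sinh \<tau> / sinh t)\<^sup>2 \<le> 1"
    using assms(3) by (simp add: abs_square_le_1)
  have "ellipse_form t (joukowski w) \<le> 1 * a + 1 * b"
    unfolding ab(4) by (intro add_mono mult_right_mono 1 2 ab)
  then show ?thesis using ab by (simp add: ellipse_ereal)
qed

section \<open>The Banach space of analytic functions\<close>

lemma real_analytic_holomorphic:
  assumes "h holomorphic_on S" "open S" "\<And>x. x \<in> {-1<..<1} \<Longrightarrow> of_real x \<in> S"
    and "\<And>x. x \<in> {-1<..<1} \<Longrightarrow> h (of_real x) = g x"
  shows "real_analytic g"
  unfolding real_analytic_def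
proof
  fix x0 :: real assume x0: "x0 \<in> {-1<..<1}"
  then obtain e where e: "e > 0" "ball (of_real x0) e \<subseteq> S"
    using assms(2,3) openE by blast
  have "(\<lambda>k. ((deriv ^^ k) h (of_real x0) / fact k) * of_real (x - x0) ^ k) sums g x"
    if "x \<in> {-1<..<1}" "\<bar>x - x0\<bar> < e" for x
  proof -
    have "of_real x \<in> ball (complex_of_real x0) e"
      using that by (simp add: dist_norm del: of_real_diff add: of_real_diff[symmetric] abs_minus_commute)
    then show ?thesis
      using holomorphic_power_series[OF holomorphic_on_subset[OF assms(1) e(2)], of "of_real x"] assms(4) that
      by simp
  qed
  then show "\<exists>c \<epsilon>. \<epsilon> > 0 \<and> (\<forall>x\<in>{-1<..<1}. \<bar>x - x0\<bar> < \<epsilon> \<longrightarrow> (\<lambda>k. c k * of_real (x - x0) ^ k) sums g x)"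
    using e(1) by (intro exI[of _ "\<lambda>k. (deriv ^^ k) h (of_real x0) / fact k"] exI[of _ e]) auto
qed

section \<open>The weighted norm in terms of pointwise bounds\<close>

locale weight =
  fixes lam :: "real \<Rightarrow> ereal"
  assumes lam_not_MInf: "0 \<le> r \<Longrightarrow> lam r \<noteq> -\<infinity>"
    and lam_mono: "mono_on {0..} lam"
    and B_pos: "0 < B_lam lam"
begin

abbreviation lam_domain :: "complex set" where
  "lam_domain \<equiv> interior (ellipse (B_lam lam))"

definition lamr :: "real \<Rightarrow> real" where
  "lamr t = real_of_ereal (lam t)"

text \<open>Some radius beyond \<open>t\<close> has finite weight, and monotonicity passes
  finiteness down to \<open>t\<close>.\<close>

lemma lam_eq_lamr:
  assumes "0 \<le> t" "ereal t < B_lam lam"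
  shows "lam t = ereal (lamr t)"
proof -
  obtain r where "0 \<le> r" "lam r < \<infinity>" "t < r"
    using assms(2) unfolding B_lam_def less_SUP_iff by auto
  moreover from this have "lam t \<le> lam r"
    using assms(1) by (intro mono_onD[OF lam_mono]) auto
  ultimately show ?thesis
    using lam_not_MInf[OF assms(1)] by (cases "lam t") (auto simp: lamr_def)
qed

text \<open>The interval accumulates at 0 inside the connected domain, so the identity theorem
  applies. The choice made in \<open>hol_ext\<close> is therefore harmless on the domain.\<close>

lemma is_hol_ext_unique:
  assumes "is_hol_ext lam g h1" "is_hol_ext lam g h2" "z \<in> lam_domain"
  shows "h1 z = h2 z"
proof -
  let ?U = "complex_of_real ` {-1<..<1}"
  have "h1 z - h2 z = 0"
  proof (rule analytic_continuation[where f = "\<lambda>z. h1 z - h2 z" and U = ?U and \<xi> = 0])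
    show "(\<lambda>z. h1 z - h2 z) holomorphic_on lam_domain"
      using assms by (auto simp: is_hol_ext_def intro!: holomorphic_intros)
    show "connected lam_domain" by (rule connected_interior_ellipse[OF B_pos])
    show "?U \<subseteq> lam_domain" using of_real_in_interior_ellipse[OF B_pos] by auto
    show "0 \<in> lam_domain" using of_real_in_interior_ellipse[OF B_pos, of 0] by simp
    show "0 islimpt ?U"
    proof (rule islimptI)
      fix T :: "complex set" assume "0 \<in> T" "open T"
      then obtain e where e: "e > 0" "ball 0 e \<subseteq> T" using openE by blast
      have "complex_of_real (min e 1 / 2) \<in> ball 0 e"
        using e by (simp only: mem_ball_0 norm_of_real)
      moreover have "min e 1 / 2 \<in> {-1<..<1}" "complex_of_real (min e 1 / 2) \<noteq> 0"
        using e by auto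
      ultimately show "\<exists>y\<in>?U. y \<in> T \<and> y \<noteq> 0"
        using e by blast
    qed
  qed (use assms in \<open>auto simp: is_hol_ext_def\<close>)
  then show ?thesis by simp
qed

lemma is_hol_ext_hol_ext:
  assumes "is_hol_ext lam g h"
  shows "is_hol_ext lam g (hol_ext lam g)"
  unfolding hol_ext_def using someI[of "is_hol_ext lam g"] assms by blast

lemma hol_ext_eq:
  assumes "is_hol_ext lam g h" "z \<in> lam_domain"
  shows "hol_ext lam g z = h z"
  using is_hol_ext_unique is_hol_ext_hol_ext assms by blast

text \<open>For \<open>t\<close> below \<open>B_lam lam\<close> the factor
  \<open>exp_minus (lam t)\<close> is a positive real and can be moved across the inequality. Later
  estimates use these pointwise bounds instead of products of extended reals.\<close>

lemma A_enorm_le_iff: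
  assumes "0 \<le> C"
  shows "A_enorm lam g \<le> ereal C \<longleftrightarrow>
    (\<forall>t. 0 < t \<and> ereal t < B_lam lam \<longrightarrow>
      (\<forall>z\<in>frontier (ellipse (ereal t)). cmod (hol_ext lam g z) \<le> C * exp (lamr t)))"
proof -
  have "ereal (exp_minus (lam t)) * (SUP z\<in>frontier (ellipse (ereal t)). ereal (cmod (hol_ext lam g z))) \<le> ereal C
    \<longleftrightarrow> (\<forall>z\<in>frontier (ellipse (ereal t)). cmod (hol_ext lam g z) \<le> C * exp (lamr t))"
    (is "?L * ?S \<le> _ \<longleftrightarrow> _") if "0 < t" "ereal t < B_lam lam" for t
  proof -
    have L: "?L = ereal (exp (- lamr t))"
      using lam_eq_lamr[of t] that by (simp add: exp_minus_def)
    have "?L * ?S \<le> ereal C \<longleftrightarrow> ?S \<le> ereal C / ?L"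
      unfolding L by (subst ereal_le_divide_pos) (auto simp: mult.commute)
    also have "ereal C / ?L = ereal (C * exp (lamr t))"
      unfolding L by (simp add: exp_minus field_simps)
    finally show ?thesis by (simp add: SUP_le_iff)
  qed
  then show ?thesis unfolding A_enorm_def SUP_le_iff by auto
qed

text \<open>The suprema must be over nonempty sets, since an empty supremum is
  \<open>- \<infinity>\<close>: a radius exists because \<open>B_lam lam > 0\<close>, and the
  Joukowski image of \<open>exp t\<close> lies on its boundary ellipse.\<close>

lemma A_enorm_nonneg: "0 \<le> A_enorm lam g"
proof -
  obtain t where t: "0 < t" "ereal t < B_lam lam"
    using B_pos ereal_dense2[of 0 "B_lam lam"] by auto
  obtain z where z: "z \<in> frontier (ellipse (ereal t))"
    using joukowski_in_frontier_ellipse[of "of_real (exp t)" t] t by auto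
  have "0 \<le> ereal (exp_minus (lam t)) * (SUP z\<in>frontier (ellipse (ereal t)). ereal (cmod (hol_ext lam g z)))"
    by (intro ereal_0_le_mult SUP_upper2[OF z]) (auto simp: exp_minus_def)
  also have "\<dots> \<le> A_enorm lam g"
    unfolding A_enorm_def by (rule SUP_upper) (use t in auto)
  finally show ?thesis .
qed

lemma A_norm_nonneg: "0 \<le> A_norm lam g"
  using A_enorm_nonneg by (simp add: A_norm_def real_of_ereal_pos)

lemma A_enorm_eq_A_norm:
  assumes "g \<in> A_space lam"
  shows "A_enorm lam g = ereal (A_norm lam g)"
  using assms A_enorm_nonneg[of g] by (cases "A_enorm lam g") (auto simp: A_space_def A_norm_def)

lemma is_hol_ext_A_space:
  assumes "g \<in> A_space lam"
  shows "is_hol_ext lam g (hol_ext lam g)"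
  using assms is_hol_ext_hol_ext by (auto simp: A_space_def)

lemma hol_ext_frontier_bound:
  assumes "g \<in> A_space lam" "0 < t" "ereal t < B_lam lam" "z \<in> frontier (ellipse (ereal t))"
  shows "cmod (hol_ext lam g z) \<le> A_norm lam g * exp (lamr t)"
  using A_enorm_le_iff[OF A_norm_nonneg, of g g] A_enorm_eq_A_norm[OF assms(1)] assms by auto

lemma hol_ext_bound:
  assumes "g \<in> A_space lam" "0 < t" "ereal t < B_lam lam" "z \<in> ellipse (ereal t)"
  shows "cmod (hol_ext lam g z) \<le> A_norm lam g * exp (lamr t)"
proof (rule maximum_modulus_frontier[where S = "ellipse (ereal t)" and f = "hol_ext lam g"])
  have hol: "hol_ext lam g holomorphic_on lam_domain"
    using is_hol_ext_A_space[OF assms(1)] by (simp add: is_hol_ext_def)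
  have sub: "ellipse (ereal t) \<subseteq> lam_domain"
    by (rule ellipse_subset_interior) (use assms in auto)
  show "hol_ext lam g holomorphic_on interior (ellipse (ereal t))"
    by (rule holomorphic_on_subset[OF hol]) (use sub interior_subset in blast)
  show "continuous_on (closure (ellipse (ereal t))) (hol_ext lam g)"
    using holomorphic_on_imp_continuous_on[OF holomorphic_on_subset[OF hol sub]] closed_ellipse
    by simp
qed (use assms bounded_ellipse hol_ext_frontier_bound in auto)

text \<open>Any extension \<open>h\<close> may be used for the estimate, since it agrees with
  \<open>hol_ext lam g\<close> on the domain. Closure under the operations and the norm inequalities
  thus come down to one pointwise bound each.\<close>

lemma A_spaceI:
  assumes "is_hol_ext lam g h" "\<And>x. x \<notin> {-1<..<1} \<Longrightarrow> g x = 0" "0 \<le> C"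
    and "\<And>t z. 0 < t \<Longrightarrow> ereal t < B_lam lam \<Longrightarrow> z \<in> frontier (ellipse (ereal t)) \<Longrightarrow>
      cmod (h z) \<le> C * exp (lamr t)"
  shows "g \<in> A_space lam" "A_norm lam g \<le> C"
proof -
  have "A_enorm lam g \<le> ereal C"
    unfolding A_enorm_le_iff[OF assms(3)]
  proof (intro allI impI ballI)
    fix t z assume t: "0 < t \<and> ereal t < B_lam lam" and z: "z \<in> frontier (ellipse (ereal t))"
    have "z \<in> lam_domain"
      using ellipse_subset_interior[of t "B_lam lam"] t z closed_ellipse[of t] frontier_subset_eq by blast
    then show "cmod (hol_ext lam g z) \<le> C * exp (lamr t)"
      using assms(1,4) t z hol_ext_eq by simp
  qed
  moreover have "real_analytic g"
    using assms(1) of_real_in_interior_ellipse[OF B_pos]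
    by (intro real_analytic_holomorphic[of h lam_domain]) (auto simp: is_hol_ext_def)
  ultimately show g: "g \<in> A_space lam"
    using assms(1,2) by (auto simp: A_space_def)
  show "A_norm lam g \<le> C"
    using \<open>A_enorm lam g \<le> ereal C\<close> A_enorm_eq_A_norm[OF g] by simp
qed

lemma A_space_add:
  assumes "f \<in> A_space lam" "g \<in> A_space lam"
  shows "(\<lambda>x. f x + g x) \<in> A_space lam" "A_norm lam (\<lambda>x. f x + g x) \<le> A_norm lam f + A_norm lam g"
proof -
  have *: "is_hol_ext lam (\<lambda>x. f x + g x) (\<lambda>z. hol_ext lam f z + hol_ext lam g z)"
    using is_hol_ext_A_space[OF assms(1)] is_hol_ext_A_space[OF assms(2)]
    by (auto simp: is_hol_ext_def intro!: holomorphic_intros)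
  have 1: "\<And>x. x \<notin> {-1<..<1} \<Longrightarrow> f x + g x = 0"
    using assms by (auto simp: A_space_def)
  have 2: "0 \<le> A_norm lam f + A_norm lam g" using A_norm_nonneg by (simp add: add_nonneg_nonneg)
  have 3: "cmod (hol_ext lam f z + hol_ext lam g z) \<le> (A_norm lam f + A_norm lam g) * exp (lamr t)"
    if "0 < t" "ereal t < B_lam lam" "z \<in> frontier (ellipse (ereal t))" for t z
    using hol_ext_frontier_bound[OF assms(1) that] hol_ext_frontier_bound[OF assms(2) that]
    unfolding distrib_right by (rule norm_triangle_le[OF add_mono])
  show "(\<lambda>x. f x + g x) \<in> A_space lam" "A_norm lam (\<lambda>x. f x + g x) \<le> A_norm lam f + A_norm lam g"
    by (rule A_spaceI[OF * 1 2 3]; assumption)+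
qed

lemma A_space_mult:
  assumes "f \<in> A_space lam"
  shows "(\<lambda>x. c * f x) \<in> A_space lam" "A_norm lam (\<lambda>x. c * f x) \<le> cmod c * A_norm lam f"
proof -
  have *: "is_hol_ext lam (\<lambda>x. c * f x) (\<lambda>z. c * hol_ext lam f z)"
    using is_hol_ext_A_space[OF assms(1)]
    by (auto simp: is_hol_ext_def intro!: holomorphic_intros)
  have 1: "\<And>x. x \<notin> {-1<..<1} \<Longrightarrow> c * f x = 0"
    using assms by (auto simp: A_space_def)
  have 2: "0 \<le> cmod c * A_norm lam f" using A_norm_nonneg by simp
  have 3: "cmod (c * hol_ext lam f z) \<le> (cmod c * A_norm lam f) * exp (lamr t)"
    if "0 < t" "ereal t < B_lam lam" "z \<in> frontier (ellipse (ereal t))" for t z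
    using mult_left_mono[OF hol_ext_frontier_bound[OF assms(1) that], of "cmod c"]
    by (simp only: norm_mult mult.assoc norm_ge_zero)
  show "(\<lambda>x. c * f x) \<in> A_space lam" "A_norm lam (\<lambda>x. c * f x) \<le> cmod c * A_norm lam f"
    by (rule A_spaceI[OF * 1 2 3]; assumption)+
qed

lemma A_space_diff:
  assumes "f \<in> A_space lam" "g \<in> A_space lam"
  shows "(\<lambda>x. f x - g x) \<in> A_space lam"
  using A_space_add(1)[OF assms(1) A_space_mult(1)[OF assms(2), of "-1"]] by simp

lemma hol_ext_diff:
  assumes "f \<in> A_space lam" "g \<in> A_space lam" "z \<in> lam_domain"
  shows "hol_ext lam (\<lambda>x. f x - g x) z = hol_ext lam f z - hol_ext lam g z"
proof (rule hol_ext_eq)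
  show "is_hol_ext lam (\<lambda>x. f x - g x) (\<lambda>z. hol_ext lam f z - hol_ext lam g z)"
    using is_hol_ext_A_space[OF assms(1)] is_hol_ext_A_space[OF assms(2)]
    by (auto simp: is_hol_ext_def intro!: holomorphic_intros)
qed fact

lemma A_norm_mult:
  assumes "f \<in> A_space lam"
  shows "A_norm lam (\<lambda>x. c * f x) = cmod c * A_norm lam f"
proof (cases "c = 0")
  case True
  then show ?thesis
    using A_space_mult(2)[OF assms, of c] A_norm_nonneg[of "\<lambda>x. c * f x"] by simp
next
  case False
  \<comment> \<open>The upper bound, applied with the factor \<open>1 / c\<close>, yields the
    reverse inequality.\<close>
  have "A_norm lam (\<lambda>x. (1 / c) * (c * f x)) \<le> cmod (1 / c) * A_norm lam (\<lambda>x. c * f x)"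
    by (rule A_space_mult(2)[OF A_space_mult(1)[OF assms]])
  then have "cmod c * A_norm lam f \<le> A_norm lam (\<lambda>x. c * f x)"
    using False by (simp add: norm_divide field_simps)
  then show ?thesis using A_space_mult(2)[OF assms, of c] by simp
qed

lemma zero_in_A_space: "(\<lambda>x. 0) \<in> A_space lam" "A_norm lam (\<lambda>x. 0) = 0"
proof -
  have "is_hol_ext lam (\<lambda>x. 0) (\<lambda>z. 0)" by (simp add: is_hol_ext_def)
  from A_spaceI[OF this, of 0] show "(\<lambda>x. 0) \<in> A_space lam" "A_norm lam (\<lambda>x. 0) = 0"
    using A_norm_nonneg[of "\<lambda>x. 0"] by auto
qed

lemma obtain_radius:
  obtains t where "0 < t" "ereal t < B_lam lam"
  using B_pos ereal_dense2[of 0 "B_lam lam"] by auto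

lemma of_real_in_ellipse:
  assumes "\<bar>x\<bar> \<le> 1"
  shows "of_real x \<in> ellipse (ereal t)"
proof -
  have "1 \<le> cosh t" by (rule cosh_real_ge_1)
  then have "1 \<le> (cosh t)\<^sup>2" by simp
  moreover have "x\<^sup>2 \<le> 1" using assms by (simp add: abs_square_le_1)
  ultimately have "x\<^sup>2 \<le> (cosh t)\<^sup>2" by linarith
  then show ?thesis by (simp add: ellipse_ereal ellipse_form_def)
qed

lemma A_space_bounded:
  assumes "g \<in> A_space lam" "0 < t" "ereal t < B_lam lam"
  shows "cmod (g x) \<le> A_norm lam g * exp (lamr t)"
proof (cases "x \<in> {-1<..<1}")
  case True
  then have "hol_ext lam g (of_real x) = g x"
    using is_hol_ext_A_space[OF assms(1)] by (simp add: is_hol_ext_def)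
  then show ?thesis
    using hol_ext_bound[OF assms of_real_in_ellipse[of x]] True by auto
next
  case False
  then show ?thesis using assms A_norm_nonneg by (simp add: A_space_def)
qed

lemma A_norm_eq_0:
  assumes "g \<in> A_space lam" "A_norm lam g = 0"
  shows "g = (\<lambda>x. 0)"
proof -
  obtain t where "0 < t" "ereal t < B_lam lam" by (rule obtain_radius)
  from A_space_bounded[OF assms(1) this] have "cmod (g x) \<le> 0" for x unfolding assms(2) by simp
  then show ?thesis by (intro ext) simp
qed

text \<open>The extensions are uniformly Cauchy on every closed ellipse below the critical
  parameter. The bounds for \<open>F n - F m\<close> survive the limit in \<open>m\<close>, which
  puts \<open>F n - f\<close> into the space with small norm.\<close>

lemma A_space_complete:
  fixes F :: "nat \<Rightarrow> real \<Rightarrow> complex"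
  assumes F: "\<And>n. F n \<in> A_space lam"
    and Cauchy: "\<And>e. e > 0 \<Longrightarrow> \<exists>M. \<forall>m\<ge>M. \<forall>n\<ge>M. A_norm lam (\<lambda>x. F m x - F n x) < e"
  shows "\<exists>f\<in>A_space lam. (\<lambda>n. A_norm lam (\<lambda>x. F n x - f x)) \<longlonglongrightarrow> 0"
proof -
  define h where "h n = hol_ext lam (F n)" for n
  \<comment> \<open>Outside the domain this \<open>lim\<close> may be an unspecified value; it is
    evaluated only on the ellipses, where the sequence converges.\<close>
  define H where "H z = lim (\<lambda>n. h n z)" for z
  have h: "is_hol_ext lam (F n) (h n)" for n
    unfolding h_def by (rule is_hol_ext_A_space[OF F])
  have diff: "cmod (h m z - h n z) \<le> A_norm lam (\<lambda>x. F m x - F n x) * exp (lamr t)"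
    if "0 < t" "ereal t < B_lam lam" "z \<in> ellipse (ereal t)" for m n t z
  proof -
    have "z \<in> lam_domain" using ellipse_subset_interior[of t] that by auto
    then show ?thesis
      using hol_ext_bound[OF A_space_diff[OF F F] that, of m n] hol_ext_diff[OF F F]
      by (simp add: h_def)
  qed
  have lim: "uniform_limit (ellipse (ereal t)) h H sequentially"
    if t: "0 < t" "ereal t < B_lam lam" for t
  proof -
    have "uniformly_Cauchy_on (ellipse (ereal t)) h"
      unfolding uniformly_Cauchy_on_def
    proof (intro allI impI)
      fix e :: real assume "e > 0"
      then obtain M where M: "\<forall>m\<ge>M. \<forall>n\<ge>M. A_norm lam (\<lambda>x. F m x - F n x) < e / exp (lamr t)"
        using Cauchy[of "e / exp (lamr t)"] by auto
      show "\<exists>M. \<forall>x\<in>ellipse (ereal t). \<forall>m\<ge>M. \<forall>n\<ge>M. dist (h m x) (h n x) < e"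
      proof (intro exI[of _ M] ballI allI impI)
        fix z m n assume z: "z \<in> ellipse (ereal t)" and "m \<ge> M" "n \<ge> M"
        then have "A_norm lam (\<lambda>x. F m x - F n x) * exp (lamr t) < e"
          using M by (simp add: field_simps)
        then show "dist (h m z) (h n z) < e"
          using diff[OF t z, of m n] by (simp add: dist_norm)
      qed
    qed
    then show ?thesis
      unfolding H_def by (simp add: Cauchy_uniformly_convergent flip: uniformly_convergent_uniform_limit_iff)
  qed
  have hol: "H holomorphic_on lam_domain"
  proof (rule holomorphic_uniform_sequence)
    show "h n holomorphic_on lam_domain" for n using h by (simp add: is_hol_ext_def)
    fix z assume "z \<in> lam_domain"
    then obtain t where t: "0 < t" "ereal t < B_lam lam" "ellipse_form t z < 1"
      using interior_ellipse_exhaust[OF B_pos] by blast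
    then have "z \<in> interior (ellipse (ereal t))" by (simp add: interior_ellipse)
    then obtain d where d: "d > 0" "cball z d \<subseteq> interior (ellipse (ereal t))"
      using open_contains_cball[of "interior (ellipse (ereal t))"] open_interior by metis
    then have "cball z d \<subseteq> ellipse (ereal t)" using interior_subset by blast
    then have "uniform_limit (cball z d) h H sequentially" "cball z d \<subseteq> lam_domain"
      using t ellipse_subset_interior[of t "B_lam lam"] uniform_limit_on_subset[OF lim[of t]] by blast+
    then show "\<exists>d>0. cball z d \<subseteq> lam_domain \<and> uniform_limit (cball z d) h H sequentially"
      using d(1) by blast
  qed simp
  define f where "f x = (if x \<in> {-1<..<1} then H (of_real x) else 0)" for x :: real
  have f: "is_hol_ext lam f H"
    using hol by (simp add: is_hol_ext_def f_def)
  have conv: "\<exists>M. \<forall>n\<ge>M. (\<lambda>x. F n x - f x) \<in> A_space lam \<and> A_norm lam (\<lambda>x. F n x - f x) \<le> e"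
    if e0: "e > 0" for e
  proof -
    obtain M where M: "\<forall>m\<ge>M. \<forall>n\<ge>M. A_norm lam (\<lambda>x. F m x - F n x) < e"
      using Cauchy[OF e0] by blast
    have "(\<lambda>x. F n x - f x) \<in> A_space lam \<and> A_norm lam (\<lambda>x. F n x - f x) \<le> e" if "n \<ge> M" for n
    proof -
      have *: "is_hol_ext lam (\<lambda>x. F n x - f x) (\<lambda>z. h n z - H z)"
        using f h[of n] by (auto simp: is_hol_ext_def intro!: holomorphic_intros)
      have 1: "\<And>x. x \<notin> {-1<..<1} \<Longrightarrow> F n x - f x = 0"
        using F[of n] by (auto simp: A_space_def f_def)
      have 2: "cmod (h n z - H z) \<le> e * exp (lamr t)"
        if t: "0 < t" "ereal t < B_lam lam" and "z \<in> frontier (ellipse (ereal t))" for t z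
      proof -
        have z: "z \<in> ellipse (ereal t)"
          using that frontier_subset_eq[of "ellipse (ereal t)"] closed_ellipse by auto
        have "(\<lambda>m. h m z) \<longlonglongrightarrow> H z"
          using tendsto_uniform_limitI[OF lim[OF t] z] .
        then have "(\<lambda>m. cmod (h n z - h m z)) \<longlonglongrightarrow> cmod (h n z - H z)"
          by (intro tendsto_intros)
        moreover have "\<forall>m\<ge>M. cmod (h n z - h m z) \<le> e * exp (lamr t)"
        proof (intro allI impI)
          fix m assume "m \<ge> M"
          then have "A_norm lam (\<lambda>x. F n x - F m x) \<le> e" using M \<open>n \<ge> M\<close> by (meson less_imp_le)
          then show "cmod (h n z - h m z) \<le> e * exp (lamr t)"
            using diff[OF t z, of n m] by (meson exp_ge_zero mult_right_mono order_trans)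
        qed
        ultimately show ?thesis by (meson LIMSEQ_le_const2)
      qed
      show ?thesis using A_spaceI[OF * 1 less_imp_le[OF e0] 2] by auto
    qed
    then show ?thesis by blast
  qed
  obtain M where "(\<lambda>x. F M x - f x) \<in> A_space lam"
    using conv[of 1] by auto
  \<comment> \<open>Membership of \<open>f\<close> comes from \<open>f = F M - (F M - f)\<close>,
    both terms being in the space.\<close>
  from A_space_diff[OF F[of M] this] have "f \<in> A_space lam" by simp
  moreover have "(\<lambda>n. A_norm lam (\<lambda>x. F n x - f x)) \<longlonglongrightarrow> 0"
  proof (rule LIMSEQ_I)
    fix e :: real assume "e > 0"
    then obtain M where "\<forall>n\<ge>M. A_norm lam (\<lambda>x. F n x - f x) \<le> e / 2"
      using conv[of "e / 2"] by auto
    then have "\<forall>n\<ge>M. norm (A_norm lam (\<lambda>x. F n x - f x) - 0) < e"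
      using \<open>e > 0\<close> A_norm_nonneg by (smt (verit) real_norm_def field_sum_of_halves)
    then show "\<exists>M. \<forall>n\<ge>M. norm (A_norm lam (\<lambda>x. F n x - f x) - 0) < e" ..
  qed
  ultimately show ?thesis by blast
qed

lemma banach_on_A_space: "banach_on (A_space lam) (A_norm lam)"
  unfolding banach_on_def
proof (intro conjI ballI allI impI)
  fix f assume "f \<in> A_space lam"
  then show "A_norm lam f = 0 \<longleftrightarrow> f = (\<lambda>x. 0)"
    using A_norm_eq_0 zero_in_A_space(2) by blast
next
  fix F :: "nat \<Rightarrow> real \<Rightarrow> complex"
  assume "(\<forall>n. F n \<in> A_space lam) \<and>
    (\<forall>e>0. \<exists>M. \<forall>m\<ge>M. \<forall>n\<ge>M. A_norm lam (\<lambda>x. F m x - F n x) < e)"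
  then show "\<exists>f\<in>A_space lam. (\<lambda>n. A_norm lam (\<lambda>x. F n x - f x)) \<longlonglongrightarrow> 0"
    by (intro A_space_complete) auto
qed (rule zero_in_A_space A_space_add A_space_mult(1) A_norm_mult A_norm_nonneg; assumption)+

end

section \<open>Chebyshev coefficients as contour integrals\<close>

lemma contour_integral_circlepath_annulus:
  assumes "f holomorphic_on S" "open S" "0 < r" "r \<le> R"
    and sub: "\<And>u. r \<le> cmod u \<Longrightarrow> cmod u \<le> R \<Longrightarrow> u \<in> S"
  shows "contour_integral (circlepath 0 r) f = contour_integral (circlepath 0 R) f"
proof (rule Cauchy_theorem_homotopic_loops[OF _ assms(2,1)])
  show "homotopic_loops S (circlepath 0 r) (circlepath 0 R)"
  proof (rule homotopic_loops_linear)
    fix t :: real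
    show "closed_segment (circlepath 0 r t) (circlepath 0 R t) \<subseteq> S"
    proof
      fix y assume "y \<in> closed_segment (circlepath 0 r t) (circlepath 0 R t)"
      then obtain u where u: "0 \<le> u" "u \<le> 1"
        "y = of_real ((1 - u) * r + u * R) * exp (2 * of_real pi * \<i> * of_real t)"
        by (auto simp: in_segment circlepath scaleR_conv_of_real algebra_simps)
      have "cmod y = \<bar>(1 - u) * r + u * R\<bar>"
        unfolding u(3) norm_mult norm_of_real by (simp add: norm_exp_eq_Re)
      moreover have "(1 - u) * r + u * R = r + u * (R - r)" by (simp add: algebra_simps)
      moreover have "0 \<le> u * (R - r)" "u * (R - r) \<le> 1 * (R - r)"
        using u assms(4) mult_right_mono[of u 1 "R - r"] by auto
      ultimately show "y \<in> S" using assms(3) by (intro sub) auto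
    qed
  qed auto
qed auto

lemma integral_reflect01:
  fixes f :: "real \<Rightarrow> 'a::euclidean_space"
  shows "integral {0..1} (\<lambda>x. f (1 - x)) = integral {0..1} f"
proof -
  have "(f has_integral i) {0..1} \<Longrightarrow> ((\<lambda>x. f (1 - x)) has_integral i) {0..1}" for i and f :: "real \<Rightarrow> 'a"
    using has_integral_affinity[of f i 0 1 "-1" 1]
    by (simp add: image_affinity_atLeastAtMost algebra_simps)
  from this this[of "\<lambda>x. f (1 - x)"] have "(f has_integral i) {0..1} \<longleftrightarrow> ((\<lambda>x. f (1 - x)) has_integral i) {0..1}" for i
    by auto
  then show ?thesis by (simp add: integral_def integrable_on_def)
qed

text \<open>The substitution \<open>u = 1 / v\<close> gives \<open>du = - dv / v^2\<close> and also
  reverses the orientation of the circle; the two signs cancel. The reversal is the reflection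
  \<open>x \<mapsto> 1 - x\<close> of the parameter interval.\<close>

lemma contour_integral_circlepath_inverse:
  assumes "0 < r"
  shows "contour_integral (circlepath 0 (1 / r)) f = contour_integral (circlepath 0 r) (\<lambda>v. f (1 / v) / v\<^sup>2)"
proof -
  define e where "e x = exp (2 * of_real pi * \<i> * of_real x)" for x :: real
  have e1: "e (1 - x) = 1 / e x" for x
    unfolding e_def by (simp add: exp_diff algebra_simps)
  have ne: "e x \<noteq> 0" for x by (simp add: e_def)
  have "contour_integral (circlepath 0 (1 / r)) f = integral {0..1} (\<lambda>x. f (of_real (1 / r) * e x) * (2 * of_real pi * \<i> * of_real (1 / r) * e x))"
    unfolding contour_integral_integral vector_derivative_circlepath by (simp add: circlepath e_def mult_ac)
  also have "\<dots> = integral {0..1} (\<lambda>x. f (of_real (1 / r) * e (1 - x)) * (2 * of_real pi * \<i> * of_real (1 / r) * e (1 - x)))"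
    by (rule integral_reflect01[symmetric])
  also have "\<dots> = integral {0..1} (\<lambda>x. f (1 / (of_real r * e x)) / (of_real r * e x)\<^sup>2 * (2 * of_real pi * \<i> * of_real r * e x))"
    using assms ne by (intro integral_cong) (simp add: e1 field_simps power2_eq_square)
  also have "\<dots> = contour_integral (circlepath 0 r) (\<lambda>v. f (1 / v) / v\<^sup>2)"
    unfolding contour_integral_integral vector_derivative_circlepath by (simp add: circlepath e_def mult_ac)
  finally show ?thesis .
qed

lemma contour_integrable_circlepath_holomorphic:
  assumes "f holomorphic_on S" "sphere 0 r \<subseteq> S" "0 \<le> r"
  shows "f contour_integrable_on circlepath 0 r"
  using holomorphic_on_imp_continuous_on[OF holomorphic_on_subset[OF assms(1,2)]] assms(3)
  by (intro contour_integrable_continuous_circlepath) simp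

text \<open>The difference quotient \<open>f\<close> is holomorphic across \<open>w\<close>, so its
  integrals over the two circles agree. What remains is \<open>G w\<close> times
  \<open>2 * pi * \<i>\<close> times the winding numbers, 1 for the outer and 0 for the inner
  circle.\<close>

lemma Cauchy_integral_annulus:
  assumes G: "G holomorphic_on S" "open S" "1 < r" and w: "cmod w = 1"
    and sub: "\<And>u. 1 / r \<le> cmod u \<Longrightarrow> cmod u \<le> r \<Longrightarrow> u \<in> S"
  shows "contour_integral (circlepath 0 r) (\<lambda>u. G u / (u - w))
    - contour_integral (circlepath 0 (1 / r)) (\<lambda>u. G u / (u - w)) = 2 * of_real pi * \<i> * G w"
proof -
  define f where "f u = (if u = w then deriv G w else (G u - G w) / (u - w))" for u
  have f: "f holomorphic_on S"
    unfolding f_def by (rule pole_lemma_open[OF G(1,2)])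
  have r: "1 / r < 1" "1 / r \<le> r" using G(3) by (simp_all add: field_simps order_less_imp_le less_1_mult)
  have eq: "contour_integral (circlepath 0 (1 / r)) f = contour_integral (circlepath 0 r) f"
    by (rule contour_integral_circlepath_annulus[OF f G(2)]) (use G(3) r sub in auto)
  have int: "contour_integral (circlepath 0 s) (\<lambda>u. G u / (u - w)) =
      contour_integral (circlepath 0 s) f + G w * contour_integral (circlepath 0 s) (\<lambda>u. 1 / (u - w))"
    if s: "s = r \<or> s = 1 / r" for s
  proof -
    have s': "s > 0" "s \<noteq> 1" "sphere 0 s \<subseteq> S" using s G(3) r sub by auto
    have "contour_integral (circlepath 0 s) (\<lambda>u. G u / (u - w)) =
        contour_integral (circlepath 0 s) (\<lambda>u. f u + G w * (1 / (u - w)))"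
    proof (rule contour_integral_eq)
      fix u assume "u \<in> path_image (circlepath 0 s)"
      then have "u \<noteq> w" using s' w by auto
      then show "G u / (u - w) = f u + G w * (1 / (u - w))" by (simp add: f_def diff_divide_distrib)
    qed
    also have "\<dots> = contour_integral (circlepath 0 s) f + contour_integral (circlepath 0 s) (\<lambda>u. G w * (1 / (u - w)))"
      using s' w
      by (intro contour_integral_add contour_integrable_circlepath_holomorphic[OF f]
            contour_integrable_circlepath_holomorphic[where S = "- {w}"]) (auto intro!: holomorphic_intros)
    also have "contour_integral (circlepath 0 s) (\<lambda>u. G w * (1 / (u - w))) =
        G w * contour_integral (circlepath 0 s) (\<lambda>u. 1 / (u - w))"
      using s' w
      by (intro contour_integral_lmul contour_integrable_circlepath_holomorphic[where S = "- {w}"])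
        (auto intro!: holomorphic_intros)
    finally show ?thesis .
  qed
  have "contour_integral (circlepath 0 r) (\<lambda>u. 1 / (u - w)) = 2 * of_real pi * \<i>"
    using Cauchy_integral_circlepath_simple[of "\<lambda>_. 1" 0 r w] G(3) w
    by (intro contour_integral_unique) auto
  moreover have "contour_integral (circlepath 0 (1 / r)) (\<lambda>u. 1 / (u - w)) = 0"
    by (rule contour_integral_unique, rule Cauchy_theorem_convex_simple[where S = "ball 0 1"])
      (use w r G(3) in \<open>auto intro!: holomorphic_intros\<close>)
  ultimately show ?thesis using int[of r] int[of "1 / r"] eq by simp
qed

text \<open>Geometric series with exact remainder: only a finite sum has to be integrated termwise,
  and the remainder is estimated by itself.\<close>

lemma geometric_resolvent:
  fixes v w :: "'a :: field"
  assumes "v \<noteq> 0" "v \<noteq> w"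
  shows "1 / (v - w) = (\<Sum>k\<le>K. w ^ k / v ^ Suc k) + (w / v) ^ Suc K / (v - w)"
proof (induction K)
  case 0
  show ?case using assms by (simp add: field_simps)
next
  case (Suc K)
  have "(w / v) ^ Suc K / (v - w) = w ^ Suc K / v ^ Suc (Suc K) + (w / v) ^ Suc (Suc K) / (v - w)"
    using assms by (simp add: field_simps)
  then show ?case using Suc by (simp add: add.assoc)
qed

text \<open>With \<open>u = exp (i s)\<close> this is \<open>1 / pi\<close> times the integral of
  \<open>h (cos s) exp (- i n s)\<close> over a period, the usual Chebyshev coefficient. Dividing by
  \<open>pi * \<i>\<close> instead of \<open>2 * pi * \<i>\<close> accounts for the factor 2 in the
  bounds and the half in the constant term.\<close>

definition joukowski_coeff :: "(complex \<Rightarrow> complex) \<Rightarrow> nat \<Rightarrow> complex" where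
  "joukowski_coeff h n = contour_integral (circlepath 0 1) (\<lambda>u. h (joukowski u) / u ^ Suc n) / (of_real pi * \<i>)"

context
  fixes h :: "complex \<Rightarrow> complex" and D :: "complex set" and t M :: real
  assumes h: "h holomorphic_on D" and D: "open D" and t: "0 < t"
    and sub: "ellipse (ereal t) \<subseteq> D" and M: "\<And>z. z \<in> ellipse (ereal t) \<Longrightarrow> cmod (h z) \<le> M"
begin

text \<open>\<open>S\<close> contains the closed annulus that is mapped into the ellipse. The point
  0 has to be removed, since \<open>1 / 0 = 0\<close> gives \<open>joukowski 0\<close> the spurious
  value 0.\<close>

lemma joukowski_domain:
  defines "S \<equiv> {u. u \<noteq> 0 \<and> joukowski u \<in> D}"
  shows "open S" "(\<lambda>u. h (joukowski u)) holomorphic_on S" "0 \<notin> S"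
    "\<And>u. 1 / exp t \<le> cmod u \<Longrightarrow> cmod u \<le> exp t \<Longrightarrow> u \<in> S"
    "\<And>u. 1 \<le> cmod u \<Longrightarrow> cmod u \<le> exp t \<Longrightarrow> u \<in> S"
proof -
  have hol: "joukowski holomorphic_on - {0}"
    unfolding joukowski_def by (auto intro!: holomorphic_intros)
  have S: "S = - {0} \<inter> joukowski -` D" by (auto simp: S_def)
  show "open S" unfolding S
    by (intro continuous_open_preimage holomorphic_on_imp_continuous_on hol D) auto
  show "(\<lambda>u. h (joukowski u)) holomorphic_on S"
    using holomorphic_on_compose_gen[OF holomorphic_on_subset[OF hol, of S] h]
    by (auto simp: S_def o_def)
  show "u \<in> S" if "1 / exp t \<le> cmod u" "cmod u \<le> exp t" for u
  proof -
    have "cmod u > 0" using that(1) exp_gt_zero[of t] by (smt (verit) divide_pos_pos)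
    then show ?thesis
      using that joukowski_in_ellipse[of t u] t sub by (auto simp: S_def exp_minus inverse_eq_divide)
  qed
  then show "u \<in> S" if "1 \<le> cmod u" "cmod u \<le> exp t" for u
    using that t by (smt (verit) divide_le_eq_1 one_le_exp_iff)
qed (auto simp: S_def)

lemma joukowski_coeff_has_contour_integral:
  "((\<lambda>u. h (joukowski u) / u ^ Suc n) has_contour_integral (of_real pi * \<i> * joukowski_coeff h n)) (circlepath 0 (exp t))"
proof -
  let ?S = "{u. u \<noteq> 0 \<and> joukowski u \<in> D}"
  have hol: "(\<lambda>u. h (joukowski u) / u ^ Suc n) holomorphic_on ?S"
    by (intro holomorphic_intros joukowski_domain) auto
  have e: "1 / exp t < 1" "1 < exp t" using t by auto
  have "contour_integral (circlepath 0 1) (\<lambda>u. h (joukowski u) / u ^ Suc n) =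
      contour_integral (circlepath 0 (exp t)) (\<lambda>u. h (joukowski u) / u ^ Suc n)"
    by (rule contour_integral_circlepath_annulus[OF hol joukowski_domain(1)]) (use e joukowski_domain(5) in auto)
  moreover have "(\<lambda>u. h (joukowski u) / u ^ Suc n) contour_integrable_on circlepath 0 (exp t)"
    by (rule contour_integrable_circlepath_holomorphic[OF hol]) (use e joukowski_domain(5) in auto)
  ultimately show ?thesis
    unfolding joukowski_coeff_def by (simp add: has_contour_integral_integral)
qed

lemma joukowski_bound: "cmod u = exp t \<Longrightarrow> cmod (h (joukowski u)) \<le> M"
  using joukowski_in_ellipse[of t u] t by (intro M) auto

text \<open>The integrand is at most \<open>M / exp t ^ Suc n\<close>, and the length
  \<open>2 * pi * exp t\<close> of the circle cancels one power.\<close>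

lemma cmod_joukowski_coeff_le: "cmod (joukowski_coeff h n) \<le> 2 * M * exp (- (real n * t))"
proof -
  have M0: "0 \<le> M" using joukowski_bound[of "of_real (exp t)"] norm_ge_zero order_trans by (metis abs_exp_cancel norm_of_real)
  have "cmod (of_real pi * \<i> * joukowski_coeff h n) \<le> M / exp t ^ Suc n * (2 * pi * exp t)"
    by (rule has_contour_integral_bound_circlepath[OF joukowski_coeff_has_contour_integral])
      (use joukowski_bound M0 in \<open>auto simp: norm_divide norm_mult norm_power intro!: divide_right_mono\<close>)
  also have "\<dots> = pi * (2 * M / exp t ^ n)" by simp
  finally have "pi * cmod (joukowski_coeff h n) \<le> pi * (2 * M / exp t ^ n)" by (simp add: norm_mult)
  then have "cmod (joukowski_coeff h n) \<le> 2 * M / exp t ^ n" by (rule mult_left_le_imp_le) simp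
  also have "\<dots> = 2 * M * exp (- (real n * t))"
    by (simp add: exp_of_nat_mult exp_minus divide_inverse)
  finally show ?thesis .
qed

text \<open>Invariance under inversion folds the inner circle of Cauchy's formula onto the outer
  one. The resulting kernel is symmetric in \<open>w\<close> and \<open>1 / w\<close>, so its
  expansion contains only the sums \<open>w ^ n + (1 / w) ^ n\<close>, that is, Chebyshev
  polynomials.\<close>

lemma joukowski_has_contour_integral:
  assumes w: "cmod w = 1"
  shows "((\<lambda>v. h (joukowski v) * (1 / (v - w) + 1 / (v - 1 / w) - 1 / v)) has_contour_integral
     2 * of_real pi * \<i> * h (joukowski w)) (circlepath 0 (exp t))"
proof -
  let ?S = "{u. u \<noteq> 0 \<and> joukowski u \<in> D}" and ?G = "\<lambda>u. h (joukowski u)"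
  have e: "1 / exp t < 1" "1 < exp t" using t by auto
  have w0: "w \<noteq> 0" "cmod (1 / w) = 1" using w by (auto simp: norm_divide)
  have holS: "sphere 0 (exp t) \<subseteq> ?S - {w, 1 / w}"
    using joukowski_domain(5) e w w0(2) by (auto simp del: norm_divide)
  have i1: "(\<lambda>v. ?G v / (v - w)) contour_integrable_on circlepath 0 (exp t)"
    by (rule contour_integrable_circlepath_holomorphic[OF _ holS])
      (auto intro!: holomorphic_intros holomorphic_on_subset[OF joukowski_domain(2)])
  have i2: "(\<lambda>v. ?G v * (1 / v - 1 / (v - 1 / w))) contour_integrable_on circlepath 0 (exp t)"
    by (rule contour_integrable_circlepath_holomorphic[OF _ holS])
      (auto intro!: holomorphic_intros holomorphic_on_subset[OF joukowski_domain(2)])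
  have "contour_integral (circlepath 0 (1 / exp t)) (\<lambda>u. ?G u / (u - w)) =
      contour_integral (circlepath 0 (exp t)) (\<lambda>v. ?G (1 / v) / (1 / v - w) / v\<^sup>2)"
    by (rule contour_integral_circlepath_inverse) simp
  also have "\<dots> = contour_integral (circlepath 0 (exp t)) (\<lambda>v. ?G v * (1 / v - 1 / (v - 1 / w)))"
  proof (rule contour_integral_eq)
    fix v assume "v \<in> path_image (circlepath 0 (exp t))"
    then have v: "v \<in> sphere 0 (exp t)" by simp
    have v0: "v \<noteq> 0" "v \<noteq> 1 / w" using v holS by auto
    have "1 / v - w \<noteq> 0" "v - 1 / w \<noteq> 0" using v0 w0 by (auto simp: field_simps)
    then have "1 / (1 / v - w) / v\<^sup>2 = 1 / v - 1 / (v - 1 / w)"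
      using v0(1) w0(1) by (simp add: field_simps power2_eq_square)
    then show "?G (1 / v) / (1 / v - w) / v\<^sup>2 = ?G v * (1 / v - 1 / (v - 1 / w))"
      unfolding joukowski_inverse by (metis divide_divide_eq_left' divide_divide_eq_left mult.right_neutral times_divide_eq_right)
  qed
  finally have "contour_integral (circlepath 0 (exp t)) (\<lambda>v. ?G v / (v - w))
      - contour_integral (circlepath 0 (exp t)) (\<lambda>v. ?G v * (1 / v - 1 / (v - 1 / w))) = 2 * of_real pi * \<i> * ?G w"
    using Cauchy_integral_annulus[OF joukowski_domain(2,1) e(2) w joukowski_domain(4)] by simp
  with has_contour_integral_diff[OF has_contour_integral_integral[OF i1] has_contour_integral_integral[OF i2]]
  have "((\<lambda>v. ?G v / (v - w) - ?G v * (1 / v - 1 / (v - 1 / w))) has_contour_integral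
     2 * of_real pi * \<i> * h (joukowski w)) (circlepath 0 (exp t))" by simp
  then show ?thesis by (rule has_contour_integral_eq) (simp add: algebra_simps)
qed

text \<open>Both resolvents are expanded in \<open>1 / v\<close>. The two terms of index 0 give
  \<open>2 / v\<close>, and the \<open>- 1 / v\<close> of the kernel reduces this to
  \<open>1 / v\<close>, whence the half at the coefficient 0. Each remainder is at most
  \<open>exp (- t) ^ Suc K / (exp t - 1)\<close>; the length of the circle uses up one
  power.\<close>

lemma joukowski_expansion_error:
  assumes w: "cmod w = 1"
  shows "cmod (h (joukowski w) - (joukowski_coeff h 0 / 2 + (\<Sum>n=1..K. joukowski_coeff h n * ((w ^ n + (1 / w) ^ n) / 2))))
    \<le> 2 * M / (exp t - 1) * exp (- t) ^ K"
proof -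
  let ?r = "exp t" and ?G = "\<lambda>u. h (joukowski u)" and ?a = "joukowski_coeff h"
  have e: "1 / exp t < 1" "1 < exp t" using t by auto
  have M0: "0 \<le> M" using joukowski_bound[of "of_real (exp t)"] norm_ge_zero order_trans by (metis abs_exp_cancel norm_of_real)
  have w0: "w \<noteq> 0" "cmod (1 / w) = 1" using w by (auto simp: norm_divide)
  define R where "R v = (w / v) ^ Suc K / (v - w) + ((1 / w) / v) ^ Suc K / (v - 1 / w)" for v
  have P: "((\<lambda>v. (\<Sum>k\<le>K. (w ^ k + (1 / w) ^ k) * (?G v / v ^ Suc k)) - ?G v / v ^ Suc 0) has_contour_integral
     (\<Sum>k\<le>K. (w ^ k + (1 / w) ^ k) * (of_real pi * \<i> * ?a k)) - of_real pi * \<i> * ?a 0) (circlepath 0 ?r)"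
    by (intro has_contour_integral_diff has_contour_integral_sum has_contour_integral_lmul
        joukowski_coeff_has_contour_integral finite_atMost)
  have "((\<lambda>v. ?G v * R v) has_contour_integral 2 * of_real pi * \<i> * ?G w -
     ((\<Sum>k\<le>K. (w ^ k + (1 / w) ^ k) * (of_real pi * \<i> * ?a k)) - of_real pi * \<i> * ?a 0)) (circlepath 0 ?r)"
  proof (rule has_contour_integral_eq[OF has_contour_integral_diff[OF joukowski_has_contour_integral[OF w] P]])
    fix v assume "v \<in> path_image (circlepath 0 ?r)"
    then have v: "v \<noteq> 0" "v \<noteq> w" "v \<noteq> 1 / w" using e w w0(2) by auto
    show "?G v * (1 / (v - w) + 1 / (v - 1 / w) - 1 / v) -
        ((\<Sum>k\<le>K. (w ^ k + (1 / w) ^ k) * (?G v / v ^ Suc k)) - ?G v / v ^ Suc 0) = ?G v * R v"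
    proof -
      have "(\<Sum>k\<le>K. (w ^ k + (1 / w) ^ k) * (?G v / v ^ Suc k)) =
          ?G v * ((\<Sum>k\<le>K. w ^ k / v ^ Suc k) + (\<Sum>k\<le>K. (1 / w) ^ k / v ^ Suc k))"
        unfolding sum.distrib[symmetric] sum_distrib_left by (intro sum.cong) (auto simp: add_divide_distrib algebra_simps)
      then show ?thesis
        unfolding geometric_resolvent[OF v(1,2), of K] geometric_resolvent[OF v(1,3), of K] R_def
        by (simp add: algebra_simps)
    qed
  qed
  then have "cmod (2 * of_real pi * \<i> * ?G w -
     ((\<Sum>k\<le>K. (w ^ k + (1 / w) ^ k) * (of_real pi * \<i> * ?a k)) - of_real pi * \<i> * ?a 0)) \<le>
     (M * (2 * ((1 / ?r) ^ Suc K / (?r - 1)))) * (2 * pi * ?r)"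
  proof (rule has_contour_integral_bound_circlepath)
    fix v assume "cmod (v - 0) = ?r"
    then have v: "cmod v = ?r" by simp
    have *: "cmod ((y / v) ^ Suc K / (v - y)) \<le> (1 / ?r) ^ Suc K / (?r - 1)" if "cmod y = 1" for y
    proof -
      have "?r - 1 \<le> cmod (v - y)" using norm_triangle_ineq2[of v y] v that by simp
      then show ?thesis
        unfolding norm_divide norm_power v that using e(2)
        by (intro divide_left_mono mult_pos_pos) auto
    qed
    show "cmod (?G v * R v) \<le> M * (2 * ((1 / ?r) ^ Suc K / (?r - 1)))"
      unfolding norm_mult R_def using joukowski_bound[OF v] M0 *[OF w] *[OF w0(2)]
      by (intro mult_mono) (auto intro!: order_trans[OF norm_triangle_ineq])
  qed (use M0 e in auto)
  also have "2 * of_real pi * \<i> * ?G w -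
     ((\<Sum>k\<le>K. (w ^ k + (1 / w) ^ k) * (of_real pi * \<i> * ?a k)) - of_real pi * \<i> * ?a 0) =
     2 * of_real pi * \<i> * (?G w - (?a 0 / 2 + (\<Sum>n=1..K. ?a n * ((w ^ n + (1 / w) ^ n) / 2))))"
  proof -
    have "(\<Sum>k\<le>K. (w ^ k + (1 / w) ^ k) * (of_real pi * \<i> * ?a k)) =
        of_real pi * \<i> * (2 * ?a 0) + (\<Sum>k=1..K. (w ^ k + (1 / w) ^ k) * (of_real pi * \<i> * ?a k))"
      by (simp add: atMost_atLeast0 sum.atLeast_Suc_atMost)
    also have "(\<Sum>k=1..K. (w ^ k + (1 / w) ^ k) * (of_real pi * \<i> * ?a k)) =
        2 * of_real pi * \<i> * (\<Sum>n=1..K. ?a n * ((w ^ n + (1 / w) ^ n) / 2))"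
      unfolding sum_distrib_left by (intro sum.cong) (auto simp: algebra_simps)
    finally show ?thesis by (simp add: algebra_simps)
  qed
  also have "cmod (2 * of_real pi * \<i> * (?G w - (?a 0 / 2 + (\<Sum>n=1..K. ?a n * ((w ^ n + (1 / w) ^ n) / 2))))) =
     2 * pi * cmod (?G w - (?a 0 / 2 + (\<Sum>n=1..K. ?a n * ((w ^ n + (1 / w) ^ n) / 2))))"
    by (simp add: norm_mult)
  also have "(M * (2 * ((1 / ?r) ^ Suc K / (?r - 1)))) * (2 * pi * ?r) = 2 * pi * (2 * M / (?r - 1) * exp (- t) ^ K)"
    by (simp add: exp_minus power_one_over inverse_eq_divide mult_ac)
  finally show ?thesis by (rule mult_left_le_imp_le) simp
qed

text \<open>For \<open>w = cis (arccos x)\<close> the Joukowski image is \<open>x\<close>, and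
  \<open>(w ^ n + (1 / w) ^ n) / 2\<close> is the Chebyshev polynomial at \<open>x\<close>.\<close>

lemma cheb_expansion_error:
  assumes "\<bar>x\<bar> \<le> 1"
  shows "cmod (h (of_real x) - (joukowski_coeff h 0 / 2 + (\<Sum>n=1..K. joukowski_coeff h n * of_real (poly (cheb_T n) x))))
    \<le> 2 * M / (exp t - 1) * exp (- t) ^ K"
proof -
  define w where "w = cis (arccos x)"
  have x: "x = cos (arccos x)" using assms by simp
  have w: "cmod w = 1" "1 / w = cnj w" by (auto simp: w_def cis_cnj inverse_eq_divide[symmetric])
  have cosw: "(w ^ n + (1 / w) ^ n) / 2 = of_real (poly (cheb_T n) x)" for n
  proof -
    have "(w ^ n + (1 / w) ^ n) / 2 = of_real (Re (w ^ n))"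
      unfolding w(2) complex_cnj_power[symmetric] complex_add_cnj by simp
    also have "Re (w ^ n) = cos (real n * arccos x)"
      by (simp only: w_def Complex.DeMoivre cis.sel)
    also have "\<dots> = poly (cheb_T n) x" using x poly_cheb_T_cos by metis
    finally show ?thesis .
  qed
  have "joukowski w = of_real x" using cosw[of 1] by (simp add: joukowski_def)
  then show ?thesis using joukowski_expansion_error[OF w(1), of K] by (simp only: cosw)
qed

end

section \<open>Orthogonal polynomials on the interval\<close>

fun legendre :: "nat \<Rightarrow> real poly" where
  "legendre 0 = 1"
| "legendre (Suc 0) = [:0, 1:]"
| "legendre (Suc (Suc n)) = smult (1 / real (n + 2))
     (smult (real (2 * n + 3)) ([:0, 1:] * legendre (Suc n)) - smult (real (n + 1)) (legendre n))"

lemma poly_legendre_Suc_Suc: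
  "real (n + 2) * poly (legendre (Suc (Suc n))) x =
     real (2 * n + 3) * (x * poly (legendre (Suc n)) x) - real (n + 1) * poly (legendre n) x"
proof -
  have "real (n + 2) \<noteq> 0" by simp
  then show ?thesis by (simp del: of_nat_add)
qed

text \<open>The recursion shifted by one. For \<open>n = 0\<close> the truncated index
  \<open>n - 1\<close> is harmless because its coefficient is 0.\<close>

lemma poly_legendre_Suc:
  "real (n + 1) * poly (legendre (Suc n)) x =
     real (2 * n + 1) * (x * poly (legendre n) x) - real n * poly (legendre (n - 1)) x"
  using poly_legendre_Suc_Suc[of "n - 1" x] by (cases n) (auto simp: algebra_simps)

lemma poly_pderiv_legendre_Suc_Suc:
  "real (n + 2) * poly (pderiv (legendre (Suc (Suc n)))) x =
     real (2 * n + 3) * (poly (legendre (Suc n)) x + x * poly (pderiv (legendre (Suc n))) x)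
     - real (n + 1) * poly (pderiv (legendre n)) x"
proof -
  have "real (n + 2) \<noteq> 0" by simp
  then show ?thesis by (simp add: pderiv_smult pderiv_diff pderiv_mult pderiv_pCons distrib_left mult.left_commute del: of_nat_add)
qed

text \<open>The two ladder identities need a joint induction: the differentiated recursion yields
  the first once the lower derivative is eliminated by the second, and the second then follows from
  the new first identity, both hypotheses and the recursion.\<close>

lemma poly_pderiv_legendre:
  "poly (pderiv (legendre (Suc n))) x = x * poly (pderiv (legendre n)) x + real (n + 1) * poly (legendre n) x"
  "x * poly (pderiv (legendre (Suc n))) x - poly (pderiv (legendre n)) x = real (n + 1) * poly (legendre (Suc n)) x"
proof (induction n)
  case 0
  show "poly (pderiv (legendre (Suc 0))) x = x * poly (pderiv (legendre 0)) x + real (0 + 1) * poly (legendre 0) x"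
    "x * poly (pderiv (legendre (Suc 0))) x - poly (pderiv (legendre 0)) x = real (0 + 1) * poly (legendre (Suc 0)) x"
    by (simp_all add: pderiv_pCons pderiv_1)
next
  case (Suc n)
  define p0 p1 p2 d0 d1 d2 k where "p0 = poly (legendre n) x" "p1 = poly (legendre (Suc n)) x"
    "p2 = poly (legendre (Suc (Suc n))) x" "d0 = poly (pderiv (legendre n)) x"
    "d1 = poly (pderiv (legendre (Suc n))) x" "d2 = poly (pderiv (legendre (Suc (Suc n)))) x" "k = real n"
  note defs = p0_p1_p2_d0_d1_d2_k_def
  have IH: "d1 = x * d0 + (k + 1) * p0" "x * d1 - d0 = (k + 1) * p1"
    using Suc by (simp_all add: defs del: legendre.simps)
  have R: "(k + 2) * p2 = (2 * k + 3) * (x * p1) - (k + 1) * p0"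
    using poly_legendre_Suc_Suc[of n x] by (simp add: defs add.commute del: legendre.simps)
  have R': "(k + 2) * d2 = (2 * k + 3) * (p1 + x * d1) - (k + 1) * d0"
    using poly_pderiv_legendre_Suc_Suc[of n x] by (simp add: defs add.commute del: legendre.simps)
  have k: "k + 2 \<noteq> 0" by (simp add: defs add_nonneg_pos)
  have "(k + 2) * d2 = (k + 2) * (x * d1 + (k + 2) * p1)"
  proof -
    have d0: "d0 = x * d1 - (k + 1) * p1" using IH(2) by simp
    show ?thesis unfolding R' d0 by (simp add: algebra_simps)
  qed
  then have 1: "d2 = x * d1 + (k + 2) * p1" using k by simp
  have "x * d2 - d1 = x * (x * d1 - d0) + (x * d0 - d1) + (k + 2) * (x * p1)"
    unfolding 1 by (simp add: algebra_simps)
  also have "\<dots> = (2 * k + 3) * (x * p1) - (k + 1) * p0"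
    unfolding IH(2) unfolding IH(1) by (simp add: algebra_simps)
  finally have 2: "x * d2 - d1 = (k + 2) * p2" unfolding R .
  show "poly (pderiv (legendre (Suc (Suc n)))) x =
      x * poly (pderiv (legendre (Suc n))) x + real (Suc n + 1) * poly (legendre (Suc n)) x"
    using 1 by (simp add: defs del: legendre.simps)
  show "x * poly (pderiv (legendre (Suc (Suc n)))) x - poly (pderiv (legendre (Suc n))) x =
      real (Suc n + 1) * poly (legendre (Suc (Suc n))) x"
    using 2 by (simp add: defs del: legendre.simps)
qed

text \<open>The ladder identities combine to \<open>(x^2 - 1) P_n' = n (x P_n - P_(n-1))\<close>.
  Differentiating this and applying the second identity once more gives Legendre's equation.\<close>

lemma legendre_ODE:
  "[:1, 0, -1:] * pderiv (pderiv (legendre n)) =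
     [:0, 2:] * pderiv (legendre n) - smult (real n * real (n + 1)) (legendre n)"
proof (cases n)
  case (Suc k)
  have "[:-1, 0, 1:] * pderiv (legendre (Suc k)) =
      smult (real (k + 1)) ([:0, 1:] * legendre (Suc k) - legendre k)" (is "?L = ?R")
  proof (rule iffD1[OF poly_eq_poly_eq_iff], rule ext)
    fix x
    let ?d1 = "poly (pderiv (legendre (Suc k))) x" and ?d0 = "poly (pderiv (legendre k)) x"
    have "(x\<^sup>2 - 1) * ?d1 = x * (x * ?d1 - ?d0) + (x * ?d0 - ?d1)"
      by (simp add: algebra_simps power2_eq_square)
    also have "\<dots> = real (k + 1) * (x * poly (legendre (Suc k)) x - poly (legendre k) x)"
      unfolding poly_pderiv_legendre(2) unfolding poly_pderiv_legendre(1) by (simp add: algebra_simps)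
    finally show "poly ?L x = poly ?R x"
      by (simp add: algebra_simps power2_eq_square)
  qed
  then have eq: "pderiv ?L = pderiv ?R" by simp
  show ?thesis
  proof (rule iffD1[OF poly_eq_poly_eq_iff], rule ext)
    fix x
    let ?d1 = "poly (pderiv (legendre (Suc k))) x" and ?d0 = "poly (pderiv (legendre k)) x"
      and ?dd = "poly (pderiv (pderiv (legendre (Suc k)))) x"
    have "2 * x * ?d1 + (x\<^sup>2 - 1) * ?dd = real (k + 1) * (poly (legendre (Suc k)) x + (x * ?d1 - ?d0))"
      using arg_cong[OF eq, of "\<lambda>p. poly p x"]
      by (simp add: pderiv_mult pderiv_smult pderiv_diff pderiv_pCons algebra_simps power2_eq_square)
    then have "2 * x * ?d1 + (x\<^sup>2 - 1) * ?dd = real (k + 1) * (real (k + 2) * poly (legendre (Suc k)) x)"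
      unfolding poly_pderiv_legendre(2) by (simp add: algebra_simps)
    then show "poly ([:1, 0, -1:] * pderiv (pderiv (legendre n))) x =
       poly ([:0, 2:] * pderiv (legendre n) - smult (real n * real (n + 1)) (legendre n)) x"
      by (simp add: Suc algebra_simps power2_eq_square)
  qed
qed (simp add: pderiv_1)

text \<open>The hypothesis covers both end points at once. The value 1 at 1 also shows that no
  Legendre polynomial vanishes identically.\<close>

lemma poly_legendre_endpoint:
  assumes "x\<^sup>2 = 1"
  shows "poly (legendre n) x = x ^ n"
proof (induction n rule: legendre.induct)
  case (3 n)
  have x: "x * x = 1" "x * (x * y) = y" for y
    using assms by (simp_all add: power2_eq_square flip: mult.assoc)
  have "real (n + 2) * poly (legendre (Suc (Suc n))) x = real (n + 2) * x ^ Suc (Suc n)"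
    unfolding poly_legendre_Suc_Suc 3 by (simp add: x algebra_simps)
  then show ?case by simp
qed simp_all

text \<open>The function \<open>n (n + 1) P\<^sup>2 + (1 - x\<^sup>2) P'\<^sup>2\<close> has the derivative \<open>2 x P'\<^sup>2\<close>, so on \<open>[-1,1]\<close> it is
  largest at the end points.\<close>

lemma abs_poly_legendre_le_1:
  assumes "\<bar>x\<bar> \<le> 1"
  shows "\<bar>poly (legendre n) x\<bar> \<le> 1"
proof (cases "n = 0")
  case False
  define N where "N = real n * real (n + 1)"
  have N: "N > 0" using False by (simp add: N_def)
  define E where "E = smult N ((legendre n)\<^sup>2) + [:1, 0, -1:] * (pderiv (legendre n))\<^sup>2"
  have dE: "poly (pderiv E) y = 2 * y * (poly (pderiv (legendre n)) y)\<^sup>2" for y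
  proof -
    have "(1 - y\<^sup>2) * poly (pderiv (pderiv (legendre n))) y =
        2 * y * poly (pderiv (legendre n)) y - N * poly (legendre n) y"
      using arg_cong[OF legendre_ODE[of n], of "\<lambda>p. poly p y"] by (simp add: N_def algebra_simps power2_eq_square)
    then have "2 * poly (pderiv (legendre n)) y * ((1 - y\<^sup>2) * poly (pderiv (pderiv (legendre n))) y) =
        2 * poly (pderiv (legendre n)) y * (2 * y * poly (pderiv (legendre n)) y - N * poly (legendre n) y)"
      by simp
    then show ?thesis
      unfolding E_def
      by (simp add: pderiv_add pderiv_minus pderiv_smult pderiv_mult pderiv_pCons power2_eq_square algebra_simps)
  qed
  have E1: "poly E y = N" if "y\<^sup>2 = 1" for y
  proof -
    have "(y ^ n)\<^sup>2 = 1" using that by (metis power_mult mult.commute power_one)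
    then show ?thesis
      using that by (simp add: E_def poly_legendre_endpoint[OF that] power2_eq_square)
  qed
  have "poly E x \<le> N"
  proof (cases "x \<ge> 0")
    case True
    have "poly E x \<le> poly E 1"
    proof (rule DERIV_nonneg_imp_nondecreasing[where f = "poly E"])
      show "\<exists>d. (poly E has_real_derivative d) (at y) \<and> 0 \<le> d" if "x \<le> y" for y
        using True that poly_DERIV[of E y] by (intro exI[of _ "poly (pderiv E) y"]) (simp add: dE)
    qed (use assms in auto)
    then show ?thesis using E1[of 1] by simp
  next
    case False
    have "poly E (-1) \<ge> poly E x"
    proof (rule DERIV_nonpos_imp_nonincreasing[where f = "poly E"])
      show "\<exists>d. (poly E has_real_derivative d) (at y) \<and> d \<le> 0" if "y \<le> x" for y
        using False that poly_DERIV[of E y]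
        by (intro exI[of _ "poly (pderiv E) y"]) (simp add: dE mult_nonpos_nonneg)
    qed (use assms in auto)
    then show ?thesis using E1[of "-1"] by simp
  qed
  moreover have "x\<^sup>2 \<le> 1" using assms by (simp add: abs_square_le_1)
  then have "0 \<le> (1 - x\<^sup>2) * (poly (pderiv (legendre n)) x)\<^sup>2" by simp
  ultimately have "N * (poly (legendre n) x)\<^sup>2 \<le> N * 1"
    by (simp add: E_def power2_eq_square algebra_simps)
  then have "(poly (legendre n) x)\<^sup>2 \<le> 1" using N by (metis mult_le_cancel_left_pos)
  then show ?thesis by (simp add: abs_square_le_1)
qed simp

lemma degree_legendre: "degree (legendre n) = n"
proof (induction n rule: legendre.induct)
  case (3 n)
  have "legendre (Suc n) \<noteq> 0"
    using poly_legendre_endpoint[of 1 "Suc n"] by auto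
  then have "degree (smult (real (2 * n + 3)) ([:0, 1:] * legendre (Suc n))) = Suc (Suc n)"
    using 3 by (simp add: degree_mult_eq del: of_nat_add of_nat_mult)
  moreover have "degree (- smult (real (n + 1)) (legendre n)) < Suc (Suc n)"
    using 3 by simp
  ultimately have "degree (smult (real (2 * n + 3)) ([:0, 1:] * legendre (Suc n)) + (- smult (real (n + 1)) (legendre n))) = Suc (Suc n)"
    by (subst degree_add_eq_left) auto
  then show ?case by simp
qed simp_all

section \<open>Chebyshev polynomials\<close>

lemma abs_poly_cheb_T_le_1:
  assumes "\<bar>x\<bar> \<le> 1"
  shows "\<bar>poly (cheb_T n) x\<bar> \<le> 1"
  using poly_cheb_T_cos[of n "arccos x"] assms by (simp add: cos_arccos_abs)

lemma poly_cheb_T_1: "poly (cheb_T n) 1 = 1"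
  using poly_cheb_T_cos[of n 0] by simp

lemma degree_cheb_T: "degree (cheb_T n) = n"
proof (induction n rule: cheb_T.induct)
  case (3 n)
  have "cheb_T (Suc n) \<noteq> 0"
    using poly_cheb_T_1[of "Suc n"] by auto
  then have "degree ([:0, 2:] * cheb_T (Suc n)) = Suc (Suc n)"
    using 3 by (subst degree_mult_eq) auto
  moreover have "degree (- cheb_T n) < Suc (Suc n)"
    using 3 by simp
  ultimately have "degree ([:0, 2:] * cheb_T (Suc n) + (- cheb_T n)) = Suc (Suc n)"
    by (subst degree_add_eq_left) auto
  then show ?case by simp
qed simp_all

lemma cheb_T_mult:
  assumes "i \<le> j" "\<bar>x\<bar> \<le> 1"
  shows "2 * (poly (cheb_T i) x * poly (cheb_T j) x) = poly (cheb_T (i + j)) x + poly (cheb_T (j - i)) x"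
proof -
  define s where "s = arccos x"
  have x: "x = cos s" using assms(2) by (simp add: s_def cos_arccos_abs)
  have "real (i + j) * s = real i * s + real j * s" "real (j - i) * s = real j * s - real i * s"
    using assms(1) by (simp_all add: of_nat_diff algebra_simps)
  then show ?thesis
    unfolding x poly_cheb_T_cos by (simp add: cos_add cos_diff)
qed

section \<open>Integration against Lebesgue measure and the Chebyshev weight\<close>

lemma space_unit_lborel: "space unit_lborel = {-1<..<1}"
  by (simp add: unit_lborel_def space_restrict_space)

lemma sets_unit_lborel: "sets unit_lborel = sets (restrict_space borel {-1<..<1})"
  unfolding unit_lborel_def by (intro sets_restrict_space_cong) simp

lemma space_cheb_measure: "space cheb_measure = {-1<..<1}"
  by (simp add: cheb_measure_def space_unit_lborel)

lemma sets_cheb_measure: "sets cheb_measure = sets (restrict_space borel {-1<..<1})"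
  by (simp add: cheb_measure_def sets_unit_lborel)

lemma borel_measurable_unit:
  assumes "sets M = sets (restrict_space borel {-1<..<1::real})" "continuous_on {-1<..<1} f"
  shows "f \<in> borel_measurable M"
  using borel_measurable_continuous_on_restrict[OF assms(2)] measurable_cong_sets[OF assms(1) refl] by blast

lemma integral_unit_lborel:
  fixes f :: "real \<Rightarrow> real"
  shows "integral\<^sup>L unit_lborel f = (LBINT x=ereal (-1)..ereal 1. f x)"
    "integrable unit_lborel f \<longleftrightarrow> set_integrable lborel (einterval (ereal (-1)) (ereal 1)) f"
  unfolding unit_lborel_def set_integrable_def
  by (simp_all add: integral_restrict_space integrable_restrict_space
      interval_lebesgue_integral_def set_lebesgue_integral_def)

text \<open>Either integrability is known, as for polynomials, or the integrand is nonnegative and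
  integrability is part of the result. The second alternative serves the Chebyshev weight, which is
  unbounded at the end points.\<close>

lemma FTC_unit_lborel:
  fixes F f :: "real \<Rightarrow> real"
  assumes F: "continuous_on {-1..1} F"
    and D: "\<And>x. -1 < x \<Longrightarrow> x < 1 \<Longrightarrow> DERIV F x :> f x"
    and f: "\<And>x. -1 < x \<Longrightarrow> x < 1 \<Longrightarrow> isCont f x"
    and int: "integrable unit_lborel f \<or> (\<forall>x\<in>{-1<..<1}. 0 \<le> f x)"
  shows "integrable unit_lborel f" "integral\<^sup>L unit_lborel f = F 1 - F (-1)"
proof -
  have A: "((F \<circ> real_of_ereal) \<longlongrightarrow> F (-1)) (at_right (ereal (-1)))"
    and B: "((F \<circ> real_of_ereal) \<longlongrightarrow> F 1) (at_left (ereal 1))"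
    using F by (auto simp only: ereal_tendsto_simps1 continuous_on_Icc_at_rightD continuous_on_Icc_at_leftD)
  have *: "integrable unit_lborel f \<and> integral\<^sup>L unit_lborel f = F 1 - F (-1)"
  proof (cases "integrable unit_lborel f")
    case True
    then show ?thesis
      unfolding integral_unit_lborel
      using D f A B
      by (auto intro!: interval_integral_FTC_integrable simp: has_real_derivative_iff_has_vector_derivative[symmetric])
  next
    case False
    with int have "AE x in lborel. ereal (-1) < ereal x \<longrightarrow> ereal x < ereal 1 \<longrightarrow> 0 \<le> f x" by auto
    then show ?thesis
      unfolding integral_unit_lborel
      using D f A B interval_integral_FTC_nonneg[of "ereal (-1)" "ereal 1" F f "F (-1)" "F 1"]
      by auto
  qed
  then show "integrable unit_lborel f" "integral\<^sup>L unit_lborel f = F 1 - F (-1)" by auto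
qed

lemma finite_measure_unit_lborel: "finite_measure unit_lborel"
  unfolding unit_lborel_def
  by (rule finite_measureI) (simp add: emeasure_restrict_space space_restrict_space)

lemma cheb_weight:
  "integrable unit_lborel (\<lambda>x. 1 / sqrt (1 - x\<^sup>2))"
  "integral\<^sup>L unit_lborel (\<lambda>x. 1 / sqrt (1 - x\<^sup>2)) = pi"
proof -
  have isC: "isCont (\<lambda>x. 1 / sqrt (1 - x\<^sup>2)) x" if "-1 < x" "x < 1" for x :: real
  proof -
    have "x\<^sup>2 < 1" using that by (simp add: abs_square_less_1)
    then show ?thesis by (auto intro!: continuous_intros)
  qed
  have D: "DERIV arcsin x :> 1 / sqrt (1 - x\<^sup>2)" if "-1 < x" "x < 1" for x
    using DERIV_arcsin[OF that] by (simp add: inverse_eq_divide)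
  have "0 \<le> 1 / sqrt (1 - x\<^sup>2)" if "x \<in> {-1<..<1}" for x :: real
    using that abs_square_le_1[of x] by auto
  then have "integrable unit_lborel (\<lambda>x. 1 / sqrt (1 - x\<^sup>2)) \<or> (\<forall>x\<in>{-1<..<1::real}. 0 \<le> 1 / sqrt (1 - x\<^sup>2))"
    by blast
  from FTC_unit_lborel[OF continuous_on_arcsin' D isC this]
  show "integrable unit_lborel (\<lambda>x. 1 / sqrt (1 - x\<^sup>2))"
    "integral\<^sup>L unit_lborel (\<lambda>x. 1 / sqrt (1 - x\<^sup>2)) = pi"
    by auto
qed


lemma continuous_on_cheb_weight: "continuous_on {-1<..<1} (\<lambda>x::real. 1 / sqrt (1 - x\<^sup>2))"
proof -
  have "x\<^sup>2 < 1" if "x \<in> {-1<..<1}" for x :: real using that by (auto simp: abs_square_less_1)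
  then show ?thesis by (intro continuous_intros) force+
qed

lemma cheb_weight_nonneg: "AE x in unit_lborel. 0 \<le> 1 / sqrt (1 - x\<^sup>2)"
  by (rule AE_I2) (auto simp: space_unit_lborel abs_square_le_1)

lemma integral_cheb_measure:
  fixes f :: "real \<Rightarrow> 'a::{banach, second_countable_topology}"
  assumes "f \<in> borel_measurable unit_lborel"
  shows "integral\<^sup>L cheb_measure f = integral\<^sup>L unit_lborel (\<lambda>x. (1 / sqrt (1 - x\<^sup>2)) *\<^sub>R f x)"
  unfolding cheb_measure_def
  by (intro integral_density assms cheb_weight_nonneg borel_measurable_unit sets_unit_lborel continuous_on_cheb_weight)

lemma finite_measure_cheb_measure: "finite_measure cheb_measure"
proof (rule finite_measureI)
  have "emeasure cheb_measure (space cheb_measure) = (\<integral>\<^sup>+ x. ennreal (1 / sqrt (1 - x\<^sup>2)) \<partial>unit_lborel)"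
    unfolding cheb_measure_def space_density
    by (subst emeasure_density)
      (auto intro!: borel_measurable_unit sets_unit_lborel continuous_on_cheb_weight nn_integral_cong
        measurable_compose[OF _ measurable_ennreal])
  also have "\<dots> = ennreal pi"
    using nn_integral_eq_integral[OF cheb_weight(1) cheb_weight_nonneg] cheb_weight(2) by simp
  finally show "emeasure cheb_measure (space cheb_measure) \<noteq> \<infinity>" by simp
qed

lemma integral_cheb_T: "(\<integral>x. poly (cheb_T n) x \<partial>cheb_measure) = (if n = 0 then pi else 0)"
proof -
  have meas: "(\<lambda>x. poly p x) \<in> borel_measurable unit_lborel" for p :: "real poly"
    by (intro borel_measurable_unit sets_unit_lborel continuous_intros)
  have eq: "(\<integral>x. poly (cheb_T n) x \<partial>cheb_measure) = (\<integral>x. (1 / sqrt (1 - x\<^sup>2)) * poly (cheb_T n) x \<partial>unit_lborel)"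
    using integral_cheb_measure[OF meas] by simp
  show ?thesis
  proof (cases "n = 0")
    case True
    then show ?thesis unfolding eq using cheb_weight(2) by simp
  next
    case False
    \<comment> \<open>Comes from \<open>x = cos s\<close>: the weight is minus the derivative of
      \<open>arccos\<close>, so this is a primitive. It vanishes at both end points, where
      \<open>arccos\<close> is 0 and \<open>pi\<close>.\<close>
    define F where "F x = - (sin (real n * arccos x) / real n)" for x
    have "(\<integral>x. (1 / sqrt (1 - x\<^sup>2)) * poly (cheb_T n) x \<partial>unit_lborel) = F 1 - F (-1)"
    proof (rule FTC_unit_lborel(2))
      show "continuous_on {-1..1} F"
        unfolding F_def by (intro continuous_intros continuous_on_arccos') (use False in auto)
      fix x :: real assume x: "-1 < x" "x < 1"
      then have x2: "x\<^sup>2 < 1" by (simp add: abs_square_less_1)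
      have "poly (cheb_T n) x = cos (real n * arccos x)"
        using poly_cheb_T_cos[of n "arccos x"] x by simp
      then show "DERIV F x :> 1 / sqrt (1 - x\<^sup>2) * poly (cheb_T n) x"
        unfolding F_def using x x2 False
        by (auto intro!: derivative_eq_intros simp: field_simps)
      show "isCont (\<lambda>x. 1 / sqrt (1 - x\<^sup>2) * poly (cheb_T n) x) x"
        using x2 by (auto intro!: continuous_intros)
    next
      have "integrable unit_lborel (\<lambda>x. 1 / sqrt (1 - x\<^sup>2) * poly (cheb_T n) x)"
      proof (rule Bochner_Integration.integrable_bound[OF cheb_weight(1)])
        show "(\<lambda>x. 1 / sqrt (1 - x\<^sup>2) * poly (cheb_T n) x) \<in> borel_measurable unit_lborel"
          by (intro borel_measurable_unit sets_unit_lborel continuous_intros continuous_on_cheb_weight)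
        show "AE x in unit_lborel. norm (1 / sqrt (1 - x\<^sup>2) * poly (cheb_T n) x) \<le> norm (1 / sqrt (1 - x\<^sup>2))"
          unfolding norm_mult
          by (intro AE_I2 mult_left_le) (auto simp: space_unit_lborel intro!: abs_poly_cheb_T_le_1)
      qed
      then show "integrable unit_lborel (\<lambda>x. 1 / sqrt (1 - x\<^sup>2) * poly (cheb_T n) x) \<or>
          (\<forall>x\<in>{-1<..<1}. 0 \<le> 1 / sqrt (1 - x\<^sup>2) * poly (cheb_T n) x)" ..
    qed
    also have "F 1 - F (-1) = 0" by (simp add: F_def)
    finally show ?thesis using False eq by simp
  qed
qed

section \<open>Projection onto polynomials for a finite measure on the interval\<close>

locale interval_measure = finite_measure M for M :: "real measure" +
  assumes space_M: "space M = {-1<..<1}"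
    and sets_M: "sets M = sets (restrict_space borel {-1<..<1})"
begin

lemma integrable_bounded:
  fixes f :: "real \<Rightarrow> 'b::{banach, second_countable_topology}"
  assumes "continuous_on {-1<..<1} f" "\<And>x. x \<in> {-1<..<1} \<Longrightarrow> norm (f x) \<le> C"
  shows "integrable M f"
  using assms by (intro integrable_const_bound[of _ C] AE_I2 borel_measurable_unit sets_M) (auto simp: space_M)

lemma poly_bounded:
  fixes p :: "complex poly"
  obtains C where "\<And>x. x \<in> {-1<..<1} \<Longrightarrow> cmod (poly p (of_real x)) \<le> C"
proof -
  have "compact ((\<lambda>x. poly p (complex_of_real x)) ` {-1..1})"
    by (intro compact_continuous_image continuous_intros) auto
  then have "bounded ((\<lambda>x. poly p (complex_of_real x)) ` {-1..1})" by (rule compact_imp_bounded)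
  then obtain C where "\<forall>x\<in>{-1..1}. cmod (poly p (complex_of_real x)) \<le> C"
    unfolding bounded_iff by auto
  then show ?thesis by (intro that[of C]) auto
qed

lemma integrable_mult_poly:
  fixes p :: "complex poly"
  assumes "continuous_on {-1<..<1} f" "\<And>x. x \<in> {-1<..<1} \<Longrightarrow> cmod (f x) \<le> C"
  shows "integrable M (\<lambda>x. f x * poly p (of_real x))"
proof -
  obtain D where D: "\<And>x. x \<in> {-1<..<1} \<Longrightarrow> cmod (poly p (of_real x)) \<le> D"
    using poly_bounded by blast
  show ?thesis
  proof (rule integrable_bounded)
    show "continuous_on {-1<..<1} (\<lambda>x. f x * poly p (of_real x))"
      by (intro continuous_intros assms)
    show "norm (f x * poly p (of_real x)) \<le> C * D" if "x \<in> {-1<..<1}" for x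
      unfolding norm_mult using assms(2)[OF that] D[OF that]
      by (intro mult_mono) (auto intro: order_trans[OF norm_ge_zero])
  qed
qed

lemma integrable_poly:
  fixes p :: "real poly"
  shows "integrable M (poly p)"
proof -
  have "bounded (poly p ` {-1..1})"
    by (intro compact_imp_bounded compact_continuous_image continuous_intros) auto
  then obtain C where "\<forall>x\<in>{-1..1}. norm (poly p x) \<le> C"
    unfolding bounded_iff by auto
  then show ?thesis by (intro integrable_bounded[of _ C] continuous_intros) auto
qed

end

interpretation unit: interval_measure unit_lborel
  by (intro interval_measure.intro interval_measure_axioms.intro finite_measure_unit_lborel
      space_unit_lborel sets_unit_lborel)

interpretation cheb: interval_measure cheb_measure
  by (intro interval_measure.intro interval_measure_axioms.intro finite_measure_cheb_measure
      space_cheb_measure sets_cheb_measure)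

lemma poly_map_poly_of_real: "poly (map_poly complex_of_real p) (of_real x) = of_real (poly p x)"
  by (induction p) (auto simp: map_poly_pCons)

lemma degree_map_poly_of_real: "degree (map_poly complex_of_real p) = degree p"
  by (rule degree_map_poly) auto

text \<open>The \<open>b j\<close> have real coefficients, so the complex conjugate on the second factor of the inner
  product only affects the coefficients of a linear combination.\<close>

locale orthogonal_polys = interval_measure +
  fixes b :: "nat \<Rightarrow> real poly" and \<nu> :: "nat \<Rightarrow> real"
  assumes degree_b: "degree (b n) = n"
    and b_nonzero: "b n \<noteq> 0"
    and ortho: "(\<integral>x. poly (b i) x * poly (b j) x \<partial>M) = (if i = j then \<nu> i else 0)"
    and \<nu>_pos: "\<nu> n > 0"
begin

definition coef :: "(real \<Rightarrow> complex) \<Rightarrow> nat \<Rightarrow> complex" where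
  "coef g j = (\<integral>x. g x * of_real (poly (b j) x) \<partial>M) / of_real (\<nu> j)"

definition partial :: "(nat \<Rightarrow> complex) \<Rightarrow> nat \<Rightarrow> complex poly" where
  "partial c m = (\<Sum>j\<le>m. smult (c j) (map_poly of_real (b j)))"

lemma poly_partial: "poly (partial c m) (of_real x) = (\<Sum>j\<le>m. c j * of_real (poly (b j) x))"
  by (simp add: partial_def poly_sum poly_map_poly_of_real)

lemma degree_partial: "degree (partial c m) \<le> m"
  unfolding partial_def
  by (intro degree_sum_le order_trans[OF degree_smult_le]) (auto simp: degree_map_poly_of_real degree_b)

text \<open>The \<open>j\<close>-th polynomial has degree exactly \<open>j\<close>, so leading terms
  can be removed one after the other.\<close>

lemma basis:
  assumes "degree q \<le> m"
  obtains c where "q = partial c m"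
  using assms
proof (induction m arbitrary: q thesis)
  case 0
  have b0: "degree (map_poly complex_of_real (b 0)) = 0" "map_poly complex_of_real (b 0) \<noteq> 0"
    using degree_b b_nonzero by (auto simp: degree_map_poly_of_real map_poly_eq_0_iff)
  then obtain \<beta> where \<beta>: "map_poly complex_of_real (b 0) = [:\<beta>:]" "\<beta> \<noteq> 0"
    by (metis degree_eq_zeroE pCons_0_0)
  obtain \<gamma> where "q = [:\<gamma>:]" using 0 degree_eq_zeroE by blast
  then show ?case using \<beta> by (intro "0.prems"(1)[of "\<lambda>_. \<gamma> / \<beta>"]) (simp add: partial_def)
next
  case (Suc m)
  let ?B = "map_poly complex_of_real (b (Suc m))"
  have B: "degree ?B = Suc m" "coeff ?B (Suc m) \<noteq> 0"
    using degree_b[of "Suc m"] b_nonzero[of "Suc m"] leading_coeff_0_iff[of "b (Suc m)"]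
    by (auto simp: degree_map_poly_of_real coeff_map_poly)
  define \<gamma> where "\<gamma> = coeff q (Suc m) / coeff ?B (Suc m)"
  have "degree (q - smult \<gamma> ?B) \<le> m"
  proof (rule degree_le, intro allI impI)
    fix i assume "m < i"
    then consider "i = Suc m" | "i > Suc m" by linarith
    then show "coeff (q - smult \<gamma> ?B) i = 0"
      using B Suc.prems(2) by cases (auto simp: \<gamma>_def coeff_eq_0)
  qed
  then obtain c where c: "q - smult \<gamma> ?B = partial c m" using Suc.IH by blast
  have "q = partial (c(Suc m := \<gamma>)) (Suc m)"
  proof -
    have "q = partial c m + smult \<gamma> ?B" using c by (simp add: algebra_simps)
    moreover have "partial (c(Suc m := \<gamma>)) m = partial c m"
      unfolding partial_def by (intro sum.cong) auto
    ultimately show ?thesis by (simp add: partial_def)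
  qed
  then show ?case by (rule Suc.prems(1))
qed

lemma integral_partial_mult:
  assumes "i \<le> m"
  shows "(\<integral>x. poly (partial c m) (of_real x) * of_real (poly (b i) x) \<partial>M) = c i * of_real (\<nu> i)"
proof -
  have int: "integrable M (\<lambda>x. poly (b j) x * poly (b i) x)" for j
    using integrable_poly[of "b j * b i"] by (simp add: poly_mult[abs_def])
  have "(\<integral>x. poly (partial c m) (of_real x) * of_real (poly (b i) x) \<partial>M) =
      (\<integral>x. (\<Sum>j\<le>m. c j * of_real (poly (b j) x * poly (b i) x)) \<partial>M)"
    unfolding poly_partial sum_distrib_right by (simp add: mult.assoc)
  also have "\<dots> = (\<Sum>j\<le>m. \<integral>x. c j * of_real (poly (b j) x * poly (b i) x) \<partial>M)"
    by (intro Bochner_Integration.integral_sum integrable_mult_right integrable_of_real int)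
  also have "\<dots> = (\<Sum>j\<le>m. c j * of_real (\<integral>x. poly (b j) x * poly (b i) x \<partial>M))"
    unfolding integral_mult_right_zero integral_complex_of_real ..
  also have "\<dots> = (\<Sum>j\<le>m. if j = i then c i * of_real (\<nu> i) else 0)"
    unfolding ortho by (intro sum.cong) auto
  also have "\<dots> = c i * of_real (\<nu> i)" using assms by simp
  finally show ?thesis .
qed

text \<open>Both existence and uniqueness for \<open>THE\<close> reduce to testing against the
  \<open>b i\<close>: for a combination with coefficients \<open>c\<close> the test gives
  \<open>(coef g i - c i) * \<nu> i\<close>. Every competitor is such a combination, hence has the
  coefficients of \<open>g\<close>.\<close>

lemma L2_proj_poly_eq:
  assumes g: "continuous_on {-1<..<1} g" "\<And>x. x \<in> {-1<..<1} \<Longrightarrow> cmod (g x) \<le> C"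
  shows "L2_proj_poly M m g = partial (coef g) m"
  unfolding L2_proj_poly_def
proof (rule the_equality)
  have int_g: "integrable M (\<lambda>x. g x * of_real (poly (b i) x))" for i
    using integrable_mult_poly[OF g, of "map_poly of_real (b i)"] by (simp add: poly_map_poly_of_real)
  have int_p: "integrable M (\<lambda>x. poly p (of_real x) * of_real (poly (b i) x))" for i and p :: "complex poly"
    using integrable_mult_poly[of "\<lambda>_. 1" 1 "p * map_poly of_real (b i)"] by (simp add: poly_map_poly_of_real)
  have test: "(\<integral>x. (g x - poly (partial c m) (of_real x)) * of_real (poly (b i) x) \<partial>M) = (coef g i - c i) * of_real (\<nu> i)"
    if "i \<le> m" for c i
  proof -
    have "(\<integral>x. (g x - poly (partial c m) (of_real x)) * of_real (poly (b i) x) \<partial>M) =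
        (\<integral>x. g x * of_real (poly (b i) x) \<partial>M) - (\<integral>x. poly (partial c m) (of_real x) * of_real (poly (b i) x) \<partial>M)"
      unfolding left_diff_distrib by (intro Bochner_Integration.integral_diff int_g int_p)
    also have "(\<integral>x. g x * of_real (poly (b i) x) \<partial>M) = coef g i * of_real (\<nu> i)"
      using \<nu>_pos[of i] by (simp add: coef_def)
    finally show ?thesis unfolding integral_partial_mult[OF that] by (simp add: left_diff_distrib)
  qed
  show "degree (partial (coef g) m) \<le> m \<and> (\<forall>q. degree q \<le> m \<longrightarrow>
      (\<integral>x. (g x - poly (partial (coef g) m) (of_real x)) * cnj (poly q (of_real x)) \<partial>M) = 0)"
  proof (intro conjI degree_partial allI impI)
    fix q :: "complex poly" assume "degree q \<le> m"
    then obtain c where q: "q = partial c m" using basis by blast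
    let ?p = "partial (coef g) m"
    have "(\<integral>x. (g x - poly ?p (of_real x)) * cnj (poly q (of_real x)) \<partial>M) =
        (\<integral>x. (\<Sum>i\<le>m. cnj (c i) * ((g x - poly ?p (of_real x)) * of_real (poly (b i) x))) \<partial>M)"
      unfolding q poly_partial[of c] cnj_sum sum_distrib_left
      by (intro Bochner_Integration.integral_cong refl sum.cong) simp
    also have "\<dots> = (\<Sum>i\<le>m. \<integral>x. cnj (c i) * ((g x - poly ?p (of_real x)) * of_real (poly (b i) x)) \<partial>M)"
      unfolding left_diff_distrib
      by (intro Bochner_Integration.integral_sum integrable_mult_right Bochner_Integration.integrable_diff int_g int_p)
    also have "\<dots> = 0"
      unfolding integral_mult_right_zero by (intro sum.neutral) (auto simp: test)
    finally show "(\<integral>x. (g x - poly ?p (of_real x)) * cnj (poly q (of_real x)) \<partial>M) = 0" .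
  qed
  fix p :: "complex poly"
  assume p: "degree p \<le> m \<and> (\<forall>q. degree q \<le> m \<longrightarrow>
      (\<integral>x. (g x - poly p (of_real x)) * cnj (poly q (of_real x)) \<partial>M) = 0)"
  then obtain c where c: "p = partial c m" using basis by blast
  have "c i = coef g i" if "i \<le> m" for i
  proof -
    have "degree (map_poly complex_of_real (b i)) \<le> m"
      using that degree_b by (simp add: degree_map_poly_of_real)
    with p have "(\<integral>x. (g x - poly p (of_real x)) * of_real (poly (b i) x) \<partial>M) = 0"
      by (metis (no_types, lifting) poly_map_poly_of_real complex_cnj_complex_of_real Bochner_Integration.integral_cong)
    then show ?thesis using test[OF that, of c] \<nu>_pos[of i] unfolding c by simp
  qed
  then show "p = partial (coef g) m" unfolding c partial_def by (intro sum.cong) auto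
qed

lemma L2_proj_eq:
  assumes "continuous_on {-1<..<1} g" "\<And>x. x \<in> {-1<..<1} \<Longrightarrow> cmod (g x) \<le> C"
  shows "L2_proj M m g x = (\<Sum>j\<le>m. coef g j * of_real (poly (b j) x))"
  by (simp only: L2_proj_def L2_proj_poly_eq[of g C m, OF assms] poly_partial)

end

section \<open>Orthogonality and norms of the two families\<close>

lemma cheb_T_orthogonal:
  "(\<integral>x. poly (cheb_T i) x * poly (cheb_T j) x \<partial>cheb_measure) = (if i = j then (if i = 0 then pi else pi / 2) else 0)"
proof -
  have *: "(\<integral>x. poly (cheb_T i) x * poly (cheb_T j) x \<partial>cheb_measure) = (if i = j then (if i = 0 then pi else pi / 2) else 0)"
    if "i \<le> j" for i j
  proof -
    have "(\<integral>x. poly (cheb_T i) x * poly (cheb_T j) x \<partial>cheb_measure) =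
        (\<integral>x. (poly (cheb_T (i + j)) x + poly (cheb_T (j - i)) x) / 2 \<partial>cheb_measure)"
    proof (rule Bochner_Integration.integral_cong)
      fix x assume "x \<in> space cheb_measure"
      then have "\<bar>x\<bar> \<le> 1" by (simp add: space_cheb_measure abs_le_iff)
      then show "poly (cheb_T i) x * poly (cheb_T j) x = (poly (cheb_T (i + j)) x + poly (cheb_T (j - i)) x) / 2"
        using cheb_T_mult[OF that, of x] by simp
    qed simp
    also have "\<dots> = ((\<integral>x. poly (cheb_T (i + j)) x \<partial>cheb_measure) + (\<integral>x. poly (cheb_T (j - i)) x \<partial>cheb_measure)) / 2"
      using cheb.integrable_poly by simp
    finally show ?thesis using that by (auto simp: integral_cheb_T)
  qed
  show ?thesis using *[of i j] *[of j i] by (cases "i \<le> j") (auto simp: mult.commute)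
qed

interpretation cheb: orthogonal_polys cheb_measure cheb_T "\<lambda>n. if n = 0 then pi else pi / 2"
  by unfold_locales (use poly_cheb_T_1 degree_cheb_T in \<open>auto simp: cheb_T_orthogonal dest: arg_cong[of _ _ "\<lambda>p. poly p 1"]\<close>)

lemma integral_pderiv:
  "(\<integral>x. poly (pderiv p) x \<partial>unit_lborel) = poly p 1 - poly p (-1)"
  by (rule FTC_unit_lborel) (auto intro!: continuous_intros unit.integrable_poly simp: poly_isCont)

text \<open>Sturm-Liouville argument: the weighted Wronskian \<open>Q\<close> has derivative
  \<open>(N i - N j) P_i P_j\<close> and vanishes at both end points through the factor
  \<open>1 - x^2\<close>. The eigenvalues \<open>k (k + 1)\<close> differ for distinct natural
  numbers.\<close>

lemma legendre_orthogonal_neq: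
  assumes "i \<noteq> j"
  shows "(\<integral>x. poly (legendre i * legendre j) x \<partial>unit_lborel) = 0"
proof -
  define N where "N k = real k * real (k + 1)" for k
  let ?P = legendre and ?w = "[:1, 0, -1:] :: real poly"
  have N: "N i \<noteq> N j"
  proof
    assume "N i = N j"
    then have "(real i - real j) * (real i + real j + 1) = 0" by (simp add: N_def algebra_simps)
    then show False using assms by (auto simp: add_eq_0_iff)
  qed
  define Q where "Q = ?w * (?P i * pderiv (?P j) - ?P j * pderiv (?P i))"
  have "pderiv Q = smult (N i - N j) (?P i * ?P j)"
  proof (rule iffD1[OF poly_eq_poly_eq_iff], rule ext)
    fix x
    have ode: "(1 - x\<^sup>2) * poly (pderiv (pderiv (?P k))) x = 2 * x * poly (pderiv (?P k)) x - N k * poly (?P k) x" for k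
      using arg_cong[OF legendre_ODE[of k], of "\<lambda>p. poly p x"] by (simp add: N_def algebra_simps power2_eq_square)
    have "poly (pderiv Q) x = -2 * x * (poly (?P i) x * poly (pderiv (?P j)) x - poly (?P j) x * poly (pderiv (?P i)) x)
       + (poly (?P i) x * ((1 - x\<^sup>2) * poly (pderiv (pderiv (?P j))) x) - poly (?P j) x * ((1 - x\<^sup>2) * poly (pderiv (pderiv (?P i))) x))"
      unfolding Q_def
      by (simp add: pderiv_mult pderiv_diff pderiv_add pderiv_minus pderiv_pCons power2_eq_square algebra_simps)
    also have "\<dots> = poly (smult (N i - N j) (?P i * ?P j)) x"
      unfolding ode by (simp add: algebra_simps)
    finally show "poly (pderiv Q) x = poly (smult (N i - N j) (?P i * ?P j)) x" .
  qed
  moreover have "(\<integral>x. poly (pderiv Q) x \<partial>unit_lborel) = 0"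
    unfolding integral_pderiv by (simp add: Q_def)
  ultimately show ?thesis using N by simp
qed

text \<open>The integral \<open>X\<close> of \<open>x P_(n+1) P_n\<close> links consecutive norms:
  the recursion for \<open>P_(n+2)\<close> is tested against \<open>P_n\<close>, the one for
  \<open>P_(n+1)\<close> against \<open>P_(n+1)\<close>, and each time one term drops out by
  orthogonality.\<close>

lemma integral_legendre_square:
  "(\<integral>x. poly (legendre n * legendre n) x \<partial>unit_lborel) = 2 / (2 * real n + 1)"
proof (induction n)
  case 0
  show ?case using integral_pderiv[of "[:0, 1:]"] by (simp add: pderiv_pCons)
next
  case (Suc n)
  let ?P = legendre
  define J where "J p = (\<integral>x. poly p x \<partial>unit_lborel)" for p :: "real poly"
  have J: "J (p - q) = J p - J q" "J (smult c p) = c * J p" for p q c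
  proof -
    have "poly (p - q) = (\<lambda>x. poly p x - poly q x)" "poly (smult c p) = (\<lambda>x. c * poly p x)"
      by auto
    then show "J (p - q) = J p - J q" "J (smult c p) = c * J p"
      unfolding J_def by (simp_all add: unit.integrable_poly)
  qed
  have J0: "J (?P i * ?P j) = 0" if "i \<noteq> j" for i j
    using legendre_orthogonal_neq[OF that] by (simp add: J_def)
  define X where "X = J ([:0, 1:] * ?P (Suc n) * ?P n)"
  have "smult (real (n + 2)) (?P (Suc (Suc n)) * ?P n) =
      smult (real (2 * n + 3)) ([:0, 1:] * ?P (Suc n) * ?P n) - smult (real (n + 1)) (?P n * ?P n)"
  proof (rule iffD1[OF poly_eq_poly_eq_iff], rule ext)
    fix x
    show "poly (smult (real (n + 2)) (?P (Suc (Suc n)) * ?P n)) x = poly (smult (real (2 * n + 3))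
        ([:0, 1:] * ?P (Suc n) * ?P n) - smult (real (n + 1)) (?P n * ?P n)) x"
      using arg_cong[OF poly_legendre_Suc_Suc[of n x], of "\<lambda>y. y * poly (?P n) x"]
      by (simp add: algebra_simps del: legendre.simps of_nat_add of_nat_mult)
  qed
  from arg_cong[OF this, of J] have 1: "real (2 * n + 3) * X = real (n + 1) * J (?P n * ?P n)"
    using J0[of "Suc (Suc n)" n] unfolding J X_def by simp
  have "smult (real (n + 1)) (?P (Suc n) * ?P (Suc n)) =
      smult (real (2 * n + 1)) ([:0, 1:] * ?P (Suc n) * ?P n) - smult (real n) (?P (n - 1) * ?P (Suc n))"
  proof (rule iffD1[OF poly_eq_poly_eq_iff], rule ext)
    fix x
    show "poly (smult (real (n + 1)) (?P (Suc n) * ?P (Suc n))) x = poly (smult (real (2 * n + 1))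
        ([:0, 1:] * ?P (Suc n) * ?P n) - smult (real n) (?P (n - 1) * ?P (Suc n))) x"
      using arg_cong[OF poly_legendre_Suc[of n x], of "\<lambda>y. y * poly (?P (Suc n)) x"]
      by (simp add: algebra_simps del: legendre.simps of_nat_add of_nat_mult)
  qed
  from arg_cong[OF this, of J] have 2: "real (n + 1) * J (?P (Suc n) * ?P (Suc n)) = real (2 * n + 1) * X"
    using J0[of "n - 1" "Suc n"] unfolding J X_def by simp
  have "J (?P n * ?P n) = 2 / real (2 * n + 1)" using Suc by (simp add: J_def)
  with 1 have "real (2 * n + 3) * X = real (n + 1) * (2 / real (2 * n + 1))" by (simp only:)
  moreover have "real (2 * n + 3) \<noteq> 0" by simp
  ultimately have X: "X = real (n + 1) * (2 / real (2 * n + 1)) / real (2 * n + 3)"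
    by (metis nonzero_mult_div_cancel_left)
  have "J (?P (Suc n) * ?P (Suc n)) = real (2 * n + 1) * X / real (n + 1)"
    using 2 by (simp add: field_simps)
  also have "\<dots> = 2 / real (2 * n + 3)"
    unfolding X by (simp add: divide_simps del: of_nat_add of_nat_mult)
  finally show ?case by (simp add: J_def add.commute del: poly_mult)
qed

interpretation unit: orthogonal_polys unit_lborel legendre "\<lambda>n. 2 / (2 * real n + 1)"
proof unfold_locales
  show "legendre n \<noteq> 0" for n using poly_legendre_endpoint[of 1 n] by auto
  show "(\<integral>x. poly (legendre i) x * poly (legendre j) x \<partial>unit_lborel) = (if i = j then 2 / (2 * real i + 1) else 0)" for i j
    using legendre_orthogonal_neq[of i j] integral_legendre_square[of i] by (cases "i = j") simp_all
qed (auto simp: degree_legendre)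

section \<open>Projection errors of a Chebyshev series\<close>

lemma (in interval_measure) integral_norm_diff_le:
  fixes f g :: "real \<Rightarrow> complex"
  assumes "integrable M f" "integrable M g"
    and "\<And>x. x \<in> {-1<..<1} \<Longrightarrow> cmod (f x - g x) \<le> u x" "integrable M u"
  shows "cmod ((\<integral>x. f x \<partial>M) - (\<integral>x. g x \<partial>M)) \<le> (\<integral>x. u x \<partial>M)"
proof -
  have "cmod (\<integral>x. f x - g x \<partial>M) \<le> (\<integral>x. u x \<partial>M)"
    using assms by (intro Bochner_Integration.integral_norm_bound_integral) (auto simp: space_M)
  then show ?thesis using assms(1,2) by simp
qed

context orthogonal_polys
begin

lemma coef_partial:
  assumes "i \<le> m"
  shows "coef (\<lambda>x. poly (partial c m) (of_real x)) i = c i"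
  using integral_partial_mult[OF assms] \<nu>_pos[of i] by (simp add: coef_def)

lemma partial_extend:
  assumes "m < i"
  shows "partial c m = partial (\<lambda>j. if j \<le> m then c j else 0) i"
proof -
  have "partial (\<lambda>j. if j \<le> m then c j else 0) i = (\<Sum>j\<le>i. if j \<le> m then smult (c j) (map_poly of_real (b j)) else 0)"
    unfolding partial_def by (intro sum.cong) auto
  also have "\<dots> = (\<Sum>j\<in>{..i} \<inter> {j. j \<le> m}. smult (c j) (map_poly of_real (b j)))"
    by (subst sum.inter_restrict) simp_all
  also have "{..i} \<inter> {j. j \<le> m} = {..m}" using assms by auto
  finally show ?thesis by (simp add: partial_def)
qed

text \<open>The coefficients are padded with zeros up to index \<open>i\<close>, and the coefficient
  functional reads off the zero.\<close>

lemma coef_poly_degree_less: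
  assumes "degree p < i"
  shows "coef (\<lambda>x. poly p (of_real x)) i = 0"
proof -
  have "degree p \<le> i - 1" using assms by simp
  from basis[OF this] obtain c where c: "p = partial c (i - 1)" by blast
  let ?c = "\<lambda>j. if j \<le> i - 1 then c j else 0"
  have "partial c (i - 1) = partial ?c i"
    using assms by (intro partial_extend) simp
  then have "coef (\<lambda>x. poly p (of_real x)) i = coef (\<lambda>x. poly (partial ?c i) (of_real x)) i"
    unfolding c by (simp only:)
  also have "\<dots> = ?c i" by (rule coef_partial) simp
  finally show ?thesis using assms by simp
qed

text \<open>Perturbation bound: a uniform error costs the \<open>L1\<close> norm of
  \<open>b i\<close> over its squared norm. It serves both to pass to uniform limits and to estimate
  Legendre coefficients.\<close>

lemma coef_diff_le:
  assumes f: "continuous_on {-1<..<1} f" "\<And>x. x \<in> {-1<..<1} \<Longrightarrow> cmod (f x) \<le> C"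
    and g: "continuous_on {-1<..<1} g" "\<And>x. x \<in> {-1<..<1} \<Longrightarrow> cmod (g x) \<le> D"
    and fg: "\<And>x. x \<in> {-1<..<1} \<Longrightarrow> cmod (f x - g x) \<le> e"
  shows "cmod (coef f i - coef g i) \<le> e * (\<integral>x. \<bar>poly (b i) x\<bar> \<partial>M) / \<nu> i"
proof -
  have int: "integrable M (\<lambda>x. f x * of_real (poly (b i) x))" "integrable M (\<lambda>x. g x * of_real (poly (b i) x))"
    using integrable_mult_poly[OF f, of "map_poly of_real (b i)"] integrable_mult_poly[OF g, of "map_poly of_real (b i)"]
    by (simp_all add: poly_map_poly_of_real)
  have "cmod ((\<integral>x. f x * of_real (poly (b i) x) \<partial>M) - (\<integral>x. g x * of_real (poly (b i) x) \<partial>M)) \<le>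
      (\<integral>x. e * \<bar>poly (b i) x\<bar> \<partial>M)"
  proof (rule integral_norm_diff_le[OF int])
    show "cmod (f x * of_real (poly (b i) x) - g x * of_real (poly (b i) x)) \<le> e * \<bar>poly (b i) x\<bar>"
      if "x \<in> {-1<..<1}" for x
      unfolding left_diff_distrib[symmetric] norm_mult using fg[OF that] by (simp add: mult_right_mono)
    show "integrable M (\<lambda>x. e * \<bar>poly (b i) x\<bar>)"
      using integrable_poly by (intro integrable_mult_right integrable_abs) auto
  qed
  then have "cmod ((\<integral>x. f x * of_real (poly (b i) x) \<partial>M) - (\<integral>x. g x * of_real (poly (b i) x) \<partial>M)) / \<nu> i \<le>
      e * (\<integral>x. \<bar>poly (b i) x\<bar> \<partial>M) / \<nu> i"
    using \<nu>_pos[of i] by (intro divide_right_mono) auto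
  moreover have "coef f i - coef g i = ((\<integral>x. f x * of_real (poly (b i) x) \<partial>M) - (\<integral>x. g x * of_real (poly (b i) x) \<partial>M)) / of_real (\<nu> i)"
    by (simp add: coef_def diff_divide_distrib)
  ultimately show ?thesis using \<nu>_pos[of i] by (simp add: norm_divide)
qed

end

text \<open>Converts the classical convention with \<open>a 0 / 2\<close> into plain coefficients
  with respect to the \<open>cheb_T n\<close>, as computed by \<open>cheb.coef\<close>.\<close>

definition half0 :: "(nat \<Rightarrow> complex) \<Rightarrow> nat \<Rightarrow> complex" where
  "half0 a n = (if n = 0 then a 0 / 2 else a n)"

lemma half0_inject: "half0 a = half0 b \<Longrightarrow> a = b"
proof
  fix n assume "half0 a = half0 b"
  then have "half0 a n = half0 b n" by simp
  then show "a n = b n" by (cases "n = 0") (simp_all add: half0_def)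
qed

definition cheb_sum :: "(nat \<Rightarrow> complex) \<Rightarrow> nat \<Rightarrow> real \<Rightarrow> complex" where
  "cheb_sum a K x = a 0 / 2 + (\<Sum>n=1..K. a n * of_real (poly (cheb_T n) x))"

lemma cheb_sum_Suc: "cheb_sum a (Suc K) x = cheb_sum a K x + a (Suc K) * of_real (poly (cheb_T (Suc K)) x)"
  by (simp add: cheb_sum_def del: cheb_T.simps)

lemma cheb_sum_eq_poly: "cheb_sum a K x = poly (cheb.partial (half0 a) K) (of_real x)"
proof -
  have "(\<Sum>j\<le>K. half0 a j * of_real (poly (cheb_T j) x)) =
      half0 a 0 * of_real (poly (cheb_T 0) x) + (\<Sum>j=1..K. half0 a j * of_real (poly (cheb_T j) x))"
    by (simp add: atMost_atLeast0 sum.atLeast_Suc_atMost)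
  also have "(\<Sum>j=1..K. half0 a j * of_real (poly (cheb_T j) x)) = (\<Sum>j=1..K. a j * of_real (poly (cheb_T j) x))"
    by (intro sum.cong) (auto simp: half0_def)
  finally show ?thesis unfolding cheb.poly_partial cheb_sum_def by (simp add: half0_def)
qed

lemma cheb_expansion_iff: "cheb_expansion a g \<longleftrightarrow> uniform_limit {-1<..<1} (cheb_sum a) g sequentially"
  unfolding cheb_expansion_def cheb_sum_def[abs_def] ..

text \<open>Coefficients are continuous under uniform convergence, and those of the partial sums no
  longer change once \<open>K \<ge> n\<close>. Uniqueness of the expansion follows, which gives
  \<open>cheb_coeff\<close> its meaning.\<close>

lemma cheb_coef_expansion:
  assumes g: "continuous_on {-1<..<1} g" "\<And>x. x \<in> {-1<..<1} \<Longrightarrow> cmod (g x) \<le> C"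
    and a: "cheb_expansion a g"
  shows "cheb.coef g n = half0 a n"
proof -
  define \<nu> where "\<nu> = (if n = 0 then pi else pi / 2)"
  define I where "I = (\<integral>x. \<bar>poly (cheb_T n) x\<bar> \<partial>cheb_measure) / \<nu>"
  have I: "0 \<le> I" by (simp add: I_def \<nu>_def)
  have "cmod (cheb.coef g n - half0 a n) \<le> 0 + e" if "e > 0" for e
  proof -
    define e' where "e' = e / (I + 1)"
    have e': "e' > 0" using that I by (simp add: e'_def)
    have "eventually (\<lambda>K. \<forall>x\<in>{-1<..<1}. dist (cheb_sum a K x) (g x) < e') sequentially"
      using a e' unfolding cheb_expansion_iff uniform_limit_iff by blast
    from eventually_happens'[OF sequentially_bot eventually_conj[OF this eventually_ge_at_top[of n]]]
    obtain K where K: "K \<ge> n" "\<forall>x\<in>{-1<..<1}. dist (cheb_sum a K x) (g x) < e'" by blast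
    obtain D where D: "\<And>x. x \<in> {-1<..<1} \<Longrightarrow> cmod (cheb_sum a K x) \<le> D"
      unfolding cheb_sum_eq_poly using cheb.poly_bounded[of "cheb.partial (half0 a) K"] by blast
    have "cmod (cheb.coef g n - cheb.coef (cheb_sum a K) n) \<le> e' * (\<integral>x. \<bar>poly (cheb_T n) x\<bar> \<partial>cheb_measure) / (if n = 0 then pi else pi / 2)"
    proof (rule cheb.coef_diff_le[OF g _ D])
      show "continuous_on {-1<..<1} (cheb_sum a K)"
        unfolding cheb_sum_eq_poly by (intro continuous_intros)
      show "cmod (g x - cheb_sum a K x) \<le> e'" if x: "x \<in> {-1<..<1}" for x
      proof -
        have "dist (cheb_sum a K x) (g x) < e'" using K(2) x by blast
        then show ?thesis by (simp add: dist_norm norm_minus_commute)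
      qed
    qed auto
    also have "\<dots> = e' * I" by (simp add: I_def \<nu>_def)
    also have "e' * I \<le> e' * (I + 1)" using e' by simp
    also have "\<dots> = e" using I by (simp add: e'_def)
    finally show ?thesis
      using cheb.coef_partial[OF K(1), of "half0 a"] by (simp add: cheb_sum_eq_poly[abs_def])
  qed
  then have "cmod (cheb.coef g n - half0 a n) \<le> 0" by (rule field_le_epsilon)
  then show ?thesis by simp
qed

lemma cheb_coeff_eq:
  assumes g: "continuous_on {-1<..<1} g" "\<And>x. x \<in> {-1<..<1} \<Longrightarrow> cmod (g x) \<le> C"
    and a: "cheb_expansion a g"
  shows "cheb_coeff g = a"
  unfolding cheb_coeff_def
proof (rule the_equality)
  fix b assume b: "cheb_expansion b g"
  have "half0 b n = half0 a n" for n
  proof (rule trans[OF sym])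
    show "cheb.coef g n = half0 b n" by (rule cheb_coef_expansion[OF g b])
    show "cheb.coef g n = half0 a n" by (rule cheb_coef_expansion[OF g a])
  qed
  then show "b = a" by (rule half0_inject[OF ext])
qed (rule a)

text \<open>After division by \<open>sin t\<close> this is the bound \<open>k\<close> for the
  polynomial \<open>U (k - 1)\<close> of the second kind. Keeping the sine avoids introducing these
  polynomials.\<close>

lemma abs_sin_of_nat_mult_le:
  fixes t :: real
  assumes "0 \<le> sin t"
  shows "\<bar>sin (real k * t)\<bar> \<le> real k * sin t"
proof (induction k)
  case (Suc k)
  have "sin (real (Suc k) * t) = sin (real k * t) * cos t + cos (real k * t) * sin t"
    by (simp add: distrib_right sin_add)
  also have "\<bar>\<dots>\<bar> \<le> \<bar>sin (real k * t)\<bar> * 1 + 1 * sin t"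
    using assms by (intro order_trans[OF abs_triangle_ineq] add_mono)
      (auto simp: abs_mult intro!: mult_left_le mult_right_mono mult_left_le_one_le)
  also have "\<dots> \<le> real (Suc k) * sin t" using Suc by (simp add: distrib_right)
  finally show ?case .
qed simp

text \<open>The expansion in the polynomials \<open>U j\<close> of the second kind, where \<open>U j (cos t) sin t = sin ((j + 1) t)\<close>,
  in terms of \<open>2 T n = U n - U (n - 2)\<close>.\<close>

lemma cheb_sum_sin:
  "of_real (sin t) * cheb_sum a J (cos t) =
     (\<Sum>j\<le>J. (a j - a (j + 2)) / 2 * of_real (sin (real (j + 1) * t)))
     + (a (J + 1) * of_real (sin (real J * t)) + a (J + 2) * of_real (sin (real (J + 1) * t))) / 2"
proof (induction J)
  case (Suc J)
  have "real (J + 2) * t = real (J + 1) * t + t" "real J * t = real (J + 1) * t - t"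
    by (simp_all add: algebra_simps)
  then have *: "sin t * cos (real (J + 1) * t) = (sin (real (J + 2) * t) - sin (real J * t)) / 2"
    by (simp only: sin_add sin_diff) simp
  have "of_real (sin t) * cheb_sum a (Suc J) (cos t) =
      of_real (sin t) * cheb_sum a J (cos t) + a (J + 1) * of_real (sin t * cos (real (J + 1) * t))"
    by (simp add: cheb_sum_Suc poly_cheb_T_cos algebra_simps del: cheb_T.simps of_nat_Suc)
  then show ?case
    unfolding Suc * by (simp add: algebra_simps diff_divide_distrib add_divide_distrib)
qed (simp add: cheb_sum_def algebra_simps diff_divide_distrib add_divide_distrib)

text \<open>Cauchy-Schwarz in pointwise form: \<open>2 p \<le> c p^2 + 1 / c\<close>, where
  \<open>c = sqrt (2 j + 1)\<close> balances the squared norm \<open>2 / (2 j + 1)\<close> against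
  the total mass 2.\<close>

lemma integral_abs_legendre_le:
  "(\<integral>x. \<bar>poly (legendre j) x\<bar> \<partial>unit_lborel) \<le> 2 / sqrt (2 * real j + 1)"
proof -
  define c where "c = sqrt (2 * real j + 1)"
  have c: "c > 0" "c\<^sup>2 = 2 * real j + 1" by (simp_all add: c_def add_nonneg_pos)
  have i2: "integrable unit_lborel (\<lambda>x. (poly (legendre j) x)\<^sup>2)"
    using unit.integrable_poly[of "legendre j ^ 2"] by (simp add: poly_power[abs_def])
  have 1: "(\<integral>x. 1 \<partial>unit_lborel) = (2::real)"
    using unit.ortho[of 0 0] by simp
  have "(\<integral>x. \<bar>poly (legendre j) x\<bar> \<partial>unit_lborel) \<le> (\<integral>x. (c * (poly (legendre j) x)\<^sup>2 + 1 / c) / 2 \<partial>unit_lborel)"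
  proof (rule integral_mono)
    show "integrable unit_lborel (\<lambda>x. \<bar>poly (legendre j) x\<bar>)"
      using unit.integrable_poly by (intro integrable_abs) auto
    show "integrable unit_lborel (\<lambda>x. (c * (poly (legendre j) x)\<^sup>2 + 1 / c) / 2)"
      using i2 by simp
    show "\<bar>poly (legendre j) x\<bar> \<le> (c * (poly (legendre j) x)\<^sup>2 + 1 / c) / 2" for x
    proof -
      define p where "p = \<bar>poly (legendre j) x\<bar>"
      have "0 \<le> (c * p - 1)\<^sup>2 / c" using c by simp
      also have "\<dots> = c * p\<^sup>2 + 1 / c - 2 * p"
        using c(1) by (simp add: power2_eq_square field_simps)
      finally show ?thesis by (simp add: p_def)
    qed
  qed
  also have "\<dots> = (c * (2 / (2 * real j + 1)) + 1 / c * 2) / 2"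
    using i2 1 unit.ortho[of j j] by (simp add: power2_eq_square)
  also have "\<dots> = 2 / c"
    unfolding c(2)[symmetric] using c(1) by (simp add: field_simps power2_eq_square)
  finally show ?thesis by (simp add: c_def)
qed

text \<open>The right-hand side is the derivative of the geometric series. Arbitrary finite sets
  include singletons, which bound one term.\<close>

lemma sum_Suc_power_le:
  fixes q :: real
  assumes "0 \<le> q" "q < 1" "finite A"
  shows "(\<Sum>k\<in>A. real (Suc k) * q ^ k) \<le> 1 / (1 - q)\<^sup>2"
proof -
  have s: "(\<lambda>k. real (Suc k) * q ^ k) sums (1 / (1 - q)\<^sup>2)"
    using geometric_deriv_sums[of q] assms by simp
  show ?thesis
    using sum_le_suminf[OF sums_summable[OF s] assms(3)] sums_unique[OF s] assms(1) by simp
qed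

text \<open>In the application \<open>E n\<close> is \<open>exp_minus (lam_star lam n)\<close>,
  \<open>N\<close> is the norm of \<open>g\<close>, and \<open>q\<close> and \<open>m0\<close>
  depend only on \<open>lam\<close>; so constants built from \<open>q\<close> are uniform in
  \<open>g\<close>. The coefficient bound is required from \<open>m0\<close> on only, as it can fail
  for smaller indices when \<open>lam\<close> jumps at 0.\<close>

locale cheb_series =
  fixes g :: "real \<Rightarrow> complex" and a :: "nat \<Rightarrow> complex" and E :: "nat \<Rightarrow> real" and q N C :: real and m0 :: nat
  assumes cont: "continuous_on {-1<..<1} g"
    and bdd: "x \<in> {-1<..<1} \<Longrightarrow> cmod (g x) \<le> C"
    and expansion: "cheb_expansion a g"
    and a_le: "n \<ge> m0 \<Longrightarrow> cmod (a n) \<le> 2 * E n * N"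
    and E_le: "m \<ge> m0 \<Longrightarrow> E (m + k) \<le> q ^ k * E m"
    and q: "0 < q" "q < 1"
    and E_nonneg: "0 \<le> E n"
    and N_nonneg: "0 \<le> N"
begin

text \<open>The polynomials are bounded by 1, so the tail is dominated by a geometric series. Its
  first index is \<open>Suc K\<close>, hence the form of the threshold and of the bound.\<close>

lemma cheb_sum_error:
  assumes "m0 \<le> Suc K" "x \<in> {-1<..<1}"
  shows "cmod (g x - cheb_sum a K x) \<le> 2 / (1 - q) * E (Suc K) * N"
proof -
  have "(\<lambda>J. cheb_sum a J x) \<longlonglongrightarrow> g x"
    using expansion assms(2) unfolding cheb_expansion_iff by (rule tendsto_uniform_limitI)
  then have lim: "(\<lambda>J. cmod (cheb_sum a J x - cheb_sum a K x)) \<longlonglongrightarrow> cmod (g x - cheb_sum a K x)"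
    by (intro tendsto_intros)
  have bound: "cmod (cheb_sum a J x - cheb_sum a K x) \<le> 2 / (1 - q) * E (Suc K) * N" if "K \<le> J" for J
  proof -
    have x: "\<bar>x\<bar> \<le> 1" using assms(2) by auto
    define d where "d = J - K"
    have d: "J = K + d" using that by (simp add: d_def)
    have diff: "cheb_sum a (K + d) x - cheb_sum a K x = (\<Sum>k<d. a (Suc K + k) * of_real (poly (cheb_T (Suc K + k)) x))" for d
    proof (induction d)
      case (Suc d)
      have "cheb_sum a (K + Suc d) x - cheb_sum a K x =
          (cheb_sum a (K + d) x - cheb_sum a K x) + a (Suc K + d) * of_real (poly (cheb_T (Suc K + d)) x)"
        by (simp only: add_Suc_right add_Suc cheb_sum_Suc add_diff_eq diff_add_eq)
      then show ?case unfolding Suc sum.lessThan_Suc .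
    qed simp
    have "cmod (cheb_sum a J x - cheb_sum a K x) \<le> (\<Sum>k<d. cmod (a (Suc K + k) * of_real (poly (cheb_T (Suc K + k)) x)))"
      unfolding d diff by (rule norm_sum)
    also have "\<dots> \<le> (\<Sum>k<d. 2 * E (Suc K) * N * q ^ k)"
    proof (rule sum_mono)
      fix k
      have "cmod (a (Suc K + k) * of_real (poly (cheb_T (Suc K + k)) x)) \<le> cmod (a (Suc K + k)) * 1"
        unfolding norm_mult norm_of_real by (intro mult_left_mono abs_poly_cheb_T_le_1 x) auto
      also have "\<dots> \<le> 2 * E (Suc K + k) * N" using a_le[of "Suc K + k"] assms(1) by simp
      also have "\<dots> \<le> 2 * (q ^ k * E (Suc K)) * N"
        using E_le[OF assms(1), of k] N_nonneg by (intro mult_right_mono mult_left_mono) auto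
      finally show "cmod (a (Suc K + k) * of_real (poly (cheb_T (Suc K + k)) x)) \<le> 2 * E (Suc K) * N * q ^ k"
        by (simp add: mult_ac)
    qed
    also have "\<dots> = 2 * E (Suc K) * N * (\<Sum>k<d. q ^ k)" by (simp add: sum_distrib_left)
    also have "\<dots> \<le> 2 * E (Suc K) * N * (1 / (1 - q))"
    proof (rule mult_left_mono)
      show "(\<Sum>k<d. q ^ k) \<le> 1 / (1 - q)"
      proof -
        have "(\<Sum>k<d. q ^ k) = (1 - q ^ d) / (1 - q)" using q by (simp add: sum_gp_strict)
        also have "\<dots> \<le> 1 / (1 - q)" using q by (intro divide_right_mono) auto
        finally show ?thesis .
      qed
    qed (use E_nonneg N_nonneg in auto)
    finally show ?thesis by simp
  qed
  show ?thesis by (rule LIMSEQ_le_const2[OF lim]) (intro exI[of _ K] allI impI bound)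
qed

lemma L2_proj_cheb_eq: "L2_proj cheb_measure m g x = cheb_sum a m x"
proof -
  have coef: "cheb.coef g j = half0 a j" for j by (rule cheb_coef_expansion[OF cont bdd expansion])
  have "L2_proj cheb_measure m g x = (\<Sum>j\<le>m. cheb.coef g j * of_real (poly (cheb_T j) x))"
    by (rule cheb.L2_proj_eq[OF cont bdd])
  then show ?thesis unfolding coef cheb_sum_eq_poly cheb.poly_partial .
qed

lemma L2_proj_cheb_error:
  assumes "m0 \<le> m" "x \<in> {-1<..<1}"
  shows "cmod (g x - L2_proj cheb_measure m g x) \<le> 2 / (1 - q) * E m * N"
proof -
  have "E (Suc m) \<le> q ^ 1 * E m" using E_le[OF assms(1), of 1] by (simp only: Suc_eq_plus1)
  also have "\<dots> \<le> 1 * E m" using q E_nonneg by (intro mult_right_mono) auto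
  finally have "2 / (1 - q) * E (Suc m) * N \<le> 2 / (1 - q) * E m * N"
    using q N_nonneg by (intro mult_right_mono mult_left_mono) auto
  moreover have "cmod (g x - cheb_sum a m x) \<le> 2 / (1 - q) * E (Suc m) * N"
    using assms by (intro cheb_sum_error) auto
  ultimately show ?thesis unfolding L2_proj_cheb_eq by (rule order_trans[rotated])
qed

lemma L2_proj_unit_eq: "L2_proj unit_lborel m g x = (\<Sum>j\<le>m. unit.coef g j * of_real (poly (legendre j) x))"
  by (rule unit.L2_proj_eq[OF cont bdd])

text \<open>The truncated Chebyshev series has degree at most \<open>K\<close>, so the Legendre
  expansion reproduces it with coefficients \<open>c\<close>. The uniform truncation error is
  multiplied by the \<open>L1\<close> norm of \<open>P_j\<close> over its squared norm, at most
  \<open>sqrt (2 j + 1)\<close>. At index \<open>Suc K\<close> the polynomial contributes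
  nothing.\<close>

lemma legendre_coef_le:
  assumes "m0 \<le> Suc K"
  obtains c where "cheb.partial (half0 a) K = unit.partial c K"
    and "\<And>j. j \<le> K \<Longrightarrow> cmod (unit.coef g j - c j) \<le> sqrt (2 * real j + 1) * (2 / (1 - q) * E (Suc K) * N)"
    and "cmod (unit.coef g (Suc K)) \<le> sqrt (2 * real (Suc K) + 1) * (2 / (1 - q) * E (Suc K) * N)"
proof -
  define p where "p = cheb.partial (half0 a) K"
  define e where "e = 2 / (1 - q) * E (Suc K) * N"
  have e: "e \<ge> 0" using q E_nonneg N_nonneg by (simp add: e_def)
  from unit.basis[OF cheb.degree_partial[of "half0 a" K]]
  obtain c where c: "p = unit.partial c K" unfolding p_def by blast
  obtain D where D: "\<And>x. x \<in> {-1<..<1} \<Longrightarrow> cmod (poly p (of_real x)) \<le> D"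
    using unit.poly_bounded[of p] by blast
  have *: "cmod (unit.coef g j - unit.coef (\<lambda>x. poly p (of_real x)) j) \<le> sqrt (2 * real j + 1) * e" for j
  proof -
    have "cmod (unit.coef g j - unit.coef (\<lambda>x. poly p (of_real x)) j) \<le>
        e * (\<integral>x. \<bar>poly (legendre j) x\<bar> \<partial>unit_lborel) / (2 / (2 * real j + 1))"
    proof (rule unit.coef_diff_le[OF cont bdd _ D])
      show "cmod (g x - poly p (of_real x)) \<le> e" if "x \<in> {-1<..<1}" for x
        using cheb_sum_error[OF assms that] by (simp add: p_def cheb_sum_eq_poly e_def)
    qed (auto intro!: continuous_intros)
    also have "\<dots> \<le> e * (2 / sqrt (2 * real j + 1)) / (2 / (2 * real j + 1))"
      using e by (intro divide_right_mono mult_left_mono integral_abs_legendre_le) auto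
    also have "\<dots> = e * ((2 * real j + 1) / sqrt (2 * real j + 1))" by simp
    also have "(2 * real j + 1) / sqrt (2 * real j + 1) = sqrt (2 * real j + 1)"
      by (rule real_div_sqrt) simp
    finally show ?thesis by (simp add: mult.commute)
  qed
  show ?thesis
  proof (rule that[of c])
    show "cheb.partial (half0 a) K = unit.partial c K" using c by (simp add: p_def)
    show "cmod (unit.coef g j - c j) \<le> sqrt (2 * real j + 1) * (2 / (1 - q) * E (Suc K) * N)" if "j \<le> K" for j
      using *[of j] unit.coef_partial[OF that, of c] by (simp add: c e_def)
    have "degree p < Suc K" using cheb.degree_partial[of "half0 a" K] by (simp add: p_def)
    from unit.coef_poly_degree_less[OF this]
    show "cmod (unit.coef g (Suc K)) \<le> sqrt (2 * real (Suc K) + 1) * (2 / (1 - q) * E (Suc K) * N)"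
      using *[of "Suc K"] by (simp add: e_def)
  qed
qed

text \<open>The limit has to be identified before differences of projections can be summed as a
  tail. A crude comparison with the Chebyshev sum of the same degree suffices: the loss is quadratic
  in \<open>J\<close>, the error geometric.\<close>

lemma L2_proj_legendre_converges:
  assumes "x \<in> {-1<..<1}"
  shows "(\<lambda>J. L2_proj unit_lborel J g x) \<longlonglongrightarrow> g x"
proof (rule Lim_null[THEN iffD2])
  \<comment> \<open>With this \<open>s\<close>, \<open>n^2 q^n\<close> is the square of
    \<open>n s^n\<close>, whose limit 0 is standard.\<close>
  define s where "s = sqrt q"
  have s: "0 < s" "s < 1" "s\<^sup>2 = q" using q by (auto simp: s_def)
  define A where "A = 2 / (1 - q) * N * (E m0 / q ^ m0)"
  have A: "A \<ge> 0" using q E_nonneg N_nonneg by (simp add: A_def)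
  have bound: "cmod (L2_proj unit_lborel J g x - g x) \<le> A * ((real (Suc J) * s ^ Suc J)\<^sup>2 * 2 + q ^ Suc J)"
    if "J \<ge> m0" for J
  proof -
    define e where "e = 2 / (1 - q) * E (Suc J) * N"
    have e: "e \<ge> 0" using q E_nonneg N_nonneg by (simp add: e_def)
    have "E (m0 + (Suc J - m0)) \<le> q ^ (Suc J - m0) * E m0" by (rule E_le) simp
    then have "E (Suc J) \<le> q ^ Suc J * (E m0 / q ^ m0)"
      using that q by (simp add: power_diff del: power_Suc)
    then have eA: "e \<le> A * q ^ Suc J"
    proof -
      have "e = 2 / (1 - q) * N * E (Suc J)" by (simp add: e_def)
      also have "\<dots> \<le> 2 / (1 - q) * N * (q ^ Suc J * (E m0 / q ^ m0))"
        using q N_nonneg \<open>E (Suc J) \<le> _\<close> by (intro mult_left_mono) auto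
      finally show ?thesis by (simp add: A_def mult_ac)
    qed
    have "m0 \<le> Suc J" using that by simp
    then obtain c where c: "cheb.partial (half0 a) J = unit.partial c J"
      and cj: "\<And>j. j \<le> J \<Longrightarrow> cmod (unit.coef g j - c j) \<le> sqrt (2 * real j + 1) * e"
      using legendre_coef_le[of J] unfolding e_def[symmetric] by auto
    have S: "cheb_sum a J x = (\<Sum>j\<le>J. c j * of_real (poly (legendre j) x))"
      by (simp add: cheb_sum_eq_poly c unit.poly_partial)
    have "cmod (L2_proj unit_lborel J g x - cheb_sum a J x) =
        cmod (\<Sum>j\<le>J. (unit.coef g j - c j) * of_real (poly (legendre j) x))"
      unfolding S L2_proj_unit_eq sum_subtractf[symmetric] by (simp only: left_diff_distrib)
    also have "\<dots> \<le> (\<Sum>j\<le>J. 2 * real (Suc J) * e)"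
    proof (rule sum_norm_le)
      fix j assume j: "j \<in> {..J}"
      have "sqrt (2 * real j + 1) \<le> sqrt ((2 * real j + 1)\<^sup>2)"
        by (intro real_sqrt_le_mono) (simp add: power2_eq_square)
      also have "\<dots> = 2 * real j + 1" by simp
      also have "\<dots> \<le> 2 * real (Suc J)" using j by simp
      finally have "sqrt (2 * real j + 1) * e \<le> 2 * real (Suc J) * e" using e by (rule mult_right_mono)
      moreover have "cmod ((unit.coef g j - c j) * of_real (poly (legendre j) x)) \<le> sqrt (2 * real j + 1) * e * 1"
        unfolding norm_mult norm_of_real
        using cj[of j] j e assms by (intro mult_mono abs_poly_legendre_le_1) auto
      ultimately show "cmod ((unit.coef g j - c j) * of_real (poly (legendre j) x)) \<le> 2 * real (Suc J) * e"
        by simp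
    qed
    also have "\<dots> = (real (Suc J))\<^sup>2 * 2 * e" by (simp add: power2_eq_square)
    finally have "cmod (L2_proj unit_lborel J g x - cheb_sum a J x) \<le> (real (Suc J))\<^sup>2 * 2 * e" .
    moreover have "cmod (cheb_sum a J x - g x) \<le> e"
      using cheb_sum_error[of J x] that assms by (simp add: e_def norm_minus_commute)
    ultimately have "cmod (L2_proj unit_lborel J g x - g x) \<le> (real (Suc J))\<^sup>2 * 2 * e + e"
      using norm_triangle_le[of "L2_proj unit_lborel J g x - cheb_sum a J x" "cheb_sum a J x - g x"] by simp
    also have "\<dots> = ((real (Suc J))\<^sup>2 * 2 + 1) * e" by (simp add: distrib_right)
    also have "\<dots> \<le> ((real (Suc J))\<^sup>2 * 2 + 1) * (A * q ^ Suc J)"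
      using eA by (rule mult_left_mono) simp
    also have "\<dots> = A * ((real (Suc J) * s ^ Suc J)\<^sup>2 * 2 + q ^ Suc J)"
    proof -
      have "(s ^ Suc J)\<^sup>2 = q ^ Suc J"
        unfolding s(3)[symmetric] power_mult[symmetric] by (simp only: mult.commute)
      then have "(real (Suc J) * s ^ Suc J)\<^sup>2 = (real (Suc J))\<^sup>2 * q ^ Suc J"
        unfolding power_mult_distrib by (simp only:)
      then show ?thesis by (simp only:) (simp only: distrib_left distrib_right mult_ac mult_1_left)
    qed
    finally show ?thesis .
  qed
  have "(\<lambda>n. A * ((real n * s ^ n)\<^sup>2 * 2 + q ^ n)) \<longlonglongrightarrow> A * (0\<^sup>2 * 2 + 0)"
    using s q by (intro tendsto_intros powser_times_n_limit_0 LIMSEQ_power_zero) auto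
  then have "(\<lambda>J. A * ((real (Suc J) * s ^ Suc J)\<^sup>2 * 2 + q ^ Suc J)) \<longlonglongrightarrow> 0"
    by (intro LIMSEQ_Suc) simp
  then show "(\<lambda>J. L2_proj unit_lborel J g x - g x) \<longlonglongrightarrow> 0"
    by (rule Lim_null_comparison[rotated]) (rule eventually_sequentiallyI[of m0], rule bound)
qed

text \<open>A direct comparison with the Chebyshev sum of degree \<open>m\<close> would add up all
  the lower coefficient errors and cost a higher power of \<open>m\<close>. In the tail, the
  coefficient of index \<open>m + k + 1\<close> is compared with the Chebyshev sum of degree
  \<open>m + k\<close>, so each term brings its own decay \<open>q ^ k\<close>.\<close>

lemma L2_proj_legendre_error:
  assumes "m0 \<le> m" "x \<in> {-1<..<1}"
  shows "cmod (g x - L2_proj unit_lborel m g x) \<le> 4 / (1 - q) ^ 3 * sqrt (real (m + 1)) * E (m + 1) * N"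
proof -
  have lim: "(\<lambda>J. cmod (L2_proj unit_lborel J g x - L2_proj unit_lborel m g x)) \<longlonglongrightarrow>
      cmod (g x - L2_proj unit_lborel m g x)"
    by (intro tendsto_intros L2_proj_legendre_converges assms)
  define A where "A = 2 / (1 - q) * N * E (m + 1)"
  have A: "A \<ge> 0" using q E_nonneg N_nonneg by (simp add: A_def)
  have bound: "cmod (L2_proj unit_lborel J g x - L2_proj unit_lborel m g x) \<le> 4 / (1 - q) ^ 3 * sqrt (real (m + 1)) * E (m + 1) * N"
    if "m \<le> J" for J
  proof -
    define d where "d = J - m"
    have d: "J = m + d" using that by (simp add: d_def)
    have diff: "L2_proj unit_lborel (m + d) g x - L2_proj unit_lborel m g x =
        (\<Sum>k<d. unit.coef g (Suc (m + k)) * of_real (poly (legendre (Suc (m + k))) x))" for d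
    proof (induction d)
      case (Suc d)
      have "L2_proj unit_lborel (m + Suc d) g x - L2_proj unit_lborel m g x =
          (L2_proj unit_lborel (m + d) g x - L2_proj unit_lborel m g x) +
          unit.coef g (Suc (m + d)) * of_real (poly (legendre (Suc (m + d))) x)"
        by (simp only: L2_proj_unit_eq add_Suc_right sum.atMost_Suc add_diff_eq diff_add_eq)
      then show ?case unfolding Suc sum.lessThan_Suc .
    qed simp
    have "cmod (L2_proj unit_lborel J g x - L2_proj unit_lborel m g x) \<le>
        (\<Sum>k<d. cmod (unit.coef g (Suc (m + k)) * of_real (poly (legendre (Suc (m + k))) x)))"
      unfolding d diff by (rule norm_sum)
    also have "\<dots> \<le> (\<Sum>k<d. 2 * sqrt (real (m + 1)) * A * (real (Suc k) * q ^ k))"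
    proof (rule sum_mono)
      fix k
      have "cmod (unit.coef g (Suc (m + k))) \<le> sqrt (2 * real (Suc (m + k)) + 1) * (2 / (1 - q) * E (Suc (m + k)) * N)"
        by (rule legendre_coef_le[OF le_SucI[OF trans_le_add1[OF assms(1)]]])
      also have "\<dots> \<le> (2 * sqrt (real (m + 1)) * real (Suc k)) * (q ^ k * A)"
      proof (rule mult_mono)
        \<comment> \<open>Separates \<open>m\<close> from \<open>k\<close>. Squaring the factor in
          \<open>k\<close> makes its root \<open>Suc k\<close>, the weight in the derivative of the
          geometric series.\<close>
        have "2 * real (Suc (m + k)) + 1 \<le> 4 * (real (m + 1) * real (Suc k))" by (simp add: algebra_simps)
        also have "real (m + 1) * real (Suc k) \<le> real (m + 1) * (real (Suc k))\<^sup>2"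
          by (intro mult_left_mono) (auto simp: power2_eq_square)
        also have "4 * (real (m + 1) * (real (Suc k))\<^sup>2) = 2\<^sup>2 * real (m + 1) * (real (Suc k))\<^sup>2" by simp
        finally have "sqrt (2 * real (Suc (m + k)) + 1) \<le> sqrt (2\<^sup>2 * real (m + 1) * (real (Suc k))\<^sup>2)"
          by simp
        also have "\<dots> = 2 * sqrt (real (m + 1)) * real (Suc k)"
          unfolding real_sqrt_mult real_sqrt_abs by (simp add: mult.assoc)
        finally show "sqrt (2 * real (Suc (m + k)) + 1) \<le> 2 * sqrt (real (m + 1)) * real (Suc k)" .
        have "2 / (1 - q) * N * E (m + 1 + k) \<le> 2 / (1 - q) * N * (q ^ k * E (m + 1))"
          using q N_nonneg E_le[of "m + 1" k] assms(1) by (intro mult_left_mono) auto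
        then show "2 / (1 - q) * E (Suc (m + k)) * N \<le> q ^ k * A"
          by (simp add: A_def mult_ac)
      qed (use q E_nonneg N_nonneg in auto)
      finally have "cmod (unit.coef g (Suc (m + k))) \<le> 2 * sqrt (real (m + 1)) * A * (real (Suc k) * q ^ k)"
        by (simp add: mult_ac)
      moreover have "cmod (unit.coef g (Suc (m + k)) * of_real (poly (legendre (Suc (m + k))) x)) \<le>
          cmod (unit.coef g (Suc (m + k))) * 1"
        unfolding norm_mult norm_of_real using assms(2) by (intro mult_left_mono abs_poly_legendre_le_1) auto
      ultimately show "cmod (unit.coef g (Suc (m + k)) * of_real (poly (legendre (Suc (m + k))) x)) \<le>
          2 * sqrt (real (m + 1)) * A * (real (Suc k) * q ^ k)" by linarith
    qed
    also have "\<dots> = 2 * sqrt (real (m + 1)) * A * (\<Sum>k<d. real (Suc k) * q ^ k)" by (simp add: sum_distrib_left)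
    also have "\<dots> \<le> 2 * sqrt (real (m + 1)) * A * (1 / (1 - q)\<^sup>2)"
      using q A by (intro mult_left_mono sum_Suc_power_le) auto
    also have "\<dots> = 4 / (1 - q) ^ 3 * sqrt (real (m + 1)) * E (m + 1) * N"
      by (simp add: A_def power3_eq_cube power2_eq_square mult_ac)
    finally show ?thesis .
  qed
  show ?thesis by (rule LIMSEQ_le_const2[OF lim]) (intro exI[of _ m] allI impI bound)
qed

text \<open>The left side is the modulus of the coefficient of \<open>g\<close> with respect to
  \<open>U j\<close>. The difference of the two cosines is \<open>2 sin ((j + 1) t) sin t\<close>;
  its factor \<open>sin t\<close> cancels the Chebyshev weight and leaves the unweighted
  \<open>L1\<close> norm.\<close>

lemma second_kind_coeff_le:
  "cmod ((a j - a (j + 2)) / 2) \<le> 2 / pi * (\<integral>x. cmod (g x) \<partial>unit_lborel)"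
proof -
  let ?T = "\<lambda>j x. complex_of_real (poly (cheb_T j) x)"
  have int: "integrable cheb_measure (\<lambda>x. g x * ?T j x)" for j
    using cheb.integrable_mult_poly[OF cont bdd, of "map_poly of_real (cheb_T j)"]
    by (simp add: poly_map_poly_of_real)
  have a: "a j = 2 / of_real pi * (\<integral>x. g x * ?T j x \<partial>cheb_measure)" for j
  proof -
    have "cheb.coef g j = half0 a j" by (rule cheb_coef_expansion[OF cont bdd expansion])
    then show ?thesis by (cases "j = 0") (auto simp: cheb.coef_def half0_def field_simps simp del: cheb_T.simps)
  qed
  have meas: "g \<in> borel_measurable unit_lborel"
    by (intro borel_measurable_unit sets_unit_lborel cont)
  have meas2: "(\<lambda>x. 2 * (cmod (g x) * sqrt (1 - x\<^sup>2))) \<in> borel_measurable unit_lborel"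
    by (intro borel_measurable_unit sets_unit_lborel continuous_intros cont)
  have "cmod ((\<integral>x. g x * ?T j x \<partial>cheb_measure) - (\<integral>x. g x * ?T (j + 2) x \<partial>cheb_measure)) \<le>
      (\<integral>x. 2 * (cmod (g x) * sqrt (1 - x\<^sup>2)) \<partial>cheb_measure)"
  proof (rule cheb.integral_norm_diff_le[OF int int])
    fix x :: real assume x: "x \<in> {-1<..<1}"
    define t where "t = arccos x"
    have x2: "x\<^sup>2 < 1" using x by (auto simp: abs_square_less_1)
    have t12: "x = cos t" "sin t = sqrt (1 - x\<^sup>2)"
      using x by (auto simp: t_def sin_arccos)
    then have t: "x = cos t" "sin t = sqrt (1 - x\<^sup>2)" "sin t \<ge> 0"
      using x2 by simp_all
    have "real (j + 2) * t = real (j + 1) * t + t" "real j * t = real (j + 1) * t - t"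
      by (simp_all add: algebra_simps)
    then have "poly (cheb_T j) x - poly (cheb_T (j + 2)) x = 2 * (sin (real (j + 1) * t) * sin t)"
      unfolding t(1) poly_cheb_T_cos by (simp only: cos_add cos_diff)
    moreover have "\<bar>2 * (sin (real (j + 1) * t) * sin t)\<bar> \<le> 2 * (1 * sin t)"
      unfolding abs_mult using t(3) by (intro mult_mono) auto
    ultimately have "\<bar>poly (cheb_T j) x - poly (cheb_T (j + 2)) x\<bar> \<le> 2 * (1 * sin t)"
      by (simp only:)
    then have "\<bar>poly (cheb_T j) x - poly (cheb_T (j + 2)) x\<bar> * cmod (g x) \<le> 2 * sqrt (1 - x\<^sup>2) * cmod (g x)"
      unfolding t(2) by (intro mult_right_mono) auto
    moreover have "cmod (g x * ?T j x - g x * ?T (j + 2) x) = \<bar>poly (cheb_T j) x - poly (cheb_T (j + 2)) x\<bar> * cmod (g x)"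
      unfolding right_diff_distrib[symmetric] of_real_diff[symmetric] norm_mult norm_of_real by (rule mult.commute)
    ultimately show "cmod (g x * ?T j x - g x * ?T (j + 2) x) \<le> 2 * (cmod (g x) * sqrt (1 - x\<^sup>2))"
      by (simp add: mult_ac)
  next
    show "integrable cheb_measure (\<lambda>x. 2 * (cmod (g x) * sqrt (1 - x\<^sup>2)))"
    proof (rule cheb.integrable_bounded)
      show "continuous_on {-1<..<1} (\<lambda>x. 2 * (cmod (g x) * sqrt (1 - x\<^sup>2)))"
        by (intro continuous_intros cont)
      fix x :: real assume x: "x \<in> {-1<..<1}"
      have "x\<^sup>2 < 1" using x by (auto simp: abs_square_less_1)
      then have "0 \<le> sqrt (1 - x\<^sup>2)" "sqrt (1 - x\<^sup>2) \<le> 1" by simp_all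
      then have "cmod (g x) * sqrt (1 - x\<^sup>2) \<le> C * 1"
        using bdd[OF x] by (intro mult_mono) (auto intro: order_trans[OF norm_ge_zero])
      then show "norm (2 * (cmod (g x) * sqrt (1 - x\<^sup>2))) \<le> 2 * C"
        using \<open>0 \<le> sqrt (1 - x\<^sup>2)\<close> by simp
    qed
  qed
  also have "\<dots> = (\<integral>x. 2 * cmod (g x) \<partial>unit_lborel)"
    unfolding integral_cheb_measure[OF meas2]
  proof (rule Bochner_Integration.integral_cong)
    fix x assume "x \<in> space unit_lborel"
    then have "x\<^sup>2 < 1" by (auto simp: space_unit_lborel abs_square_less_1)
    then show "(1 / sqrt (1 - x\<^sup>2)) *\<^sub>R (2 * (cmod (g x) * sqrt (1 - x\<^sup>2))) = 2 * cmod (g x)" by simp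
  qed simp
  finally have *: "cmod ((\<integral>x. g x * ?T j x \<partial>cheb_measure) - (\<integral>x. g x * ?T (j + 2) x \<partial>cheb_measure)) \<le>
      2 * (\<integral>x. cmod (g x) \<partial>unit_lborel)" by simp
  have eq: "(a j - a (j + 2)) / 2 = ((\<integral>x. g x * ?T j x \<partial>cheb_measure) - (\<integral>x. g x * ?T (j + 2) x \<partial>cheb_measure)) / of_real pi"
    unfolding a[of j] a[of "j + 2"] by (simp add: diff_divide_distrib)
  show ?thesis
    unfolding eq norm_divide using divide_right_mono[OF *, of pi] by (simp del: cheb_T.simps)
qed

text \<open>The last summand compensates for \<open>a (J + 1)\<close> and \<open>a (J + 2)\<close>,
  which occur in the second-kind sum up to \<open>J\<close> but not in the Chebyshev sum. Their
  indices lie beyond \<open>J\<close>, where the coefficients are small.\<close>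

lemma cheb_sum_le_L1:
  assumes "x \<in> {-1<..<1}"
  shows "cmod (cheb_sum a J x) \<le> real ((J + 1) * (J + 2)) / pi * (\<integral>x. cmod (g x) \<partial>unit_lborel)
    + real (J + 1) * ((cmod (a (J + 1)) + cmod (a (J + 2))) / 2)"
proof -
  let ?L = "\<integral>x. cmod (g x) \<partial>unit_lborel"
  define t where "t = arccos x"
  have x2: "x\<^sup>2 < 1" using assms by (auto simp: abs_square_less_1)
  have t: "x = cos t" "sin t = sqrt (1 - x\<^sup>2)"
    using assms by (auto simp: t_def sin_arccos)
  have st: "sin t > 0" unfolding t(2) using x2 by simp
  note sin_le = abs_sin_of_nat_mult_le[OF less_imp_le[OF st]]
  have "sin t * cmod (cheb_sum a J x) = cmod (of_real (sin t) * cheb_sum a J x)"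
    using st by (simp add: norm_mult)
  also have "\<dots> \<le> (\<Sum>j\<le>J. 2 / pi * ?L * (real (j + 1) * sin t))
      + (cmod (a (J + 1)) * (real (J + 1) * sin t) + cmod (a (J + 2)) * (real (J + 1) * sin t)) / 2"
  proof -
    have "cmod (\<Sum>j\<le>J. (a j - a (j + 2)) / 2 * of_real (sin (real (j + 1) * t))) \<le> (\<Sum>j\<le>J. 2 / pi * ?L * (real (j + 1) * sin t))"
    proof (rule sum_norm_le)
      show "cmod ((a j - a (j + 2)) / 2 * of_real (sin (real (j + 1) * t))) \<le> 2 / pi * ?L * (real (j + 1) * sin t)" for j
        unfolding norm_mult norm_of_real
        by (intro mult_mono second_kind_coeff_le sin_le) auto
    qed
    moreover have "cmod ((a (J + 1) * of_real (sin (real J * t)) + a (J + 2) * of_real (sin (real (J + 1) * t))) / 2) \<le>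
        (cmod (a (J + 1)) * (real (J + 1) * sin t) + cmod (a (J + 2)) * (real (J + 1) * sin t)) / 2"
    proof -
      have "\<bar>sin (real J * t)\<bar> \<le> real (J + 1) * sin t"
        using sin_le[of J] st by (simp add: distrib_right)
      then have "cmod (a (J + 1) * of_real (sin (real J * t)) + a (J + 2) * of_real (sin (real (J + 1) * t))) \<le>
          cmod (a (J + 1)) * (real (J + 1) * sin t) + cmod (a (J + 2)) * (real (J + 1) * sin t)"
        by (intro norm_triangle_le add_mono) (simp_all only: norm_mult norm_of_real mult_left_mono norm_ge_zero sin_le)
      then show ?thesis by (simp add: norm_divide)
    qed
    ultimately show ?thesis
      unfolding t(1) cheb_sum_sin by (intro norm_triangle_le add_mono)
  qed
  also have "(\<Sum>j\<le>J. 2 / pi * ?L * (real (j + 1) * sin t)) = sin t * (real ((J + 1) * (J + 2)) / pi * ?L)"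
  proof -
    have "2 * (\<Sum>j\<le>J. real (j + 1)) = real ((J + 1) * (J + 2))"
      by (induction J) (auto simp: algebra_simps)
    moreover have "(\<Sum>j\<le>J. 2 / pi * ?L * (real (j + 1) * sin t)) = 1 / pi * ?L * sin t * (2 * (\<Sum>j\<le>J. real (j + 1)))"
      unfolding sum_distrib_left by (intro sum.cong) auto
    ultimately show ?thesis by (simp only:) simp
  qed
  also have "sin t * (real ((J + 1) * (J + 2)) / pi * ?L)
      + (cmod (a (J + 1)) * (real (J + 1) * sin t) + cmod (a (J + 2)) * (real (J + 1) * sin t)) / 2 =
      sin t * (real ((J + 1) * (J + 2)) / pi * ?L + real (J + 1) * ((cmod (a (J + 1)) + cmod (a (J + 2))) / 2))"
    by (simp add: algebra_simps add_divide_distrib)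
  finally show ?thesis using st by (rule mult_left_le_imp_le)
qed

text \<open>Since \<open>1 / pi < 1 / 2\<close>, there is room to take \<open>J\<close> larger than \<open>m\<close> by a fixed factor; the geometric
  decay of the coefficients between \<open>m\<close> and \<open>J\<close> then absorbs the factor \<open>J + 1\<close> in the remainder.\<close>

lemma sup_le_L1:
  assumes "m0 \<le> m" "4 \<le> m" "x \<in> {-1<..<1}"
  shows "cmod (g x) \<le> 20 / (1 - q)\<^sup>2 * E m * N + (real (m + 1))\<^sup>2 / 2 * (\<integral>x. cmod (g x) \<partial>unit_lborel)"
proof -
  let ?L = "\<integral>x. cmod (g x) \<partial>unit_lborel"
  have L: "?L \<ge> 0" by simp
  \<comment> \<open>The ratio \<open>6 / 5\<close> is admissible because
    \<open>(6 / 5)^2 / 3 = 12 / 25 < 1 / 2\<close> and \<open>pi > 3\<close>. Subtracting 2 makes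
    \<open>J + 2\<close> the quotient, and \<open>4 \<le> m\<close> ensures
    \<open>m \<le> J\<close>.\<close>
  define J where "J = 6 * (m + 1) div 5 - 2"
  define k where "k = J - m"
  have J: "J = m + k" "5 * (J + 2) \<le> 6 * (m + 1)" "J + 1 \<le> 9 * Suc k"
  proof -
    define d where "d = 6 * (m + 1) div 5"
    have d: "5 * d \<le> 6 * (m + 1)" "6 * (m + 1) < 5 * d + 5" by (simp_all add: d_def)
    have "m + 2 \<le> d" using d(2) assms(2) by presburger
    then have J: "J + 2 = d" "m + k + 2 = d" by (simp_all add: k_def J_def d_def)
    show "J = m + k" using J by simp
    show "5 * (J + 2) \<le> 6 * (m + 1)" unfolding J(1) by (rule d(1))
    \<comment> \<open>The rounding in the quotient gives \<open>m < 5 * k + 9\<close>, hence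
      \<open>J + 1 = m + k + 1 \<le> 6 * k + 9\<close>.\<close>
    show "J + 1 \<le> 9 * Suc k"
    proof -
      have "6 * (m + 1) < 5 * (m + k + 2) + 5" using d(2) unfolding J(2)[symmetric] .
      then have "m < 5 * k + 9" by simp
      moreover have "J = m + k" using J by simp
      ultimately show ?thesis by simp
    qed
  qed
  have JJ: "real ((J + 1) * (J + 2)) / pi \<le> (real (m + 1))\<^sup>2 / 2"
  proof -
    have "real (5 * (J + 2)) \<le> real (6 * (m + 1))" using J(2) by (simp only: of_nat_le_iff)
    then have J2: "real (J + 2) \<le> 6 / 5 * real (m + 1)" by simp
    have "real ((J + 1) * (J + 2)) \<le> (real (J + 2))\<^sup>2"
      unfolding of_nat_mult power2_eq_square by (intro mult_right_mono) auto
    also have "\<dots> \<le> (6 / 5 * real (m + 1))\<^sup>2" using J2 by (intro power_mono) auto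
    also have "\<dots> = 36 / 25 * (real (m + 1))\<^sup>2"
      unfolding power_mult_distrib by (simp add: power_divide)
    finally have "real ((J + 1) * (J + 2)) / pi \<le> 36 / 25 * (real (m + 1))\<^sup>2 / 3"
      using pi_gt3 by (intro frac_le) auto
    then show ?thesis using zero_le_power2[of "real (m + 1)"] by linarith
  qed
  have qk: "real (Suc k) * q ^ k \<le> 1 / (1 - q)\<^sup>2"
    using sum_Suc_power_le[of q "{k}"] q by simp
  have Ek: "E (J + i) \<le> q ^ k * E m" for i
  proof -
    have "q ^ (k + i) \<le> q ^ k" using q by (intro power_decreasing) auto
    then have "q ^ (k + i) * E m \<le> q ^ k * E m" using E_nonneg by (rule mult_right_mono)
    moreover have "E (J + i) \<le> q ^ (k + i) * E m"
      using E_le[OF assms(1), of "k + i"] unfolding J(1) add.assoc .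
    ultimately show ?thesis by (rule order_trans[rotated])
  qed
  have ak: "cmod (a (J + i)) \<le> 2 * (q ^ k * E m) * N" for i
  proof -
    have "cmod (a (J + i)) \<le> 2 * E (J + i) * N" using a_le[of "J + i"] J(1) assms(1) by simp
    also have "\<dots> \<le> 2 * (q ^ k * E m) * N"
      using Ek[of i] N_nonneg by (intro mult_right_mono mult_left_mono) auto
    finally show ?thesis .
  qed
  have "real (J + 1) * ((cmod (a (J + 1)) + cmod (a (J + 2))) / 2) \<le> (9 * real (Suc k)) * (2 * (q ^ k * E m) * N)"
  proof (rule mult_mono)
    show "real (J + 1) \<le> 9 * real (Suc k)" using J(3) by linarith
    show "(cmod (a (J + 1)) + cmod (a (J + 2))) / 2 \<le> 2 * (q ^ k * E m) * N"
      using ak[of 1] ak[of 2] by simp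
  qed auto
  also have "\<dots> = 18 * (real (Suc k) * q ^ k) * (E m * N)" by (simp add: mult_ac)
  also have "\<dots> \<le> 18 * (1 / (1 - q)\<^sup>2) * (E m * N)"
    using qk E_nonneg N_nonneg by (intro mult_right_mono mult_left_mono) auto
  finally have 1: "real (J + 1) * ((cmod (a (J + 1)) + cmod (a (J + 2))) / 2) \<le> 18 / (1 - q)\<^sup>2 * (E m * N)" by simp
  have "cmod (g x - cheb_sum a J x) \<le> 2 / (1 - q) * E (Suc J) * N"
    using assms J(1) by (intro cheb_sum_error) auto
  also have "\<dots> \<le> 2 / (1 - q)\<^sup>2 * E m * N"
  proof (intro mult_right_mono mult_mono N_nonneg)
    have "(1 - q) * (1 - q) \<le> 1 * (1 - q)" using q by (intro mult_right_mono) auto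
    then show "2 / (1 - q) \<le> 2 / (1 - q)\<^sup>2"
      using q unfolding power2_eq_square by (intro divide_left_mono mult_pos_pos) auto
    have "q ^ k * E m \<le> 1 * E m" using q E_nonneg by (intro mult_right_mono power_le_one) auto
    then show "E (Suc J) \<le> E m" using Ek[of 1] by simp
  qed (use q E_nonneg in auto)
  finally have 2: "cmod (g x - cheb_sum a J x) \<le> 2 / (1 - q)\<^sup>2 * (E m * N)" by simp
  have "cmod (g x) \<le> cmod (cheb_sum a J x) + cmod (g x - cheb_sum a J x)"
    using norm_triangle_ineq[of "cheb_sum a J x" "g x - cheb_sum a J x"] by simp
  also have "\<dots> \<le> real ((J + 1) * (J + 2)) / pi * ?L + 18 / (1 - q)\<^sup>2 * (E m * N) + 2 / (1 - q)\<^sup>2 * (E m * N)"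
    using cheb_sum_le_L1[OF assms(3), of J] 1 2 by linarith
  also have "\<dots> \<le> (real (m + 1))\<^sup>2 / 2 * ?L + 18 / (1 - q)\<^sup>2 * (E m * N) + 2 / (1 - q)\<^sup>2 * (E m * N)"
    using mult_right_mono[OF JJ L] by linarith
  also have "\<dots> = 20 / (1 - q)\<^sup>2 * E m * N + (real (m + 1))\<^sup>2 / 2 * ?L"
  proof -
    have "18 / d * u + 2 / d * u = 20 / d * u" for d u :: real
      by (cases "d = 0") (simp_all add: field_simps)
    from this[of "(1 - q)\<^sup>2" "E m * N"]
    have X: "18 / (1 - q)\<^sup>2 * (E m * N) + 2 / (1 - q)\<^sup>2 * (E m * N) = 20 / (1 - q)\<^sup>2 * E m * N"
      by (simp only: mult.assoc)
    show ?thesis unfolding add.assoc X by (rule add.commute)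
  qed
  finally show ?thesis .
qed

end

section \<open>The conjugate weight\<close>

context weight
begin

lemma lam_star_ge:
  assumes "0 \<le> t" "ereal t < B_lam lam" "0 \<le> s"
  shows "ereal (t * s - lamr t) \<le> lam_star lam s"
proof -
  have "ereal (t * s - lamr t) = ereal (t * s) - lam t"
    using lam_eq_lamr[OF assms(1,2)] by simp
  also have "\<dots> \<le> (SUP r\<in>{0..}. ereal (r * s) - lam r)"
    by (rule SUP_upper) (use assms in simp)
  finally show ?thesis using assms(3) by (simp add: lam_star_def)
qed

lemma zero_less_B: "ereal 0 < B_lam lam"
  using B_pos by (simp only: zero_ereal_def)

lemma lam_star_ge_0: "0 \<le> s \<Longrightarrow> ereal (- lamr 0) \<le> lam_star lam s"
  using lam_star_ge[of 0 s] zero_less_B by simp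

text \<open>The supremum in \<open>lam_star\<close> also contains the radius 0, supplied by
  \<open>L0\<close>, and the radius \<open>B_lam lam\<close> if the weight is finite there. The
  latter is reached from the left: \<open>lam t\<close> is replaced by the larger
  \<open>lam r\<close>, after which the expression is continuous in \<open>t\<close>. Radii of
  infinite weight contribute \<open>- \<infinity>\<close>.\<close>

lemma lam_star_le:
  assumes s: "0 \<le> s" and L: "\<And>t. 0 < t \<Longrightarrow> ereal t < B_lam lam \<Longrightarrow> t * s - lamr t \<le> L"
    and L0: "- lamr 0 \<le> L"
  shows "lam_star lam s \<le> ereal L"
proof -
  have "ereal (r * s) - lam r \<le> ereal L" if r: "0 \<le> r" for r
  proof (cases "lam r")
    case (real l)
    then have "ereal r \<le> B_lam lam"
      unfolding B_lam_def by (intro SUP_upper) (use r in simp)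
    then consider "r = 0" | "0 < r" "ereal r < B_lam lam" | "0 < r" "ereal r = B_lam lam"
      using r by (cases "r = 0"; cases "ereal r = B_lam lam") (simp_all add: less_le)
    then show ?thesis
    proof cases
      case 1
      then show ?thesis using L0 lam_eq_lamr[of 0] zero_less_B by simp
    next
      case 2
      then show ?thesis using L[of r] lam_eq_lamr[of r] by simp
    next
      case 3
      have "eventually (\<lambda>t. t \<in> {0<..<r}) (at_left r)"
        by (rule eventually_at_leftI[of 0]) (use 3 in auto)
      then have "eventually (\<lambda>t. t * s - l \<le> L) (at_left r)"
      proof eventually_elim
        case (elim t)
        then have t: "0 < t" "ereal t < B_lam lam" using 3(2)[symmetric] by auto
        have "lam t \<le> lam r" using elim by (intro mono_onD[OF lam_mono]) auto
        then have "lamr t \<le> l" using lam_eq_lamr[of t] t real by simp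
        then show ?case using L[OF t] by linarith
      qed
      moreover have "((\<lambda>t. t * s - l) \<longlongrightarrow> r * s - l) (at_left r)"
        by (intro tendsto_intros)
      ultimately have "r * s - l \<le> L"
        by (intro tendsto_upperbound) auto
      then show ?thesis using real by simp
    qed
  qed (use lam_not_MInf[OF r] in auto)
  then show ?thesis using s by (auto simp: lam_star_def intro!: SUP_least)
qed

text \<open>Turns bounds over positive radii into a bound by the conjugate. If \<open>lam\<close> is
  right-continuous at 0, the radius 0 is a limit of positive ones; in the other case the supremum
  exceeds its value at 0, so positive radii account for it.\<close>

lemma exp_minus_lam_star_ge:
  assumes s: "0 \<le> s" and L: "\<And>t. 0 < t \<Longrightarrow> ereal t < B_lam lam \<Longrightarrow> t * s - lamr t \<le> L"
    and cond: "(lam \<longlongrightarrow> lam 0) (at_right 0) \<or> - lam 0 < lam_star lam s"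
  shows "exp (- L) \<le> exp_minus (lam_star lam s)"
proof -
  have lam0: "lam 0 = ereal (lamr 0)" using lam_eq_lamr[of 0] zero_less_B by simp
  have le: "lam_star lam s \<le> ereal L"
    using cond
  proof
    assume "(lam \<longlongrightarrow> lam 0) (at_right 0)"
    then have "((\<lambda>t. real_of_ereal (lam t)) \<longlongrightarrow> lamr 0) (at_right 0)"
      unfolding lam0 by (rule lim_real_of_ereal)
    moreover have "(\<lambda>t. real_of_ereal (lam t)) = lamr" by (simp add: fun_eq_iff lamr_def)
    ultimately have "(lamr \<longlongrightarrow> lamr 0) (at_right 0)" by (simp only:)
    then have lim: "((\<lambda>t. t * s - lamr t) \<longlongrightarrow> 0 * s - lamr 0) (at_right 0)"
      by (intro tendsto_intros)
    obtain t0 where t0: "0 < t0" "ereal t0 < B_lam lam" by (rule obtain_radius)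
    have "eventually (\<lambda>t. t \<in> {0<..<t0}) (at_right 0)"
      by (rule eventually_at_rightI[of _ t0]) (use t0 in auto)
    then have "eventually (\<lambda>t. t * s - lamr t \<le> L) (at_right 0)"
    proof eventually_elim
      case (elim t)
      then have "ereal t < B_lam lam" by (intro less_trans[OF _ t0(2)]) simp
      then show ?case using elim by (intro L) auto
    qed
    from tendsto_upperbound[OF lim this] have L0: "- lamr 0 \<le> L" by simp
    show ?thesis by (rule lam_star_le[OF s L L0])
  next
    assume *: "- lam 0 < lam_star lam s"
    have "lam_star lam s \<le> ereal (max L (- lamr 0))"
      by (intro lam_star_le s) (use L in \<open>auto simp: le_max_iff_disj\<close>)
    then show ?thesis using * by (cases "- lamr 0 \<le> L") (auto simp: lam0 max_def)
  qed
  moreover have "ereal (- lamr 0) \<le> lam_star lam s" by (rule lam_star_ge_0[OF s])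
  ultimately show ?thesis
    by (cases "lam_star lam s") (auto simp: exp_minus_def)
qed

text \<open>Below \<open>r\<^sub>0 / 2\<close> the supremum defining \<open>lam_star lam m\<close> is dominated by the value at \<open>r\<^sub>0\<close> once \<open>m\<close> is
  large, and above \<open>r\<^sub>0 / 2\<close> each of the affine functions has slope at least \<open>r\<^sub>0 / 2\<close>.\<close>

lemma lam_star_growth:
  obtains q m0 where "0 < q" "q < 1"
    and "\<forall>m\<ge>m0. \<forall>k.
      exp_minus (lam_star lam (real (m + k))) \<le> q ^ k * exp_minus (lam_star lam (real m))"
    and "\<forall>m\<ge>m0. - lam 0 < lam_star lam (real m)"
proof -
  obtain r0 where r0: "0 < r0" "ereal r0 < B_lam lam" by (rule obtain_radius)
  have lam0: "lam 0 = ereal (lamr 0)" using lam_eq_lamr[of 0] zero_less_B by simp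
  \<comment> \<open>Half of \<open>r0 * m\<close> then pays for the difference of the weights at
    \<open>r0\<close> and 0; the other half dominates \<open>r * m\<close> for the radii below
    \<open>r0 / 2\<close>.\<close>
  obtain m0 :: nat where m0: "lamr r0 - lamr 0 < real m0 * (r0 / 2)"
    using reals_Archimedean3[of "r0 / 2"] r0(1) by (meson half_gt_zero)
  have lamr0_le: "lamr 0 \<le> lamr r0"
    using mono_onD[OF lam_mono, of 0 r0] r0 lam_eq_lamr[of r0] lam0 by simp
  have big: "lamr r0 - lamr 0 < real m * (r0 / 2)" if "m \<ge> m0" for m
  proof -
    have "real m0 * (r0 / 2) \<le> real m * (r0 / 2)" using that r0 by (intro mult_right_mono) auto
    then show ?thesis using m0 by linarith
  qed
  have growth: "lam_star lam (real m) + ereal (real k * (r0 / 2)) \<le> lam_star lam (real (m + k))"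
    if m: "m \<ge> m0" for m k
  proof -
    let ?c = "real k * (r0 / 2)"
    have "ereal (r * real m) - lam r \<le> lam_star lam (real (m + k)) - ereal ?c" if r: "0 \<le> r" for r
    proof (cases "lam r")
      case (real l)
      have "ereal (r * real m - l + ?c) \<le> lam_star lam (real (m + k))"
      proof (cases "r0 / 2 \<le> r")
        case True
        have "?c \<le> real k * r" using True by (intro mult_left_mono) auto
        then have "ereal (r * real m - l + ?c) \<le> ereal (r * real (m + k)) - lam r"
          using real by (simp add: algebra_simps)
        also have "\<dots> \<le> (SUP r\<in>{0..}. ereal (r * real (m + k)) - lam r)"
          by (rule SUP_upper) (use r in simp)
        finally show ?thesis by (simp add: lam_star_def)
      next
        case False
        have "lamr 0 \<le> l" using mono_onD[OF lam_mono, of 0 r] r lam0 real by simp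
        moreover have "r * real m \<le> r0 / 2 * real m" using False by (intro mult_right_mono) auto
        moreover have "real k * (r0 / 2) \<le> real k * r0" using r0 by (intro mult_left_mono) auto
        ultimately have "r * real m - l + ?c \<le> r0 * real (m + k) - lamr r0"
          using big[OF m] by (simp add: algebra_simps)
        also have "ereal \<dots> \<le> lam_star lam (real (m + k))"
          using r0 by (intro lam_star_ge) auto
        finally show ?thesis by simp
      qed
      then show ?thesis using real by (cases "lam_star lam (real (m + k))") auto
    qed (use lam_not_MInf[OF r] in auto)
    then have "lam_star lam (real m) \<le> lam_star lam (real (m + k)) - ereal ?c"
      by (auto simp: lam_star_def[of lam "real m"] intro!: SUP_least)
    then show ?thesis
      by (cases "lam_star lam (real m)"; cases "lam_star lam (real (m + k))") auto
  qed
  show ?thesis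
  proof (rule that[of "exp (- (r0 / 2))" m0])
    show "\<forall>m\<ge>m0. \<forall>k. exp_minus (lam_star lam (real (m + k))) \<le> exp (- (r0 / 2)) ^ k * exp_minus (lam_star lam (real m))"
    proof (intro allI impI)
      fix m k assume m: "m \<ge> m0"
      define c where "c = real k * (r0 / 2)"
      have c: "exp (- (r0 / 2)) ^ k = exp (- c)"
        by (simp add: c_def exp_of_nat_mult[symmetric])
      have "ereal (- lamr 0) \<le> lam_star lam (real m)" by (rule lam_star_ge_0) simp
      then show "exp_minus (lam_star lam (real (m + k))) \<le> exp (- (r0 / 2)) ^ k * exp_minus (lam_star lam (real m))"
        unfolding c using growth[OF m, of k, folded c_def]
        by (cases "lam_star lam (real m)"; cases "lam_star lam (real (m + k))")
          (auto simp: exp_minus_def simp flip: exp_add simp del: of_nat_add)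
    qed
    show "\<forall>m\<ge>m0. - lam 0 < lam_star lam (real m)"
    proof (intro allI impI)
      fix m assume m: "m \<ge> m0"
      have "- lamr 0 < r0 * real m - lamr r0" using big[OF m] lamr0_le r0
        by (simp add: algebra_simps)
      also have "ereal (r0 * real m - lamr r0) \<le> lam_star lam (real m)"
        using r0 by (intro lam_star_ge) auto
      finally show "- lam 0 < lam_star lam (real m)" by (simp add: lam0)
    qed
  qed (use r0 in auto)
qed

section \<open>Elements of the space as Chebyshev series\<close>

lemma A_space_continuous:
  assumes "g \<in> A_space lam"
  shows "continuous_on {-1<..<1} g"
proof -
  have h: "is_hol_ext lam g (hol_ext lam g)" by (rule is_hol_ext_A_space[OF assms])
  have "continuous_on {-1<..<1} (\<lambda>x. hol_ext lam g (of_real x))"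
  proof (rule continuous_on_compose2[where f = complex_of_real and g = "hol_ext lam g" and t = lam_domain])
    show "continuous_on lam_domain (hol_ext lam g)"
      using h by (intro holomorphic_on_imp_continuous_on) (simp add: is_hol_ext_def)
    show "continuous_on {-1<..<1} complex_of_real" by (intro continuous_intros)
    show "complex_of_real ` {-1<..<1} \<subseteq> lam_domain"
      using of_real_in_interior_ellipse[OF B_pos] by auto
  qed
  then show ?thesis
    by (rule continuous_on_eq) (use h in \<open>auto simp: is_hol_ext_def\<close>)
qed

text \<open>A single radius gives uniform convergence, whatever the weight does at 0; the
  coefficient bound combines all radii.\<close>

lemma A_space_cheb_expansion:
  assumes g: "g \<in> A_space lam"
  shows "cheb_expansion (joukowski_coeff (hol_ext lam g)) g"
    "(lam \<longlongrightarrow> lam 0) (at_right 0) \<or> - lam 0 < lam_star lam (real n) \<Longrightarrow>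
      cmod (joukowski_coeff (hol_ext lam g) n) \<le> 2 * exp_minus (lam_star lam (real n)) * A_norm lam g"
proof -
  define h where "h = hol_ext lam g"
  define a where "a = joukowski_coeff h"
  define N where "N = A_norm lam g"
  have h: "h holomorphic_on lam_domain" "\<And>x. x \<in> {-1<..<1} \<Longrightarrow> h (of_real x) = g x"
    using is_hol_ext_A_space[OF g] by (auto simp: is_hol_ext_def h_def)
  have bound: "cmod (h z) \<le> N * exp (lamr t)" if "0 < t" "ereal t < B_lam lam" "z \<in> ellipse (ereal t)" for t z
    using hol_ext_bound[OF g that] by (simp add: h_def N_def)
  have "cheb_expansion a g"
    unfolding cheb_expansion_iff uniform_limit_iff
  proof (intro allI impI)
    obtain t where t: "0 < t" "ereal t < B_lam lam" by (rule obtain_radius)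
    fix e :: real assume e: "e > 0"
    have "(\<lambda>K. 2 * (N * exp (lamr t)) / (exp t - 1) * exp (- t) ^ K) \<longlonglongrightarrow> 2 * (N * exp (lamr t)) / (exp t - 1) * 0"
      using t by (intro tendsto_intros LIMSEQ_power_zero) auto
    then have "eventually (\<lambda>K. 2 * (N * exp (lamr t)) / (exp t - 1) * exp (- t) ^ K < e) sequentially"
      using e by (intro order_tendstoD(2)) auto
    then show "eventually (\<lambda>K. \<forall>x\<in>{-1<..<1}. dist (cheb_sum a K x) (g x) < e) sequentially"
    proof eventually_elim
      case (elim K)
      show ?case
      proof
        fix x :: real assume x: "x \<in> {-1<..<1}"
        then have "\<bar>x\<bar> \<le> 1" by auto
        from cheb_expansion_error[OF h(1) open_interior t(1) ellipse_subset_interior[OF t] bound[OF t] this, of K]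
        have "cmod (g x - cheb_sum a K x) \<le> 2 * (N * exp (lamr t)) / (exp t - 1) * exp (- t) ^ K"
          unfolding h(2)[OF x] a_def cheb_sum_def .
        then show "dist (cheb_sum a K x) (g x) < e"
          using elim by (simp add: dist_norm norm_minus_commute)
      qed
    qed
  qed
  then show "cheb_expansion (joukowski_coeff (hol_ext lam g)) g" by (simp add: a_def h_def)
  assume cond: "(lam \<longlongrightarrow> lam 0) (at_right 0) \<or> - lam 0 < lam_star lam (real n)"
  have an: "cmod (a n) \<le> 2 * N * exp (- (t * real n - lamr t))" if t: "0 < t" "ereal t < B_lam lam" for t
  proof -
    have "cmod (a n) \<le> 2 * (N * exp (lamr t)) * exp (- (real n * t))"
      unfolding a_def
      by (rule cmod_joukowski_coeff_le[OF h(1) open_interior t(1) ellipse_subset_interior[OF t] bound[OF t]])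
    also have "\<dots> = 2 * N * (exp (lamr t) * exp (- (real n * t)))" by (simp only: mult.assoc)
    also have "exp (lamr t) * exp (- (real n * t)) = exp (- (t * real n - lamr t))"
      unfolding exp_add[symmetric] by (simp add: algebra_simps)
    finally show ?thesis .
  qed
  have N: "0 \<le> N" unfolding N_def by (rule A_norm_nonneg)
  have nonneg: "0 \<le> exp_minus (lam_star lam (real n))" by (simp add: exp_minus_def)
  have "cmod (a n) \<le> 2 * N * exp_minus (lam_star lam (real n))"
  proof (cases "a n = 0")
    case True
    then show ?thesis using N nonneg by simp
  next
    case False
    then have x: "cmod (a n) > 0" by simp
    obtain t0 where t0: "0 < t0" "ereal t0 < B_lam lam" by (rule obtain_radius)
    have N': "N > 0" using an[OF t0] x N by (cases "N = 0") auto
    \<comment> \<open>Rewrites the coefficient bounds as upper bounds \<open>L\<close> for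
      \<open>t * n - lamr t\<close>, the form in which the conjugate enters. A nonzero coefficient
      thereby forces the conjugate to be finite, in accordance with
      \<open>exp_minus \<infinity> = 0\<close>.\<close>
    define L where "L = - ln (cmod (a n) / (2 * N))"
    have "t * real n - lamr t \<le> L" if t: "0 < t" "ereal t < B_lam lam" for t
    proof -
      have "cmod (a n) / (2 * N) \<le> exp (- (t * real n - lamr t))"
        using an[OF t] N' by (simp add: field_simps)
      then have "ln (cmod (a n) / (2 * N)) \<le> - (t * real n - lamr t)"
        using x N' by (subst (asm) ln_le_cancel_iff[symmetric]) auto
      then show ?thesis by (simp add: L_def)
    qed
    then have "exp (- L) \<le> exp_minus (lam_star lam (real n))"
      using cond by (intro exp_minus_lam_star_ge) auto
    moreover have "exp (- L) = cmod (a n) / (2 * N)"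
      using x N' by (simp add: L_def)
    ultimately show ?thesis using N' by (simp add: field_simps)
  qed
  then show "cmod (joukowski_coeff (hol_ext lam g) n) \<le> 2 * exp_minus (lam_star lam (real n)) * A_norm lam g"
    by (simp add: a_def h_def N_def mult_ac)
qed

lemma A_space_bound_interval:
  assumes "g \<in> A_space lam"
  obtains C where "\<And>x. cmod (g x) \<le> C"
  by (rule obtain_radius, rule that, rule A_space_bounded[OF assms])

lemma A_space_cheb_coeff:
  assumes g: "g \<in> A_space lam"
  shows "cheb_coeff g = joukowski_coeff (hol_ext lam g)"
proof -
  obtain C where C: "\<And>x. cmod (g x) \<le> C" using A_space_bound_interval[OF g] by blast
  show ?thesis
    by (rule cheb_coeff_eq[OF A_space_continuous[OF g] C A_space_cheb_expansion(1)[OF g]])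
qed

lemma A_space_cheb_series:
  assumes g: "g \<in> A_space lam" and q: "0 < q" "q < 1"
    and growth: "\<forall>m\<ge>m0. \<forall>k.
      exp_minus (lam_star lam (real (m + k))) \<le> q ^ k * exp_minus (lam_star lam (real m))"
    and cond: "\<forall>m\<ge>m0. - lam 0 < lam_star lam (real m)"
  obtains C where "cheb_series g (cheb_coeff g) (\<lambda>n. exp_minus (lam_star lam (real n))) q (A_norm lam g) C m0"
proof -
  obtain C where C: "\<And>x. cmod (g x) \<le> C" using A_space_bound_interval[OF g] by blast
  show ?thesis
  proof (rule that, rule cheb_series.intro)
    show "cmod (cheb_coeff g n) \<le> 2 * exp_minus (lam_star lam (real n)) * A_norm lam g" if "m0 \<le> n" for n
      unfolding A_space_cheb_coeff[OF g] using cond that by (intro A_space_cheb_expansion(2)[OF g]) auto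
    show "cheb_expansion (cheb_coeff g) g"
      unfolding A_space_cheb_coeff[OF g] by (rule A_space_cheb_expansion(1)[OF g])
    show "0 \<le> exp_minus (lam_star lam (real n))" for n by (simp add: exp_minus_def)
    show "exp_minus (lam_star lam (real (m + k))) \<le> q ^ k * exp_minus (lam_star lam (real m))" if "m0 \<le> m" for m k
      using growth that by blast
  qed (rule A_space_continuous[OF g] C q A_norm_nonneg; assumption?)+
qed

end

lemma Linf_norm_le:
  assumes "continuous_on {-1<..<1} f" "\<And>x. x \<in> {-1<..<1} \<Longrightarrow> cmod (f x) \<le> C"
  shows "Linf_norm f \<le> ereal C"
  unfolding Linf_norm_def
proof (rule esssup_I)
  show "(\<lambda>x. ereal (cmod (f x))) \<in> borel_measurable unit_lborel"
    by (intro borel_measurable_ereal borel_measurable_unit sets_unit_lborel continuous_intros assms)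
  show "AE x in unit_lborel. ereal (cmod (f x)) \<le> ereal C"
    by (rule AE_I2) (use assms(2) in \<open>auto simp: space_unit_lborel\<close>)
qed

lemma continuous_on_L2_proj: "continuous_on S (L2_proj M m g)"
  unfolding L2_proj_def[abs_def] by (intro continuous_intros)

text \<open>The coefficient bound cannot do without its condition: if \<open>lam\<close> is 0 at 0,
  10 on \<open>(0,1]\<close> and infinite beyond, the function \<open>x\<close> has norm
  \<open>exp (-10) * cosh 1\<close> and coefficient 1 at \<open>n = 1\<close>, whereas
  \<open>lam_star lam 1 = 0\<close>. The second alternative of the condition holds for all large
  \<open>n\<close>, which is enough for the projections. The factor \<open>sqrt (m + 1)\<close> of
  the unweighted projection comes with the conjugate at \<open>m + 1\<close>, and \<open>c\<close>
  is common to all estimates.\<close>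

theorem theorem3p4:
  fixes lam :: "real \<Rightarrow> ereal"
  assumes "\<And>r. 0 \<le> r \<Longrightarrow> lam r \<noteq> -\<infinity>"
    and "mono_on {0..} lam"
    and "B_lam lam > 0"
  shows
    "banach_on (A_space lam) (A_norm lam) \<and>
     (\<forall>g\<in>A_space lam.
        cheb_expansion (cheb_coeff g) g \<and>
        (\<forall>n::nat. (lam \<longlongrightarrow> lam 0) (at_right 0) \<or> - lam 0 < lam_star lam (real n) \<longrightarrow>
           cmod (cheb_coeff g n) \<le> 2 * exp_minus (lam_star lam (real n)) * A_norm lam g)) \<and>
     (\<exists>c>0.
        (\<exists>m0::nat. \<forall>g\<in>A_space lam. \<forall>m\<ge>m0.
           Linf_norm (\<lambda>x. g x - L2_proj cheb_measure m g x)
             \<le> ereal (c * exp_minus (lam_star lam (real m)) * A_norm lam g) \<and>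
           Linf_norm (\<lambda>x. g x - L2_proj unit_lborel m g x)
             \<le> ereal (c * sqrt (real (m + 1)) * exp_minus (lam_star lam (real (m + 1)))
                        * A_norm lam g)) \<and>
        (\<exists>\<delta>0>0. \<forall>g\<in>A_space lam. \<forall>\<delta>::real. 0 < \<delta> \<and> \<delta> \<le> \<delta>0 \<longrightarrow>
           Linf_norm g
             \<le> ereal (c * exp_minus (lam_star lam (real_of_int (\<lfloor>sqrt (2 / \<delta>)\<rfloor> - 1)))
                        * A_norm lam g
                      + 1 / \<delta> * L1_norm g)))"
proof -
  interpret weight lam by unfold_locales (fact assms)+
  define E where "E n = exp_minus (lam_star lam (real n))" for n
  have E: "0 \<le> E n" for n by (simp add: E_def exp_minus_def)
  obtain q m0 where q: "0 < q" "q < 1"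
    and growth: "\<forall>m\<ge>m0. \<forall>k. exp_minus (lam_star lam (real (m + k))) \<le> q ^ k * exp_minus (lam_star lam (real m))"
    and cond: "\<forall>m\<ge>m0. - lam 0 < lam_star lam (real m)"
    by (rule lam_star_growth)
  \<comment> \<open>Dominates the constants \<open>2 / (1 - q)\<close>,
    \<open>4 / (1 - q) ^ 3\<close> and \<open>20 / (1 - q)^2\<close> of the three estimates, because
    \<open>0 < 1 - q < 1\<close>.\<close>
  define c where "c = 20 / (1 - q) ^ 3"
  have c: "c > 0" using q by (simp add: c_def)
  have pow: "(1 - q) ^ 3 \<le> 1 - q" "(1 - q) ^ 3 \<le> (1 - q)\<^sup>2"
    using q power_decreasing[of 1 3 "1 - q"] power_decreasing[of 2 3 "1 - q"] by simp_all
  have c_ge: "2 / (1 - q) \<le> c" "4 / (1 - q) ^ 3 \<le> c" "20 / (1 - q)\<^sup>2 \<le> c"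
    unfolding c_def using q pow by (auto intro!: frac_le)
  have series: "\<exists>C. cheb_series g (cheb_coeff g) E q (A_norm lam g) C m0" if g: "g \<in> A_space lam" for g
  proof -
    obtain C where "cheb_series g (cheb_coeff g) (\<lambda>n. exp_minus (lam_star lam (real n))) q (A_norm lam g) C m0"
      by (rule A_space_cheb_series[OF g q growth cond])
    then show ?thesis unfolding E_def[abs_def] by (rule exI)
  qed
  have proj_cont: "continuous_on {-1<..<1} (\<lambda>x. g x - L2_proj M m g x)" if "g \<in> A_space lam" for g M m
    by (intro continuous_intros continuous_on_L2_proj A_space_continuous that)
  have le_c: "u * v * A_norm lam g \<le> c * v * A_norm lam g" if "u \<le> c" "0 \<le> v" for u v g
    using that A_norm_nonneg by (intro mult_right_mono) auto
  have proj: "Linf_norm (\<lambda>x. g x - L2_proj cheb_measure m g x) \<le> ereal (c * E m * A_norm lam g)"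
    "Linf_norm (\<lambda>x. g x - L2_proj unit_lborel m g x) \<le> ereal (c * sqrt (real (m + 1)) * E (m + 1) * A_norm lam g)"
    if g: "g \<in> A_space lam" and m: "m \<ge> m0" for g m
  proof -
    obtain C where "cheb_series g (cheb_coeff g) E q (A_norm lam g) C m0" using series[OF g] by blast
    then interpret cheb_series g "cheb_coeff g" E q "A_norm lam g" C m0 .
    show "Linf_norm (\<lambda>x. g x - L2_proj cheb_measure m g x) \<le> ereal (c * E m * A_norm lam g)"
      by (rule Linf_norm_le[OF proj_cont[OF g]])
        (rule order_trans[OF L2_proj_cheb_error[OF m] le_c[OF c_ge(1) E]])
    have "4 / (1 - q) ^ 3 * (sqrt (real (m + 1)) * E (m + 1)) * A_norm lam g \<le> c * (sqrt (real (m + 1)) * E (m + 1)) * A_norm lam g"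
      by (rule le_c[OF c_ge(2)]) (use E in simp)
    then show "Linf_norm (\<lambda>x. g x - L2_proj unit_lborel m g x) \<le> ereal (c * sqrt (real (m + 1)) * E (m + 1) * A_norm lam g)"
      unfolding mult.assoc[symmetric]
      by (intro Linf_norm_le[OF proj_cont[OF g]] order_trans[OF L2_proj_legendre_error[OF m]])
  qed
  define m1 where "m1 = max m0 4"
  \<comment> \<open>Makes the floor of \<open>sqrt (2 / \<delta>)\<close> at least
    \<open>m1 + 1\<close> for \<open>\<delta> \<le> \<delta>0\<close>; the 4 in \<open>m1\<close>
    leaves room for the longer truncation in \<open>sup_le_L1\<close>.\<close>
  define \<delta>0 where "\<delta>0 = 2 / (real (m1 + 1))\<^sup>2"
  have \<delta>0: "\<delta>0 > 0" by (simp add: \<delta>0_def)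
  have interp: "Linf_norm g \<le> ereal (c * exp_minus (lam_star lam (real_of_int (\<lfloor>sqrt (2 / \<delta>)\<rfloor> - 1))) * A_norm lam g
      + 1 / \<delta> * L1_norm g)" if g: "g \<in> A_space lam" and \<delta>: "0 < \<delta>" "\<delta> \<le> \<delta>0" for g \<delta>
  proof -
    obtain C where "cheb_series g (cheb_coeff g) E q (A_norm lam g) C m0" using series[OF g] by blast
    then interpret cheb_series g "cheb_coeff g" E q "A_norm lam g" C m0 .
    have "(real (m1 + 1))\<^sup>2 \<le> 2 / \<delta>"
      using \<delta> by (simp add: \<delta>0_def field_simps)
    then have "real (m1 + 1) \<le> sqrt (2 / \<delta>)" by (rule real_le_rsqrt)
    then have fl: "int (m1 + 1) \<le> \<lfloor>sqrt (2 / \<delta>)\<rfloor>" by (simp add: le_floor_iff)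
    \<comment> \<open>For this \<open>m\<close> one has \<open>(m + 1)^2 \<le> 2 / \<delta>\<close>,
      which turns the factor \<open>(m + 1)^2 / 2\<close> of the \<open>L1\<close> norm into
      \<open>1 / \<delta>\<close>.\<close>
    define m where "m = nat (\<lfloor>sqrt (2 / \<delta>)\<rfloor> - 1)"
    have "0 \<le> \<lfloor>sqrt (2 / \<delta>)\<rfloor> - 1" using fl by linarith
    then have m: "\<lfloor>sqrt (2 / \<delta>)\<rfloor> - 1 = int m" by (simp add: m_def)
    then have m1: "m1 \<le> m" using fl by linarith
    have "real (m + 1) = real_of_int \<lfloor>sqrt (2 / \<delta>)\<rfloor>" using m by linarith
    also have "\<dots> \<le> sqrt (2 / \<delta>)" by (rule of_int_floor_le)
    finally have "(real (m + 1))\<^sup>2 \<le> (sqrt (2 / \<delta>))\<^sup>2" by (intro power_mono) auto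
    then have m2: "(real (m + 1))\<^sup>2 / 2 \<le> 1 / \<delta>" using \<delta> by simp
    have "cmod (g x) \<le> c * E m * A_norm lam g + 1 / \<delta> * L1_norm g" if x: "x \<in> {-1<..<1}" for x
    proof -
      have "cmod (g x) \<le> 20 / (1 - q)\<^sup>2 * E m * A_norm lam g + (real (m + 1))\<^sup>2 / 2 * L1_norm g"
        unfolding L1_norm_def by (rule sup_le_L1) (use m1 x in \<open>auto simp: m1_def\<close>)
      also have "\<dots> \<le> c * E m * A_norm lam g + 1 / \<delta> * L1_norm g"
        using m2 by (intro add_mono le_c c_ge E mult_right_mono) (auto simp: L1_norm_def)
      finally show ?thesis .
    qed
    then have "Linf_norm g \<le> ereal (c * E m * A_norm lam g + 1 / \<delta> * L1_norm g)"
      by (intro Linf_norm_le A_space_continuous g)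
    then show ?thesis unfolding m by (simp add: E_def)
  qed
  show ?thesis
  proof (intro conjI ballI allI impI banach_on_A_space)
    fix g assume g: "g \<in> A_space lam"
    show "cheb_expansion (cheb_coeff g) g"
      unfolding A_space_cheb_coeff[OF g] by (rule A_space_cheb_expansion(1)[OF g])
    show "cmod (cheb_coeff g n) \<le> 2 * exp_minus (lam_star lam (real n)) * A_norm lam g"
      if "(lam \<longlongrightarrow> lam 0) (at_right 0) \<or> - lam 0 < lam_star lam (real n)" for n
      unfolding A_space_cheb_coeff[OF g] by (rule A_space_cheb_expansion(2)[OF g that])
  next
    show "\<exists>c>0.
        (\<exists>m0::nat. \<forall>g\<in>A_space lam. \<forall>m\<ge>m0.
           Linf_norm (\<lambda>x. g x - L2_proj cheb_measure m g x)
             \<le> ereal (c * exp_minus (lam_star lam (real m)) * A_norm lam g) \<and>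
           Linf_norm (\<lambda>x. g x - L2_proj unit_lborel m g x)
             \<le> ereal (c * sqrt (real (m + 1)) * exp_minus (lam_star lam (real (m + 1)))
                        * A_norm lam g)) \<and>
        (\<exists>\<delta>0>0. \<forall>g\<in>A_space lam. \<forall>\<delta>::real. 0 < \<delta> \<and> \<delta> \<le> \<delta>0 \<longrightarrow>
           Linf_norm g
             \<le> ereal (c * exp_minus (lam_star lam (real_of_int (\<lfloor>sqrt (2 / \<delta>)\<rfloor> - 1)))
                        * A_norm lam g
                      + 1 / \<delta> * L1_norm g))"
    proof (rule exI[of _ c], intro conjI c)
      show "\<exists>m0::nat. \<forall>g\<in>A_space lam. \<forall>m\<ge>m0.
           Linf_norm (\<lambda>x. g x - L2_proj cheb_measure m g x)
             \<le> ereal (c * exp_minus (lam_star lam (real m)) * A_norm lam g) \<and>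
           Linf_norm (\<lambda>x. g x - L2_proj unit_lborel m g x)
             \<le> ereal (c * sqrt (real (m + 1)) * exp_minus (lam_star lam (real (m + 1)))
                        * A_norm lam g)"
        using proj unfolding E_def by blast
      show "\<exists>\<delta>0>0. \<forall>g\<in>A_space lam. \<forall>\<delta>::real. 0 < \<delta> \<and> \<delta> \<le> \<delta>0 \<longrightarrow>
           Linf_norm g
             \<le> ereal (c * exp_minus (lam_star lam (real_of_int (\<lfloor>sqrt (2 / \<delta>)\<rfloor> - 1)))
                        * A_norm lam g
                      + 1 / \<delta> * L1_norm g)"
        using \<delta>0 interp by blast
    qed
  qed
qed

end
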